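(* For every $\varepsilon>0$, as $H\to\infty$, \[ E_3(H) = 8\Bigl(\frac{\pi^2}{6}+\frac14\Bigr)H^2 + O_\varepsilon\bigl(H^{1.5+\varepsilon}\bigr). \]
   Context: For a real number $H>0$ and an integer $n\ge 3$, $E_n(H)$ denotes the number of integer vectors $(a_1,\dots,a_n)\in(\mathbb Z\cap[-H,H])^n$ such that the Galois group $G_f$ (the automorphism group of the splitting field over $\mathbb Q$) of $f(X)=X^n+a_1X^{n-1}+\cdots+a_{n-1}X+a_n$ is not isomorphic to the symmetric group $S_n$, where $G_f$ is regarded as a subgroup of $S_n$ via its action on the roots; inseparable polynomials are counted (their Galois group is not isomorphic to $S_n$). *)

theory Defs
  imports Complex_Main "HOL-Algebra.Sym_Groups" "HOL-Computational_Algebra.Polynomial"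
    "HOL-Library.Landau_Symbols"
begin

definition cubic_poly :: "int \<Rightarrow> int \<Rightarrow> int \<Rightarrow> complex poly" where
  "cubic_poly a1 a2 a3 = [:of_int a3, of_int a2, of_int a1, 1:]"

definition is_subfield_C :: "complex set \<Rightarrow> bool" where
  "is_subfield_C S \<longleftrightarrow> 0 \<in> S \<and> 1 \<in> S \<and>
     (\<forall>x\<in>S. \<forall>y\<in>S. x + y \<in> S \<and> x - y \<in> S \<and> x * y \<in> S) \<and>
     (\<forall>x\<in>S. x \<noteq> 0 \<longrightarrow> inverse x \<in> S)"

definition splitting_field_C :: "complex poly \<Rightarrow> complex set" where
  "splitting_field_C p = \<Inter>{S. is_subfield_C S \<and> {z. poly p z = 0} \<subseteq> S}"

text \<open>Galois group: field automorphisms of the splitting field (these automatically fix Q),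
  made extensional outside the field, with composition as group law.\<close>
definition galois_group_C :: "complex poly \<Rightarrow> (complex \<Rightarrow> complex) monoid" where
  "galois_group_C p = (let K = splitting_field_C p in
     \<lparr> carrier = {\<sigma>. bij_betw \<sigma> K K \<and>
                     (\<forall>x\<in>K. \<forall>y\<in>K. \<sigma> (x + y) = \<sigma> x + \<sigma> y \<and> \<sigma> (x * y) = \<sigma> x * \<sigma> y) \<and>
                     \<sigma> 1 = 1 \<and> (\<forall>z. z \<notin> K \<longrightarrow> \<sigma> z = z)},
       mult = (\<lambda>\<sigma> \<tau>. \<sigma> \<circ> \<tau>),
       one = id \<rparr>)"

definition not_S3 :: "int \<Rightarrow> int \<Rightarrow> int \<Rightarrow> bool" where
  "not_S3 a1 a2 a3 \<longleftrightarrow> \<not> rsquarefree (cubic_poly a1 a2 a3) \<or>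
      \<not> (galois_group_C (cubic_poly a1 a2 a3) \<cong> sym_group 3)"

definition E3 :: "real \<Rightarrow> nat" where
  "E3 H = card {(a1 :: int, a2 :: int, a3 :: int).
      \<bar>real_of_int a1\<bar> \<le> H \<and> \<bar>real_of_int a2\<bar> \<le> H \<and> \<bar>real_of_int a3\<bar> \<le> H \<and> not_S3 a1 a2 a3}"

end

theory Submission
  imports Defs "HOL-Analysis.Analysis" "HOL-Computational_Algebra.Computational_Algebra"
    "HOL-Computational_Algebra.Field_as_Ring" "HOL-Real_Asymp.Real_Asymp"
begin

text \<open>A monic integer cubic whose Galois group is not S3 has an integer root or a square discriminant.

  The cubics with a root r are counted by their factorisations (X - r)(X^2 + sX + t): the number of pairs
  (s, t) is (2H + 1)^2 for r = 0, about 3H^2 for r = 1 and r = -1, and about 4H^2 / r^2 otherwise, while the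
  cubics with more than one factorisation split completely and are negligible.

  If the discriminant of X^3 + aX^2 + bX + c is a square y^2, put P = a^2 - 3b and
  J = 9ab - 2a^3 - 27c, so that J^2 + 27y^2 = 4P^3. Hence the Eisenstein integer
  (J + 3y sqrt(-3))/2 has norm P^3, and unique factorisation writes it as
  N(\<delta>)\<delta>\<kappa>^3 with N(\<delta>)N(\<kappa>) = P; the triple (a, \<delta>, \<kappa>) determines the cubic. For a of order A
  with H < A^2, the bound on y confines \<delta>\<kappa>^3 to a thin neighbourhood of the real axis. Fixing the smaller of
  \<delta> and \<kappa>, the other one is then an Eisenstein integer in at most three thin strips, and the number of such points
  is estimated by packing. As a^2 = P + O(H), each pair (\<delta>, \<kappa>) admits O(H/A) values of a. Altogether
  this gives O(H^(3/2)) cubics up to powers of log H, without any divisor bound.\<close>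

section \<open>The Galois group of a cubic\<close>

text \<open>The set to be counted lies between the cubics with an integer root and the union of
  these with the cubics of square discriminant. As the latter are negligible, an upper bound for
  them suffices. Values |a| \<le> 3 sqrt H escape the strip argument. For them P \<le> 12H, and the
  pairs (\<delta>, \<kappa>) with N(\<delta>)N(\<kappa>) \<le> 12H number O(H) up to logarithms, so
  O(sqrt H) values of a for each pair are affordable. Larger |a| are cut dyadically, at the price of
  one logarithm. The smaller of \<delta> and \<kappa> is the one to fix because its modulus k
  satisfies k^2 = O(A). The boundary terms of the strip count are then no larger than its main terms
  A/k and sqrt H / k, and with the O(H/A) values of a each choice contributes O(H^(3/2) / k^2). The
  sum of 1/k^2 over Eisenstein integers is only a power of log H. Divisor bounds are replaced by
  weights: a tuple of product at most B gets weight B/product, which is at least 1, and the total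
  weight factors into harmonic sums. Units cost nothing: N(\<delta>)\<delta> = \<delta> for a unit
  \<delta>.\<close>

definition evq :: "rat poly \<Rightarrow> complex \<Rightarrow> complex" where
  "evq p z = poly (map_poly of_rat p) z"

lemma evq_0 [simp]: "evq 0 z = 0"
  by (simp add: evq_def)

lemma evq_pCons [simp]: "evq (pCons q p) z = of_rat q + z * evq p z"
  by (simp add: evq_def map_poly_pCons)

lemma evq_1 [simp]: "evq 1 z = 1"
  by (simp add: one_pCons)

lemma evq_add [simp]: "evq (p + q) z = evq p z + evq q z"
proof -
  have "map_poly of_rat (p + q) = (map_poly of_rat p + map_poly of_rat q :: complex poly)"
    by (rule poly_eqI) (simp add: coeff_map_poly of_rat_add)
  then show ?thesis by (simp add: evq_def)
qed

lemma evq_smult [simp]: "evq (smult r p) z = of_rat r * evq p z"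
proof -
  have "map_poly of_rat (smult r p) = (smult (of_rat r) (map_poly of_rat p) :: complex poly)"
    by (rule poly_eqI) (simp add: coeff_map_poly of_rat_mult)
  then show ?thesis by (simp add: evq_def)
qed

lemma evq_minus [simp]: "evq (- p) z = - evq p z"
  using evq_smult[of "-1" p z] by (simp add: of_rat_minus)

lemma evq_diff [simp]: "evq (p - q) z = evq p z - evq q z"
  using evq_add[of p "- q" z] by simp

lemma evq_mult [simp]: "evq (p * q) z = evq p z * evq q z"
  by (induction p) (simp_all add: algebra_simps)

lemma rat_root_of_monic_int_cubic:
  fixes r :: rat and a b c :: int
  assumes "r ^ 3 + of_int a * r ^ 2 + of_int b * r + of_int c = 0"
  shows "\<exists>k::int. k ^ 3 + a * k ^ 2 + b * k + c = 0"
proof -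
  obtain p q :: int where pq: "quotient_of r = (p, q)" by fastforce
  have q: "q > 0" "coprime p q" and r: "r = of_int p / of_int q"
    using pq quotient_of_denom_pos quotient_of_coprime quotient_of_div by blast+
  have "of_int p ^ 3 + of_int a * of_int p ^ 2 * of_int q + of_int b * of_int p * of_int q ^ 2
        + of_int c * of_int q ^ 3 = (0 :: rat)"
    using assms q unfolding r by (simp add: field_simps power2_eq_square power3_eq_cube)
  then have "of_int (p ^ 3 + a * p ^ 2 * q + b * p * q ^ 2 + c * q ^ 3) = (0 :: rat)"
    by simp
  then have "p ^ 3 + a * p ^ 2 * q + b * p * q ^ 2 + c * q ^ 3 = 0"
    using of_int_eq_0_iff by blast
  then have "p ^ 3 = q * (- (a * p ^ 2 + b * p * q + c * q ^ 2))"
    by (simp add: algebra_simps power2_eq_square power3_eq_cube)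
  then have "q dvd p ^ 3" by simp
  moreover have "coprime q (p ^ 3)" using q by (simp add: coprime_commute)
  ultimately have "is_unit q" using coprime_common_divisor[of q "p ^ 3" q] by simp
  then have "q = 1" using q by simp
  then have "of_int (p ^ 3 + a * p ^ 2 + b * p + c) = (0 :: rat)" using assms unfolding r by simp
  then show ?thesis using of_int_eq_0_iff by blast
qed

lemma int_square_if_rat_square:
  fixes r :: rat and d :: int
  assumes "r ^ 2 = of_int d"
  shows "\<exists>k::int. d = k ^ 2"
proof -
  obtain p q :: int where pq: "quotient_of r = (p, q)" by fastforce
  have q: "q > 0" "coprime p q" and r: "r = of_int p / of_int q"
    using pq quotient_of_denom_pos quotient_of_coprime quotient_of_div by blast+
  have "of_int (p ^ 2) = (of_int (d * q ^ 2) :: rat)"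
    using assms q unfolding r by (simp add: field_simps power2_eq_square)
  then have e: "p ^ 2 = d * q ^ 2" using of_int_eq_iff by blast
  have "q dvd d * q ^ 2" by simp
  then have "q dvd p ^ 2" unfolding e .
  moreover have "coprime q (p ^ 2)" using q by (simp add: coprime_commute)
  ultimately have "is_unit q" using coprime_common_divisor[of q "p ^ 2" q] by simp
  then have "q = 1" using q by simp
  then show ?thesis using e by auto
qed

definition disc3 :: "int \<Rightarrow> int \<Rightarrow> int \<Rightarrow> int" where
  "disc3 a b c = a^2 * b^2 - 4 * b^3 - 4 * a^3 * c + 18 * a * b * c - 27 * c^2"

section \<open>Subfields of the complex numbers and automorphisms of a splitting field\<close>

lemma is_subfield_C_Int:
  "(\<And>S. S \<in> \<S> \<Longrightarrow> is_subfield_C S) \<Longrightarrow> is_subfield_C (\<Inter>\<S>)"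
  unfolding is_subfield_C_def by blast

lemma is_subfield_splitting_field_C: "is_subfield_C (splitting_field_C p)"
  unfolding splitting_field_C_def by (rule is_subfield_C_Int) blast

lemma roots_in_splitting_field_C: "poly p z = 0 \<Longrightarrow> z \<in> splitting_field_C p"
  by (auto simp: splitting_field_C_def)

lemma splitting_field_C_least:
  "is_subfield_C S \<Longrightarrow> (\<And>z. poly p z = 0 \<Longrightarrow> z \<in> S) \<Longrightarrow> splitting_field_C p \<subseteq> S"
  unfolding splitting_field_C_def by blast

lemma is_subfield_C_D:
  assumes "is_subfield_C S"
  shows "0 \<in> S" "1 \<in> S" "x \<in> S \<Longrightarrow> y \<in> S \<Longrightarrow> x + y \<in> S" "x \<in> S \<Longrightarrow> y \<in> S \<Longrightarrow> x - y \<in> S"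
    "x \<in> S \<Longrightarrow> y \<in> S \<Longrightarrow> x * y \<in> S" "x \<in> S \<Longrightarrow> - x \<in> S" "x \<in> S \<Longrightarrow> inverse x \<in> S"
    "of_int k \<in> S" "of_rat r \<in> S"
proof -
  show 0: "0 \<in> S" and 1: "1 \<in> S" and add: "\<And>x y. x \<in> S \<Longrightarrow> y \<in> S \<Longrightarrow> x + y \<in> S"
    and diff: "\<And>x y. x \<in> S \<Longrightarrow> y \<in> S \<Longrightarrow> x - y \<in> S"
    and mult: "\<And>x y. x \<in> S \<Longrightarrow> y \<in> S \<Longrightarrow> x * y \<in> S"
    using assms by (auto simp: is_subfield_C_def)
  show min: "\<And>x. x \<in> S \<Longrightarrow> - x \<in> S" using diff[OF 0] by simp
  show inv: "\<And>x. x \<in> S \<Longrightarrow> inverse x \<in> S"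
    using assms 0 unfolding is_subfield_C_def by (metis inverse_zero)
  have nat: "of_nat n \<in> S" for n by (induction n) (use 0 1 add in auto)
  show int: "\<And>k. of_int k \<in> S"
    by (case_tac k rule: int_cases2) (use nat min in auto)
  obtain p q where "quotient_of r = (p, q)" by fastforce
  then have "r = of_int p / of_int q" by (rule quotient_of_div)
  then have "(of_rat r :: complex) = of_int p * inverse (of_int q)"
    by (simp add: divide_inverse of_rat_mult of_rat_inverse)
  then show "of_rat r \<in> S" using int mult inv by simp
qed

lemma evq_in_subfield: "is_subfield_C S \<Longrightarrow> z \<in> S \<Longrightarrow> evq p z \<in> S"
  by (induction p) (auto intro: is_subfield_C_D)

lemma galois_group_C_carrier:
  "\<sigma> \<in> carrier (galois_group_C p) \<longleftrightarrow>
     bij_betw \<sigma> (splitting_field_C p) (splitting_field_C p) \<and>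
     (\<forall>x\<in>splitting_field_C p. \<forall>y\<in>splitting_field_C p. \<sigma> (x + y) = \<sigma> x + \<sigma> y \<and> \<sigma> (x * y) = \<sigma> x * \<sigma> y) \<and>
     \<sigma> 1 = 1 \<and> (\<forall>z. z \<notin> splitting_field_C p \<longrightarrow> \<sigma> z = z)"
  by (simp add: galois_group_C_def Let_def)

lemma galois_group_C_mult: "mult (galois_group_C p) = (\<lambda>\<sigma> \<tau>. \<sigma> \<circ> \<tau>)"
  by (simp add: galois_group_C_def Let_def)

lemma galois_hom:
  assumes "\<sigma> \<in> carrier (galois_group_C p)" "x \<in> splitting_field_C p" "y \<in> splitting_field_C p"
  shows "\<sigma> (x + y) = \<sigma> x + \<sigma> y" "\<sigma> (x * y) = \<sigma> x * \<sigma> y" "\<sigma> (x - y) = \<sigma> x - \<sigma> y"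
    "\<sigma> 0 = 0" "\<sigma> 1 = 1" "x \<noteq> 0 \<Longrightarrow> \<sigma> (inverse x) = inverse (\<sigma> x)" "\<sigma> (of_int k) = of_int k"
    "\<sigma> x \<in> splitting_field_C p"
proof -
  define K where "K = splitting_field_C p"
  have sf: "is_subfield_C K" unfolding K_def by (rule is_subfield_splitting_field_C)
  note K = is_subfield_C_D[OF sf]
  have add: "\<sigma> (x + y) = \<sigma> x + \<sigma> y" if "x \<in> K" "y \<in> K" for x y
    using assms(1) that by (simp add: galois_group_C_carrier K_def)
  have mult: "\<sigma> (x * y) = \<sigma> x * \<sigma> y" if "x \<in> K" "y \<in> K" for x y
    using assms(1) that by (simp add: galois_group_C_carrier K_def)
  show one: "\<sigma> 1 = 1" using assms(1) by (simp add: galois_group_C_carrier)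
  have xy: "x \<in> K" "y \<in> K" using assms by (simp_all add: K_def)
  show "\<sigma> (x + y) = \<sigma> x + \<sigma> y" "\<sigma> (x * y) = \<sigma> x * \<sigma> y" using add mult xy by auto
  have diff: "\<sigma> (x - y) = \<sigma> x - \<sigma> y" if "x \<in> K" "y \<in> K" for x y
    using add[of "x - y" y] K(4)[of x y] that by simp
  then show "\<sigma> (x - y) = \<sigma> x - \<sigma> y" using xy by simp
  show zero: "\<sigma> 0 = 0" using diff[of 0 0] K by simp
  show "\<sigma> (inverse x) = inverse (\<sigma> x)" if "x \<noteq> 0"
  proof -
    have "\<sigma> x * \<sigma> (inverse x) = 1" using mult[of x "inverse x"] xy K that one by simp
    then show ?thesis by (metis inverse_unique)
  qed
  have nat: "\<sigma> (of_nat n) = of_nat n" for n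
  proof (induction n)
    case (Suc n)
    then show ?case using add[of 1 "of_nat n"] K(2) K(8)[of "int n"] one by simp
  qed (use zero in simp)
  show "\<sigma> (of_int k) = of_int k"
  proof (cases k rule: int_cases2)
    case (nonneg n) then show ?thesis using nat by simp
  next
    case (nonpos n)
    then show ?thesis using diff[of 0 "of_nat n"] K(1) K(8)[of "int n"] zero nat by simp
  qed
  show "\<sigma> x \<in> splitting_field_C p" using assms by (auto simp: galois_group_C_carrier bij_betw_def)
qed

text \<open>The points of the splitting field where two automorphisms agree form a subfield. If it
  contains the roots, minimality makes it everything. Outside the field both maps are the identity
  by the extensional definition.\<close>

lemma galois_eqI:
  assumes \<sigma>: "\<sigma> \<in> carrier (galois_group_C p)" and \<tau>: "\<tau> \<in> carrier (galois_group_C p)"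
    and eq: "\<And>z. poly p z = 0 \<Longrightarrow> \<sigma> z = \<tau> z"
  shows "\<sigma> = \<tau>"
proof
  fix z
  define K where "K = splitting_field_C p"
  have sf: "is_subfield_C K" unfolding K_def by (rule is_subfield_splitting_field_C)
  note K = is_subfield_C_D[OF sf]
  note h1 = galois_hom[OF \<sigma>, folded K_def] and h2 = galois_hom[OF \<tau>, folded K_def]
  define S where "S = {z \<in> K. \<sigma> z = \<tau> z}"
  have "is_subfield_C S" unfolding is_subfield_C_def
  proof (intro conjI ballI impI)
    show "0 \<in> S" "1 \<in> S" using h1(4,5)[OF K(1) K(1)] h2(4,5)[OF K(1) K(1)] K by (auto simp: S_def)
  next
    fix x y assume "x \<in> S" "y \<in> S"
    then show "x + y \<in> S" "x - y \<in> S" "x * y \<in> S"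
      using h1(1-3)[of x y] h2(1-3)[of x y] K by (auto simp: S_def)
  next
    fix x assume "x \<in> S" "x \<noteq> 0"
    then show "inverse x \<in> S" using h1(6)[of x x] h2(6)[of x x] K by (auto simp: S_def)
  qed
  then have "K \<subseteq> S" unfolding K_def
    by (rule splitting_field_C_least) (auto simp: S_def K_def eq intro: roots_in_splitting_field_C)
  then show "\<sigma> z = \<tau> z"
  proof (cases "z \<in> K")
    case False
    then show ?thesis using \<sigma> \<tau> by (simp add: galois_group_C_carrier K_def)
  qed (auto simp: S_def)
qed

lemma poly_cubic_poly: "poly (cubic_poly a b c) z = z ^ 3 + of_int a * z ^ 2 + of_int b * z + of_int c"
  by (simp add: cubic_poly_def algebra_simps power2_eq_square power3_eq_cube)

lemma galois_maps_roots:
  assumes \<sigma>: "\<sigma> \<in> carrier (galois_group_C (cubic_poly a b c))" and z: "poly (cubic_poly a b c) z = 0"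
  shows "poly (cubic_poly a b c) (\<sigma> z) = 0"
proof -
  define K where "K = splitting_field_C (cubic_poly a b c)"
  have sf: "is_subfield_C K" unfolding K_def by (rule is_subfield_splitting_field_C)
  note K = is_subfield_C_D[OF sf]
  have zK: "z \<in> K" using z by (simp add: K_def roots_in_splitting_field_C)
  note h = galois_hom[OF \<sigma>, folded K_def]
  have "\<sigma> (z * (z * z) + of_int a * (z * z) + of_int b * z + of_int c)
     = \<sigma> z * (\<sigma> z * \<sigma> z) + of_int a * (\<sigma> z * \<sigma> z) + of_int b * \<sigma> z + of_int c"
    using zK by (simp add: h(1,2,7) K)
  moreover have "z * (z * z) + of_int a * (z * z) + of_int b * z + of_int c = 0"
    using z by (simp add: poly_cubic_poly power2_eq_square power3_eq_cube mult.assoc)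
  ultimately show ?thesis using h(4)[OF zK zK]
    by (simp add: poly_cubic_poly power2_eq_square power3_eq_cube mult.assoc)
qed

text \<open>An automorphism fixes r, and since u + v = -s it is determined by its value at u, which
  is u or v. So the group has at most 2 elements instead of 6. The argument allows coincidences
  among r, u and v, so inseparable cubics need no case of their own.\<close>

lemma int_root_imp_not_S3:
  assumes "r ^ 3 + a * r ^ 2 + b * r + c = 0"
  shows "not_S3 a b c"
proof -
  let ?p = "cubic_poly a b c"
  define s t where "s = a + r" and "t = b + r * s"
  have c: "c = - r * t" using assms by (simp add: s_def t_def algebra_simps power2_eq_square power3_eq_cube)
  have a: "a = s - r" and b: "b = t - r * s" by (simp_all add: s_def t_def)
  have fac: "poly ?p z = (z - of_int r) * (z ^ 2 + of_int s * z + of_int t)" for z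
    unfolding poly_cubic_poly c unfolding a b by (simp add: algebra_simps power2_eq_square power3_eq_cube)
  define d where "d = csqrt (of_int (s^2 - 4 * t))"
  define u v where "u = (- of_int s + d) / 2" and "v = (- of_int s - d) / 2"
  have d2: "d ^ 2 = of_int s ^ 2 - 4 * of_int t" by (simp add: d_def)
  have uv: "v = - of_int s - u" by (simp add: u_def v_def field_simps)
  have "z ^ 2 + of_int s * z + of_int t = (z - u) * (z - v)" for z
  proof -
    have "(z - u) * (z - v) = z ^ 2 + of_int s * z + (of_int s ^ 2 - d ^ 2) / 4"
      by (simp add: u_def v_def field_simps power2_eq_square)
    then show ?thesis using d2 by simp
  qed
  then have roots: "poly ?p z = 0 \<longleftrightarrow> z = of_int r \<or> z = u \<or> z = v" for z by (simp add: fac)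
  have False if iso: "galois_group_C ?p \<cong> sym_group 3"
  proof -
    let ?G = "carrier (galois_group_C ?p)"
    define K where "K = splitting_field_C ?p"
    have sf: "is_subfield_C K" unfolding K_def by (rule is_subfield_splitting_field_C)
    note K = is_subfield_C_D[OF sf]
    have uK: "u \<in> K" unfolding K_def by (rule roots_in_splitting_field_C) (simp add: roots)
    have "inj_on (\<lambda>\<sigma>. \<sigma> u) ?G"
    proof (rule inj_onI)
      fix \<sigma> \<tau> assume st: "\<sigma> \<in> ?G" "\<tau> \<in> ?G" "\<sigma> u = \<tau> u"
      have r: "\<sigma> (of_int r) = of_int r" if "\<sigma> \<in> ?G" for \<sigma>
        using galois_hom(7)[OF that, folded K_def, OF uK uK] .
      have v: "\<sigma> v = - of_int s - \<sigma> u" if "\<sigma> \<in> ?G" for \<sigma>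
        using galois_hom(3)[OF that, folded K_def, of "of_int (- s)" u]
          galois_hom(7)[OF that, folded K_def, OF uK uK, of "- s"] uK K(8)[of "- s"] uv by simp
      show "\<sigma> = \<tau>"
      proof (rule galois_eqI[OF st(1,2)])
        fix z assume "poly ?p z = 0"
        then consider "z = of_int r" | "z = u" | "z = v" using roots by blast
        then show "\<sigma> z = \<tau> z"
          by cases (simp_all only: r[OF st(1)] r[OF st(2)] v[OF st(1)] v[OF st(2)] st(3))
      qed
    qed
    moreover have "\<sigma> u \<in> {u, v}" if \<sigma>: "\<sigma> \<in> ?G" for \<sigma>
    proof -
      have "poly ?p (\<sigma> u) = 0" by (rule galois_maps_roots[OF \<sigma>]) (simp add: roots)
      then consider "\<sigma> u \<in> {u, v}" | "\<sigma> u = of_int r" by (auto simp: roots)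
      then show ?thesis
      proof cases
        \<comment> \<open>Here \<open>\<sigma>\<close> sends both u and r to r, so injectivity gives
          u = r.\<close>
        case 2
        then have "\<sigma> u = \<sigma> (of_int r)" using galois_hom(7)[OF \<sigma>, folded K_def, OF uK uK] by simp
        moreover have "inj_on \<sigma> K" using \<sigma> by (simp add: galois_group_C_carrier bij_betw_def K_def)
        ultimately have "u = of_int r" using uK K(8) by (auto dest: inj_onD)
        then show ?thesis using 2 by simp
      qed
    qed
    ultimately have "card ?G \<le> card {u, v}" by (intro card_inj_on_le) auto
    also have "\<dots> \<le> 2" by (simp add: card_insert_if)
    finally have "card ?G \<le> 2" .
    moreover from iso obtain h where "bij_betw h ?G (carrier (sym_group 3))"
      by (auto simp: is_iso_def iso_def)
    then have "card ?G = fact 3" using sym_group_card_carrier by (metis bij_betw_same_card)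
    ultimately show False by (simp add: eval_nat_numeral)
  qed
  then show ?thesis unfolding not_S3_def by blast
qed

section \<open>The splitting field of a cubic without rational root and with non-square
  discriminant\<close>

locale generic_cubic =
  fixes a b c :: int and x1 x2 x3 :: complex
  assumes e1: "x1 + x2 + x3 = - of_int a"
    and e2: "x1 * x2 + x1 * x3 + x2 * x3 = of_int b"
    and e3: "x1 * x2 * x3 = - of_int c"
    and distinct: "x1 \<noteq> x2" "x1 \<noteq> x3" "x2 \<noteq> x3"
    and no_root: "\<And>r::rat. r ^ 3 + of_int a * r ^ 2 + of_int b * r + of_int c \<noteq> 0"
    and no_sqrt: "\<And>r::rat. r ^ 2 \<noteq> of_int (disc3 a b c)"
begin

text \<open>The locale assumptions are symmetric in the roots. Everything proved about the ordering
  x1, x2, x3 can therefore be reused for the other orderings, which this transposition and the next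
  one generate.\<close>

lemma swap12: "generic_cubic a b c x2 x1 x3"
  by unfold_locales (use e1 e2 e3 distinct no_root no_sqrt in \<open>simp_all add: algebra_simps\<close>)

lemma swap23: "generic_cubic a b c x1 x3 x2"
  by unfold_locales (use e1 e2 e3 distinct no_root no_sqrt in \<open>simp_all add: algebra_simps\<close>)

abbreviation "fp \<equiv> cubic_poly a b c"

lemma poly_fp: "poly fp z = (z - x1) * (z - x2) * (z - x3)"
proof -
  have "(z - x1) * (z - x2) * (z - x3) =
     z ^ 3 - (x1 + x2 + x3) * z ^ 2 + (x1 * x2 + x1 * x3 + x2 * x3) * z - x1 * x2 * x3"
    by (simp add: algebra_simps power2_eq_square power3_eq_cube)
  then show ?thesis unfolding e1 e2 e3 poly_cubic_poly by simp
qed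

lemma roots_fp: "poly fp z = 0 \<longleftrightarrow> z = x1 \<or> z = x2 \<or> z = x3"
  by (simp add: poly_fp)

definition fQ :: "rat poly" where "fQ = [:of_int c, of_int b, of_int a, 1:]"

lemma evq_fQ: "evq fQ z = poly fp z"
  by (simp add: fQ_def poly_cubic_poly algebra_simps power2_eq_square power3_eq_cube)

lemma degree_fQ: "degree fQ = 3"
  by (simp add: fQ_def)

lemma fQ_neq_0: "fQ \<noteq> 0"
  by (simp add: fQ_def)

lemma poly_fQ_neq_0: "poly fQ r \<noteq> 0"
  using no_root[of r] by (simp add: fQ_def algebra_simps power2_eq_square power3_eq_cube)

text \<open>In degree 3 a proper factorisation contains a linear factor, hence a rational
  root.\<close>

lemma irreducible_fQ: "irreducible fQ"
proof (rule irreducibleI)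
  show "fQ \<noteq> 0" using degree_fQ by auto
  show "\<not> is_unit fQ" using degree_fQ is_unit_iff_degree[OF fQ_neq_0] by simp
next
  fix p q assume pq: "fQ = p * q"
  then have nz: "p \<noteq> 0" "q \<noteq> 0" using degree_fQ by auto
  have lin: False if s: "degree s = 1" "s dvd fQ" for s
  proof -
    define u v where "u = coeff s 0" and "v = coeff s 1"
    have "v \<noteq> 0" using s(1) leading_coeff_0_iff[of s] by (auto simp: v_def)
    moreover have "poly s z = u + z * v" for z
      using s(1) by (simp add: poly_altdef u_def v_def)
    ultimately have "poly s (- u / v) = 0" by simp
    moreover obtain k where "fQ = s * k" using s(2) by (rule dvdE)
    ultimately have "poly fQ (- u / v) = 0" by simp
    then show False using poly_fQ_neq_0 by blast
  qed
  have "degree p + degree q = 3" using degree_mult_eq[OF nz] degree_fQ by (simp add: pq)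
  moreover have "degree p \<noteq> 1" using lin[of p] dvd_triv_left[of p q] unfolding pq by blast
  moreover have "degree q \<noteq> 1" using lin[of q] dvd_triv_right[of q p] unfolding pq by blast
  ultimately have "degree p = 0 \<or> degree q = 0" by linarith
  then show "is_unit p \<or> is_unit q" using nz by (auto simp: is_unit_iff_degree)
qed

text \<open>A Bezout coefficient inverts p modulo \<open>fQ\<close>. The same w serves all roots, so
  the inversion is compatible with passing from one root to another.\<close>

lemma evq_inverse:
  assumes "\<not> fQ dvd p"
  shows "\<exists>w. \<forall>z. poly fp z = 0 \<longrightarrow> evq w z * evq p z = 1"
proof -
  have "prime_elem fQ" using irreducible_fQ by (rule field_poly_irreducible_imp_prime)
  then have "coprime fQ p" using assms by (rule prime_elem_imp_coprime)
  then have "fst (bezout_coefficients fQ p) * fQ + snd (bezout_coefficients fQ p) * p = 1"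
    by (metis bezout_coefficients_fst_snd coprime_imp_gcd_eq_1)
  then have id: "evq (fst (bezout_coefficients fQ p) * fQ + snd (bezout_coefficients fQ p) * p) z = 1" for z
    by simp
  have "evq (snd (bezout_coefficients fQ p)) z * evq p z = 1" if "poly fp z = 0" for z
    using id[of z] that by (simp add: evq_fQ)
  then show ?thesis by blast
qed

lemma evq_eq_0: "fQ dvd p \<Longrightarrow> poly fp z = 0 \<Longrightarrow> evq p z = 0"
  by (auto elim!: dvdE simp: evq_fQ)

text \<open>\<open>fQ\<close> is the minimal polynomial of each of its roots: a rational relation
  satisfied by one root is satisfied by all. This is the source of all conjugation arguments
  below.\<close>

lemma evq_eq_0_imp_dvd: "poly fp z = 0 \<Longrightarrow> evq p z = 0 \<Longrightarrow> fQ dvd p"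
  using evq_inverse[of p] by fastforce

lemma sqrt_disc: "((x1 - x2) * (x1 - x3) * (x2 - x3)) ^ 2 = of_int (disc3 a b c)"
proof -
  have a: "of_int a = - (x1 + x2 + x3)" and c: "of_int c = - (x1 * x2 * x3)"
    using e1 e3 by simp_all
  show ?thesis unfolding disc3_def by (simp add: a c e2[symmetric]) algebra
qed

text \<open>If x2 were a polynomial in x1, so would be the square root d of the discriminant; as its square is
  rational, this polynomial takes the values d or -d at all three roots, and its trace is an odd multiple of d.\<close>

lemma x2_not_in_Q_x1: "x2 \<noteq> evq Z x1"
proof
  assume Z: "x2 = evq Z x1"
  \<comment> \<open>Since x3 = -a - x1 - x2, the third root is a polynomial in x1 as well, and so is
    the product of the root differences, represented by \<open>E\<close> below.\<close>
  define W where "W = [:- of_int a, - 1:] - Z"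
  have "x3 = (x1 + x2 + x3) - x1 - x2" by simp
  then have "x3 = - of_int a - x1 - x2" unfolding e1 .
  then have W: "evq W x1 = x3" by (simp add: W_def of_rat_minus flip: Z)
  define E where "E = ([:0, 1:] - Z) * ([:0, 1:] - W) * (Z - W)"
  define d where "d = (x1 - x2) * (x1 - x3) * (x2 - x3)"
  have "evq E x1 = d" by (simp add: E_def d_def W Z[symmetric])
  then have "evq (E * E - [:of_int (disc3 a b c):]) x1 = 0"
    using sqrt_disc by (simp add: d_def power2_eq_square)
  then have "fQ dvd E * E - [:of_int (disc3 a b c):]" using evq_eq_0_imp_dvd roots_fp by blast
  then have "evq E z * evq E z = d * d" if "poly fp z = 0" for z
    using evq_eq_0[OF _ that] sqrt_disc by (fastforce simp: d_def power2_eq_square)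
  then have Ed: "evq E z = d \<or> evq E z = - d" if "poly fp z = 0" for z
    using that by (metis square_eq_iff)
  \<comment> \<open>A representative of degree at most 2 makes the trace computable from the first
    two power sums of the roots, which are integers.\<close>
  define R where "R = E mod fQ"
  have ER: "evq E z = evq R z" if "poly fp z = 0" for z
  proof -
    have "E = (E div fQ) * fQ + R" by (simp add: R_def)
    then have "evq E z = evq ((E div fQ) * fQ + R) z" by simp
    then show ?thesis using that by (simp add: evq_fQ)
  qed
  have "R = 0 \<or> degree R < 3" using degree_mod_less[OF fQ_neq_0, of E] degree_fQ by (simp add: R_def)
  then have "degree R \<le> 2" by auto
  then obtain r0 r1 r2 where R: "R = [:r0, r1, r2:]"
  proof -
    have "R = [:coeff R 0, coeff R 1, coeff R 2:]"
    proof (rule poly_eqI)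
      fix n show "coeff R n = coeff [:coeff R 0, coeff R 1, coeff R 2:] n"
        using \<open>degree R \<le> 2\<close> coeff_eq_0[of R n]
        by (cases "n \<le> 2") (auto simp: le_Suc_eq numeral_2_eq_2 coeff_pCons split: nat.splits)
    qed
    then show ?thesis using that by blast
  qed
  have sq: "x1 * x1 + x2 * x2 + x3 * x3 = of_int (a * a - 2 * b)"
  proof -
    have "x1 * x1 + x2 * x2 + x3 * x3 = (x1 + x2 + x3) * (x1 + x2 + x3) - 2 * (x1 * x2 + x1 * x3 + x2 * x3)"
      by (simp add: algebra_simps)
    then show ?thesis unfolding e1 e2 by simp
  qed
  define q where "q = 3 * r0 + r1 * (- of_int a) + r2 * of_int (a * a - 2 * b)"
  have "evq R x1 + evq R x2 + evq R x3
     = 3 * of_rat r0 + of_rat r1 * (x1 + x2 + x3) + of_rat r2 * (x1 * x1 + x2 * x2 + x3 * x3)"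
    by (simp add: R algebra_simps)
  also have "\<dots> = of_rat q" unfolding e1 sq q_def
    by (simp add: of_rat_add of_rat_mult of_rat_minus of_rat_diff)
  finally have sum: "evq E x1 + evq E x2 + evq E x3 = of_rat q" using ER roots_fp by simp
  have "\<exists>q'. d = of_rat q'"
  proof -
    \<comment> \<open>Three signs add up to 1, -1, 3 or -3, never to 0.\<close>
    consider "of_rat q = d" | "of_rat q = - d" | "of_rat q = 3 * d" | "of_rat q = - 3 * d"
      using Ed[of x1] Ed[of x2] Ed[of x3] sum roots_fp by force
    then show ?thesis
    proof cases
      case 1 then show ?thesis by metis
    next
      case 2 then show ?thesis by (metis add.inverse_inverse of_rat_minus)
    next
      case 3 then have "d = of_rat (q / 3)" by (simp add: of_rat_divide)
      then show ?thesis by blast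
    next
      case 4 then have "d = of_rat (- q / 3)" by (simp add: of_rat_divide of_rat_minus)
      then show ?thesis by blast
    qed
  qed
  then obtain q' where "d = of_rat q'" by blast
  then have "of_rat (q' ^ 2) = (of_rat (of_int (disc3 a b c)) :: complex)"
    using sqrt_disc by (simp add: d_def of_rat_power)
  then have "q' ^ 2 = of_int (disc3 a b c)" using of_rat_eq_iff by blast
  then show False using no_sqrt by blast
qed

text \<open>The splitting field consists of the values A(x1) + B(x1) x2, where A and B are unique up to multiples
  of the minimal polynomial; automorphisms arise by evaluating at another pair of distinct roots.\<close>

definition val :: "rat poly \<Rightarrow> rat poly \<Rightarrow> complex \<Rightarrow> complex \<Rightarrow> complex" where
  "val A B u v = evq A u + evq B u * v"

text \<open>1 and x2 are linearly independent over Q(x1): if B(x1) were nonzero, dividing by it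
  would express x2 through x1.\<close>

lemma val_eq_0_imp_dvd:
  assumes "val A B x1 x2 = 0"
  shows "fQ dvd A \<and> fQ dvd B"
proof -
  have x1: "poly fp x1 = 0" by (simp add: roots_fp)
  have B: "fQ dvd B"
  proof (rule ccontr)
    assume "\<not> fQ dvd B"
    then obtain w where "\<forall>z. poly fp z = 0 \<longrightarrow> evq w z * evq B z = 1" using evq_inverse by blast
    then have w: "evq w x1 * evq B x1 = 1" using x1 by blast
    have "evq w x1 * (evq A x1 + evq B x1 * x2) = 0" using assms by (simp add: val_def)
    then have "evq w x1 * evq A x1 + x2 = 0" using w by (simp add: distrib_left mult.assoc[symmetric])
    then have "x2 = evq (- (w * A)) x1" by (simp add: add_eq_0_iff)
    then show False using x2_not_in_Q_x1 by blast
  qed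
  then have "evq A x1 = 0" using assms x1 by (simp add: val_def evq_eq_0)
  then show ?thesis using B evq_eq_0_imp_dvd x1 by blast
qed

lemma val_eq_0_transfer:
  assumes "val A B x1 x2 = 0" "poly fp u = 0"
  shows "val A B u v = 0"
  using val_eq_0_imp_dvd[OF assms(1)] assms(2) by (simp add: val_def evq_eq_0)

definition Kset :: "complex set" where
  "Kset = {val A B x1 x2 | A B. True}"

lemma Kset_iff: "z \<in> Kset \<longleftrightarrow> (\<exists>A B. z = val A B x1 x2)"
  by (auto simp: Kset_def)

text \<open>\<open>mulA\<close> and \<open>mulB\<close> are the coordinates of a product with
  respect to 1 and x2. They reduce x2^2 by f(X)/(X - x1) = X^2 + (a + x1)X + (b + a x1 + x1^2),
  which vanishes at x2.\<close>

definition mulA :: "rat poly \<Rightarrow> rat poly \<Rightarrow> rat poly \<Rightarrow> rat poly \<Rightarrow> rat poly" where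
  "mulA A B C D = A * C - B * D * [:of_int b, of_int a, 1:]"

definition mulB :: "rat poly \<Rightarrow> rat poly \<Rightarrow> rat poly \<Rightarrow> rat poly \<Rightarrow> rat poly" where
  "mulB A B C D = A * D + B * C - B * D * [:of_int a, 1:]"

lemma val_add: "val A B u v + val C D u v = val (A + C) (B + D) u v"
  by (simp add: val_def algebra_simps)

lemma val_diff: "val A B u v - val C D u v = val (A - C) (B - D) u v"
  by (simp add: val_def algebra_simps)

lemma val_mult12: "val A B x1 x2 * val C D x1 x2 = val (mulA A B C D) (mulB A B C D) x1 x2"
proof -
  have x3: "x3 = - of_int a - x1 - x2" using e1 by (simp add: algebra_simps)
  have "x1 * x2 + (x1 + x2) * (- of_int a - x1 - x2) = of_int b"
    using e2 unfolding x3 by (simp add: algebra_simps)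
  then have rel: "x2 * x2 = - (of_int b + of_int a * x1 + x1 * x1) - (of_int a + x1) * x2"
    by (simp add: algebra_simps)
  have "val A B x1 x2 * val C D x1 x2 = evq A x1 * evq C x1 +
      (evq A x1 * evq D x1 + evq B x1 * evq C x1) * x2 + evq B x1 * evq D x1 * (x2 * x2)"
    by (simp add: val_def algebra_simps)
  also have "\<dots> = val (mulA A B C D) (mulB A B C D) x1 x2"
    unfolding rel by (simp add: val_def mulA_def mulB_def algebra_simps)
  finally show ?thesis .
qed

end

text \<open>Any two distinct roots can serve as the first two of an ordering satisfying the locale
  assumptions; all six orderings come from composing the two transpositions.\<close>

lemma (in generic_cubic) instances:
  assumes "u \<in> {x1, x2, x3}" "v \<in> {x1, x2, x3}" "u \<noteq> v"
  shows "\<exists>w. generic_cubic a b c u v w"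
proof -
  have G: "generic_cubic a b c x1 x2 x3" by unfold_locales
  note s12 = generic_cubic.swap12 and s23 = generic_cubic.swap23
  have "generic_cubic a b c x1 x2 x3" "generic_cubic a b c x1 x3 x2" "generic_cubic a b c x2 x1 x3"
    "generic_cubic a b c x2 x3 x1" "generic_cubic a b c x3 x1 x2" "generic_cubic a b c x3 x2 x1"
    using G s12[OF G] s23[OF G] s23[OF s12[OF G]] s12[OF s23[OF G]] s23[OF s12[OF s23[OF G]]] by blast+
  then show ?thesis using assms by blast
qed

context generic_cubic begin

lemma val_mult:
  assumes "u \<in> {x1, x2, x3}" "v \<in> {x1, x2, x3}" "u \<noteq> v"
  shows "val A B u v * val C D u v = val (mulA A B C D) (mulB A B C D) u v"
proof -
  obtain w where w: "generic_cubic a b c u v w" using instances assms by blast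
  show ?thesis using generic_cubic.val_mult12[OF w]
    by (simp add: generic_cubic.val_def[OF w] val_def generic_cubic.mulA_def[OF w] mulA_def
        generic_cubic.mulB_def[OF w] mulB_def)
qed

lemma val_x1: "val [:0, 1:] 0 u v = u" and val_x2: "val 0 1 u v = v"
  and val_rat: "val [:r:] 0 u v = of_rat r"
  by (simp_all add: val_def)

lemma val_x3: "val [:- of_int a, -1:] (-1) x1 x2 = x3"
proof -
  have "x3 = (x1 + x2 + x3) - x1 - x2" by simp
  then show ?thesis unfolding e1 by (simp add: val_def of_rat_minus)
qed

lemma subfield_Kset: "is_subfield_C Kset"
  unfolding is_subfield_C_def
proof (intro conjI ballI impI)
  show "0 \<in> Kset" "1 \<in> Kset" unfolding Kset_iff using val_rat[of 0] val_rat[of 1] by (metis of_rat_0, metis of_rat_1)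
next
  fix x y assume "x \<in> Kset" "y \<in> Kset"
  then obtain A B C D where xy: "x = val A B x1 x2" "y = val C D x1 x2" by (auto simp: Kset_iff)
  show "x + y \<in> Kset" "x - y \<in> Kset" "x * y \<in> Kset"
    unfolding Kset_iff xy val_add val_diff val_mult12 by blast+
next
  fix x assume x: "x \<in> Kset" "x \<noteq> 0"
  then obtain A B where xv: "x = val A B x1 x2" by (auto simp: Kset_iff)
  \<comment> \<open>y is the conjugate of x over Q(x1), obtained by exchanging x2 and x3. It is
    nonzero by transfer between the two orderings, and x * y lies in Q(x1), where inverses are
    known.\<close>
  define y where "y = val A B x1 x3"
  have i: "generic_cubic a b c x1 x3 x2" by (rule swap23)
  have "y \<noteq> 0"
  proof
    assume "y = 0"
    then have "val A B x1 x2 = 0" using generic_cubic.val_eq_0_transfer[OF i, of A B x1 x2]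
      by (simp add: generic_cubic.val_def[OF i] val_def roots_fp y_def)
    then show False using x xv by simp
  qed
  \<comment> \<open>The relative norm of A + B x2, written with x2 + x3 = -a - x1 and x2 x3 = b + a
    x1 + x1^2.\<close>
  define M where "M = A * A - A * B * [:of_int a, 1:] + B * B * [:of_int b, of_int a, 1:]"
  have x3: "x3 = - of_int a - x1 - x2" using e1 by (simp add: algebra_simps)
  have rel: "x2 * x3 = of_int b + of_int a * x1 + x1 * x1"
  proof -
    have "x2 * x3 = (x1 * x2 + x1 * x3 + x2 * x3) - x1 * ((x1 + x2 + x3) - x1)"
      by (simp add: algebra_simps)
    then show ?thesis unfolding e1 e2 by (simp add: algebra_simps)
  qed
  have "x * y = evq A x1 * evq A x1 + evq A x1 * evq B x1 * (x2 + x3) + evq B x1 * evq B x1 * (x2 * x3)"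
    by (simp add: xv y_def val_def algebra_simps)
  also have "x2 + x3 = - of_int a - x1" using e1 by (simp add: algebra_simps)
  also have "evq A x1 * evq A x1 + evq A x1 * evq B x1 * (- of_int a - x1) + evq B x1 * evq B x1 * (x2 * x3) = evq M x1"
    unfolding rel M_def by (simp add: algebra_simps)
  finally have xyM: "x * y = evq M x1" .
  have "\<not> fQ dvd M" using evq_eq_0[of M x1] xyM x \<open>y \<noteq> 0\<close> roots_fp by auto
  then obtain w where "\<forall>z. poly fp z = 0 \<longrightarrow> evq w z * evq M z = 1" using evq_inverse by blast
  then have "evq w x1 * (x * y) = 1" using roots_fp xyM by auto
  then have "x * (evq w x1 * y) = 1" by (simp add: mult_ac)
  then have inv: "inverse x = evq w x1 * y" by (rule inverse_unique)
  have "y = val (A + B * [:- of_int a, -1:]) (- B) x1 x2"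
    unfolding y_def val_def x3 by (simp add: algebra_simps of_rat_minus)
  then have "inverse x = val w 0 x1 x2 * val (A + B * [:- of_int a, -1:]) (- B) x1 x2"
    using inv by (simp add: val_def)
  then show "inverse x \<in> Kset" unfolding val_mult12 Kset_iff by blast
qed

lemma splitting_field_eq_Kset: "splitting_field_C fp = Kset"
proof
  have "x1 \<in> Kset" "x2 \<in> Kset" "x3 \<in> Kset"
    unfolding Kset_iff using val_x1 val_x2 val_x3 by metis+
  then show "splitting_field_C fp \<subseteq> Kset"
    by (intro splitting_field_C_least subfield_Kset) (auto simp: roots_fp)
  have sf: "is_subfield_C (splitting_field_C fp)" by (rule is_subfield_splitting_field_C)
  have "x1 \<in> splitting_field_C fp" "x2 \<in> splitting_field_C fp"
    by (auto intro: roots_in_splitting_field_C simp: roots_fp)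
  then show "Kset \<subseteq> splitting_field_C fp"
    by (auto simp: Kset_iff val_def intro!: is_subfield_C_D[OF sf] evq_in_subfield[OF sf])
qed

lemma splitting_field_eq:
  assumes "u \<in> {x1, x2, x3}" "v \<in> {x1, x2, x3}" "u \<noteq> v"
  shows "splitting_field_C fp = {val A B u v | A B. True}"
proof -
  obtain w where w: "generic_cubic a b c u v w" using instances assms by blast
  show ?thesis using generic_cubic.splitting_field_eq_Kset[OF w]
    by (simp add: generic_cubic.Kset_def[OF w] generic_cubic.val_def[OF w] val_def)
qed

lemma val_transfer:
  assumes "u \<in> {x1, x2, x3}" "v \<in> {x1, x2, x3}" "u \<noteq> v"
    and "u' \<in> {x1, x2, x3}" "v' \<in> {x1, x2, x3}" "u' \<noteq> v'"
    and "val A B u v = val C D u v"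
  shows "val A B u' v' = val C D u' v'"
proof -
  obtain w where w: "generic_cubic a b c u v w" using instances assms by blast
  have "val (A - C) (B - D) u v = 0" using assms(7) by (simp add: val_diff[symmetric])
  then have "val (A - C) (B - D) u' v' = 0"
    using generic_cubic.val_eq_0_transfer[OF w, of "A - C" "B - D" u' v'] assms(4)
    by (auto simp: generic_cubic.val_def[OF w] val_def roots_fp)
  then show ?thesis by (simp add: val_diff[symmetric])
qed

text \<open>The candidate automorphism with x1 to u and x2 to v. The representation A(x1) + B(x1) x2
  is picked by choice; \<open>val_transfer\<close> makes the value independent of the pick. Being
  the identity off the field matches the convention in \<open>galois_group_C\<close>.\<close>

definition sig :: "complex \<Rightarrow> complex \<Rightarrow> complex \<Rightarrow> complex" where
  "sig u v z = (if z \<in> splitting_field_C fp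
     then (let AB = (SOME AB. z = val (fst AB) (snd AB) x1 x2) in val (fst AB) (snd AB) u v) else z)"

lemma sig_val:
  assumes "u \<in> {x1, x2, x3}" "v \<in> {x1, x2, x3}" "u \<noteq> v"
  shows "sig u v (val A B x1 x2) = val A B u v"
proof -
  define z where "z = val A B x1 x2"
  define AB where "AB = (SOME AB. z = val (fst AB) (snd AB) x1 x2)"
  have "z = val (fst AB) (snd AB) x1 x2"
    unfolding AB_def by (rule someI[of _ "(A, B)"]) (simp add: z_def)
  then have "val (fst AB) (snd AB) u v = val A B u v"
    using assms distinct by (intro val_transfer[of x1 x2 u v]) (auto simp: z_def)
  moreover have "z \<in> splitting_field_C fp"
    unfolding splitting_field_eq_Kset Kset_iff z_def by blast
  ultimately show ?thesis by (simp add: sig_def Let_def AB_def[symmetric] flip: z_def)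
qed

text \<open>Injectivity is the transfer of relations from (u, v) back to (x1, x2). Surjectivity
  holds because u and v generate the same splitting field.\<close>

lemma sig_in_galois_group:
  assumes uv: "u \<in> {x1, x2, x3}" "v \<in> {x1, x2, x3}" "u \<noteq> v"
  shows "sig u v \<in> carrier (galois_group_C fp)"
proof -
  have K: "z \<in> splitting_field_C fp \<longleftrightarrow> (\<exists>A B. z = val A B x1 x2)" for z
    by (simp add: splitting_field_eq_Kset Kset_iff)
  have K': "z \<in> splitting_field_C fp \<longleftrightarrow> (\<exists>A B. z = val A B u v)" for z
    by (simp add: splitting_field_eq[OF uv])
  note s = sig_val[OF uv]
  have 12: "x1 \<in> {x1, x2, x3}" "x2 \<in> {x1, x2, x3}" "x1 \<noteq> x2" using distinct by auto
  show ?thesis unfolding galois_group_C_carrier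
  proof (intro conjI ballI allI impI)
    show "bij_betw (sig u v) (splitting_field_C fp) (splitting_field_C fp)"
      unfolding bij_betw_def
    proof
      show "inj_on (sig u v) (splitting_field_C fp)"
      proof (rule inj_onI)
        fix x y assume "x \<in> splitting_field_C fp" "y \<in> splitting_field_C fp" and e: "sig u v x = sig u v y"
        then obtain A B C D where xy: "x = val A B x1 x2" "y = val C D x1 x2" using K by metis
        have "val A B u v = val C D u v" using e unfolding xy s .
        then show "x = y" unfolding xy by (rule val_transfer[OF uv 12])
      qed
      show "sig u v ` splitting_field_C fp = splitting_field_C fp"
      proof
        show "sig u v ` splitting_field_C fp \<subseteq> splitting_field_C fp"
        proof
          fix y assume "y \<in> sig u v ` splitting_field_C fp"
          then obtain A B where "y = sig u v (val A B x1 x2)" by (auto simp: K)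
          then show "y \<in> splitting_field_C fp" unfolding s K' by blast
        qed
        show "splitting_field_C fp \<subseteq> sig u v ` splitting_field_C fp"
        proof
          fix y assume "y \<in> splitting_field_C fp"
          then obtain A B where "y = val A B u v" by (auto simp: K')
          then have "y = sig u v (val A B x1 x2)" by (simp add: s)
          moreover have "val A B x1 x2 \<in> splitting_field_C fp" unfolding K by blast
          ultimately show "y \<in> sig u v ` splitting_field_C fp" by blast
        qed
      qed
    qed
  next
    fix x y assume "x \<in> splitting_field_C fp" "y \<in> splitting_field_C fp"
    then obtain A B C D where xy: "x = val A B x1 x2" "y = val C D x1 x2" by (auto simp: K)
    show "sig u v (x + y) = sig u v x + sig u v y" unfolding xy by (simp add: val_add s)
    show "sig u v (x * y) = sig u v x * sig u v y" unfolding xy val_mult[OF 12] s val_mult[OF uv] ..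
  next
    show "sig u v 1 = 1" using s[of "[:1:]" 0] by (simp add: val_rat)
  next
    fix z assume "z \<notin> splitting_field_C fp"
    then show "sig u v z = z" by (simp add: sig_def)
  qed
qed

lemma sig_roots:
  assumes uv: "u \<in> {x1, x2, x3}" "v \<in> {x1, x2, x3}" "u \<noteq> v"
  shows "sig u v x1 = u" "sig u v x2 = v"
  using sig_val[OF uv, of "[:0, 1:]" 0] sig_val[OF uv, of 0 1] by (simp_all add: val_x1 val_x2)

text \<open>A numbering of the roots by {1..3}, the set on which \<open>sym_group 3\<close> acts.
  The value x3 at all other indices makes \<open>rt_in\<close> hold for every index.\<close>

definition rt :: "nat \<Rightarrow> complex" where
  "rt i = (if i = 1 then x1 else if i = 2 then x2 else x3)"

lemma rt_bij: "bij_betw rt {1..3} {x1, x2, x3}"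
proof -
  have "{1..3} = {1, 2, 3 :: nat}" by auto
  then show ?thesis using distinct by (auto simp: bij_betw_def rt_def inj_on_def)
qed

definition idx :: "complex \<Rightarrow> nat" where "idx = the_inv_into {1..3} rt"

lemma rt_idx: "z \<in> {x1, x2, x3} \<Longrightarrow> rt (idx z) = z"
  unfolding idx_def
  by (rule f_the_inv_into_f[OF bij_betw_imp_inj_on[OF rt_bij]])
    (simp only: bij_betw_imp_surj_on[OF rt_bij])

lemma idx_in: "z \<in> {x1, x2, x3} \<Longrightarrow> idx z \<in> {1..3}"
  unfolding idx_def
  by (rule the_inv_into_into[OF bij_betw_imp_inj_on[OF rt_bij] _ order_refl])
    (simp only: bij_betw_imp_surj_on[OF rt_bij])

lemma rt_in: "rt i \<in> {x1, x2, x3}"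
  by (simp add: rt_def)

lemma rt_inj: "rt i = rt j \<Longrightarrow> i \<in> {1..3} \<Longrightarrow> j \<in> {1..3} \<Longrightarrow> i = j"
  using rt_bij by (auto simp: bij_betw_def inj_on_def)

definition perm_aut :: "(nat \<Rightarrow> nat) \<Rightarrow> complex \<Rightarrow> complex" where
  "perm_aut \<pi> = sig (rt (\<pi> 1)) (rt (\<pi> 2))"

lemma sum_galois:
  assumes "\<sigma> \<in> carrier (galois_group_C fp)"
  shows "\<sigma> x1 + \<sigma> x2 + \<sigma> x3 = - of_int a"
proof -
  have r: "x1 \<in> splitting_field_C fp" "x2 \<in> splitting_field_C fp" "x3 \<in> splitting_field_C fp"
    by (auto intro: roots_in_splitting_field_C simp: roots_fp)
  note h = galois_hom[OF assms]
  have "\<sigma> x1 + \<sigma> x2 + \<sigma> x3 = \<sigma> (x1 + x2 + x3)"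
    using r h(1)[of x1 x2] h(1)[of "x1 + x2" x3] is_subfield_C_D(3)[OF is_subfield_splitting_field_C r(1,2)] by simp
  also have "\<dots> = \<sigma> (of_int (- a))" by (simp add: e1)
  also have "\<dots> = - of_int a" using h(7)[OF r(1) r(1), of "- a"] by simp
  finally show ?thesis .
qed

text \<open>The images of x1 and x2 are prescribed. That of x3 follows since an automorphism
  preserves the sum -a of the roots, and the roots at three distinct indices have this same
  sum.\<close>

lemma perm_aut:
  assumes \<pi>: "\<pi> permutes {1..3::nat}"
  shows "perm_aut \<pi> \<in> carrier (galois_group_C fp)" "i \<in> {1..3} \<Longrightarrow> perm_aut \<pi> (rt i) = rt (\<pi> i)"
proof -
  have in3: "\<pi> 1 \<in> {1..3}" "\<pi> 2 \<in> {1..3}" "\<pi> 3 \<in> {1..3}"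
    using permutes_in_image[OF \<pi>] by auto
  have ne: "\<pi> 1 \<noteq> \<pi> 2" "\<pi> 1 \<noteq> \<pi> 3" "\<pi> 2 \<noteq> \<pi> 3" by (simp_all add: inj_eq[OF permutes_inj[OF \<pi>]])
  have uv: "rt (\<pi> 1) \<in> {x1, x2, x3}" "rt (\<pi> 2) \<in> {x1, x2, x3}" "rt (\<pi> 1) \<noteq> rt (\<pi> 2)"
    using rt_in rt_inj in3 ne by blast+
  show G: "perm_aut \<pi> \<in> carrier (galois_group_C fp)"
    unfolding perm_aut_def by (rule sig_in_galois_group[OF uv])
  have 12: "perm_aut \<pi> x1 = rt (\<pi> 1)" "perm_aut \<pi> x2 = rt (\<pi> 2)"
    unfolding perm_aut_def by (rule sig_roots[OF uv])+
  have tot: "rt i + rt j + rt k = - of_int a"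
    if "i \<in> {1..3}" "j \<in> {1..3}" "k \<in> {1..3}" "i \<noteq> j" "i \<noteq> k" "j \<noteq> k" for i j k
  proof -
    have "i \<in> {1,2,3}" "j \<in> {1,2,3}" "k \<in> {1,2,3}" using that by auto
    then show ?thesis using that(4-6) e1 by (auto simp: rt_def algebra_simps)
  qed
  have "perm_aut \<pi> x1 + perm_aut \<pi> x2 + perm_aut \<pi> x3 = rt (\<pi> 1) + rt (\<pi> 2) + rt (\<pi> 3)"
    using sum_galois[OF G] tot[OF in3 ne] by simp
  then have 3: "perm_aut \<pi> x3 = rt (\<pi> 3)" using 12 by simp
  assume "i \<in> {1..3}"
  then have "i = 1 \<or> i = 2 \<or> i = 3" by auto
  then show "perm_aut \<pi> (rt i) = rt (\<pi> i)" using 12 3 by (auto simp: rt_def)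
qed

lemma galois_comp:
  assumes "\<sigma> \<in> carrier (galois_group_C fp)" "\<tau> \<in> carrier (galois_group_C fp)"
  shows "\<sigma> \<circ> \<tau> \<in> carrier (galois_group_C fp)"
proof -
  have "bij_betw (\<sigma> \<circ> \<tau>) (splitting_field_C fp) (splitting_field_C fp)"
    using assms by (intro bij_betw_trans) (auto simp: galois_group_C_carrier)
  moreover have "\<tau> x \<in> splitting_field_C fp" if "x \<in> splitting_field_C fp" for x
    using galois_hom(8)[OF assms(2) that that] .
  ultimately show ?thesis using assms by (simp add: galois_group_C_carrier)
qed

text \<open>Automorphisms are compared on the roots only, which settles multiplicativity. For
  surjectivity, an automorphism maps roots injectively to roots and so induces a permutation of
  indices.\<close>

lemma galois_group_iso: "galois_group_C fp \<cong> sym_group 3"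
proof -
  let ?G = "galois_group_C fp"
  have eqI: "\<sigma> = \<tau>" if "\<sigma> \<in> carrier ?G" "\<tau> \<in> carrier ?G" "\<And>i. i \<in> {1..3} \<Longrightarrow> \<sigma> (rt i) = \<tau> (rt i)" for \<sigma> \<tau>
  proof (rule galois_eqI[OF that(1,2)])
    fix z assume "poly fp z = 0"
    then have "z \<in> {x1, x2, x3}" by (simp add: roots_fp)
    then show "\<sigma> z = \<tau> z" using that(3)[of "idx z"] idx_in rt_idx by auto
  qed
  have car: "carrier (sym_group 3) = {\<pi>. \<pi> permutes {1..3::nat}}" by (simp add: sym_group_def)
  have hom: "perm_aut \<in> hom (sym_group 3) ?G"
  proof (rule homI)
    fix \<pi> assume "\<pi> \<in> carrier (sym_group 3)"
    then show "perm_aut \<pi> \<in> carrier ?G" using perm_aut(1) car by simp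
  next
    fix \<pi> \<rho> assume "\<pi> \<in> carrier (sym_group 3)" "\<rho> \<in> carrier (sym_group 3)"
    then have p: "\<pi> permutes {1..3}" "\<rho> permutes {1..3}" by (simp_all add: car)
    have pr: "\<pi> \<circ> \<rho> permutes {1..3}" using p by (rule permutes_compose[rotated])
    have "perm_aut (\<pi> \<circ> \<rho>) = perm_aut \<pi> \<circ> perm_aut \<rho>"
    proof (rule eqI)
      show "perm_aut (\<pi> \<circ> \<rho>) \<in> carrier ?G" by (rule perm_aut(1)[OF pr])
      show "perm_aut \<pi> \<circ> perm_aut \<rho> \<in> carrier ?G" by (intro galois_comp perm_aut(1) p)
      fix i assume i: "i \<in> {1..3::nat}"
      then have "\<rho> i \<in> {1..3}" using permutes_in_image[OF p(2)] by blast
      then show "perm_aut (\<pi> \<circ> \<rho>) (rt i) = (perm_aut \<pi> \<circ> perm_aut \<rho>) (rt i)"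
        using i by (simp only: perm_aut(2)[OF pr] perm_aut(2)[OF p(1)] perm_aut(2)[OF p(2)] o_apply)
    qed
    then show "perm_aut (\<pi> \<otimes>\<^bsub>sym_group 3\<^esub> \<rho>) = perm_aut \<pi> \<otimes>\<^bsub>?G\<^esub> perm_aut \<rho>"
      by (simp add: sym_group_def galois_group_C_mult)
  qed
  have "bij_betw perm_aut (carrier (sym_group 3)) (carrier ?G)"
    unfolding bij_betw_def
  proof
    show "inj_on perm_aut (carrier (sym_group 3))"
    proof (rule inj_onI)
      fix \<pi> \<rho> assume "\<pi> \<in> carrier (sym_group 3)" "\<rho> \<in> carrier (sym_group 3)" and e: "perm_aut \<pi> = perm_aut \<rho>"
      then have p: "\<pi> permutes {1..3}" "\<rho> permutes {1..3}" by (simp_all add: car)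
      show "\<pi> = \<rho>"
      proof
        fix i
        show "\<pi> i = \<rho> i"
        proof (cases "i \<in> {1..3}")
          case True
          then have "rt (\<pi> i) = rt (\<rho> i)" using perm_aut(2)[OF p(1)] perm_aut(2)[OF p(2)] e by metis
          then show ?thesis using rt_inj permutes_in_image[OF p(1)] permutes_in_image[OF p(2)] True by blast
        next
          case False
          then show ?thesis using p by (simp add: permutes_not_in)
        qed
      qed
    qed
    show "perm_aut ` carrier (sym_group 3) = carrier ?G"
    proof
      show "perm_aut ` carrier (sym_group 3) \<subseteq> carrier ?G" using perm_aut(1) car by auto
      show "carrier ?G \<subseteq> perm_aut ` carrier (sym_group 3)"
      proof
        fix \<sigma> assume \<sigma>: "\<sigma> \<in> carrier ?G"
        \<comment> \<open>Indices outside {1..3} must be fixed for \<open>\<pi>\<close> to lie in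
          \<open>sym_group 3\<close>.\<close>
        define \<pi> where "\<pi> i = (if i \<in> {1..3} then idx (\<sigma> (rt i)) else i)" for i :: nat
        have sr: "\<sigma> (rt i) \<in> {x1, x2, x3}" for i
          using galois_maps_roots[OF \<sigma>, of "rt i"] rt_in[of i] by (auto simp: roots_fp)
        have r\<pi>: "rt (\<pi> i) = \<sigma> (rt i)" if "i \<in> {1..3}" for i using that sr rt_idx by (simp add: \<pi>_def)
        have "\<pi> permutes {1..3}"
        proof (rule bij_imp_permutes)
          have "inj_on \<pi> {1..3}"
          proof (rule inj_onI)
            fix i j assume ij: "i \<in> {1..3::nat}" "j \<in> {1..3}" "\<pi> i = \<pi> j"
            then have "\<sigma> (rt i) = \<sigma> (rt j)" using r\<pi> by metis
            moreover have "rt k \<in> splitting_field_C fp" for k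
              using rt_in[of k] by (intro roots_in_splitting_field_C) (simp add: roots_fp)
            moreover have "inj_on \<sigma> (splitting_field_C fp)" using \<sigma> by (simp add: galois_group_C_carrier bij_betw_def)
            ultimately have "rt i = rt j" by (auto dest: inj_onD)
            then show "i = j" using rt_inj ij by blast
          qed
          moreover have "\<pi> ` {1..3} \<subseteq> {1..3}"
            using idx_in[OF sr] unfolding \<pi>_def by auto
          ultimately show "bij_betw \<pi> {1..3} {1..3}"
            by (simp add: bij_betw_def endo_inj_surj)
          fix x assume "x \<notin> {1..3::nat}"
          then show "\<pi> x = x" by (simp only: \<pi>_def if_False)
        qed
        moreover from this have "\<sigma> = perm_aut \<pi>"
          by (intro eqI \<sigma> perm_aut(1)) (simp_all only: perm_aut(2) r\<pi>)
        ultimately show "\<sigma> \<in> perm_aut ` carrier (sym_group 3)" using car by blast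
      qed
    qed
  qed
  then have "perm_aut \<in> iso (sym_group 3) ?G" using hom by (simp add: iso_def)
  \<comment> \<open>The isomorphism is inverted from the side of the symmetric group, whose group
    axioms are available.\<close>
  then have "sym_group 3 \<cong> ?G" by (auto simp: is_iso_def)
  then show ?thesis using group.iso_sym[OF sym_group_is_group] by blast
qed

end

section \<open>Cubics whose Galois group is not the full symmetric group\<close>

lemma cubic_roots_exist:
  fixes a b c :: complex
  shows "\<exists>x1 x2 x3. x1 + x2 + x3 = - a \<and> x1 * x2 + x1 * x3 + x2 * x3 = b \<and> x1 * x2 * x3 = - c"
proof -
  have "\<not> constant (poly [:c, b, a, 1:])" by (simp add: constant_degree)
  then obtain x where x: "poly [:c, b, a, 1:] x = 0" using fundamental_theorem_of_algebra by blast
  define s t where "s = a + x" and "t = b + x * s"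
  define d where "d = csqrt (s^2 - 4 * t)"
  have d2: "d * d = s * s - 4 * t" using power2_csqrt[of "s^2 - 4*t"] by (simp add: d_def power2_eq_square)
  define u v where "u = (- s + d) / 2" and "v = (- s - d) / 2"
  have uv: "u + v = - s" by (simp add: u_def v_def field_simps)
  have "u * v = (s * s - d * d) / 4" by (simp add: u_def v_def field_simps)
  then have uvt: "u * v = t" using d2 by simp
  have xt: "x * t = - c" using x by (simp add: t_def s_def algebra_simps add_eq_0_iff)
  have "x + u + v = - a" using uv by (simp add: s_def algebra_simps)
  moreover have "x * u + x * v + u * v = b"
  proof -
    have "x * u + x * v + u * v = x * (u + v) + u * v" by (simp add: algebra_simps)
    then show ?thesis unfolding uv uvt by (simp add: t_def)
  qed
  moreover have "x * u * v = - c" using uvt xt by (simp add: mult.assoc)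
  ultimately show ?thesis by blast
qed

lemma not_S3_imp:
  assumes "not_S3 a b c" "\<And>r. r ^ 3 + a * r ^ 2 + b * r + c \<noteq> 0"
  shows "\<exists>y. disc3 a b c = y ^ 2"
proof (rule ccontr)
  assume nsq: "\<nexists>y. disc3 a b c = y ^ 2"
  obtain x1 x2 x3 :: complex where e: "x1 + x2 + x3 = - of_int a"
      "x1 * x2 + x1 * x3 + x2 * x3 = of_int b" "x1 * x2 * x3 = - of_int c"
    using cubic_roots_exist by blast
  have a: "of_int a = - (x1 + x2 + x3)" and c: "of_int c = - (x1 * x2 * x3)"
    using e by simp_all
  have "of_int (disc3 a b c) = ((x1 - x2) * (x1 - x3) * (x2 - x3)) ^ 2"
    unfolding disc3_def by (simp add: a c e(2)[symmetric]) algebra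
  \<comment> \<open>0 is a square, so a non-square discriminant already forces distinct
    roots.\<close>
  moreover have "disc3 a b c \<noteq> 0" using nsq by (metis zero_power2)
  ultimately have dist: "x1 \<noteq> x2" "x1 \<noteq> x3" "x2 \<noteq> x3" by auto
  interpret generic_cubic a b c x1 x2 x3
  proof unfold_locales
    fix r :: rat
    show "r ^ 3 + of_int a * r ^ 2 + of_int b * r + of_int c \<noteq> 0"
      using rat_root_of_monic_int_cubic assms(2) by blast
    show "r ^ 2 \<noteq> of_int (disc3 a b c)"
      using int_square_if_rat_square nsq by blast
  qed (use e dist in auto)
  have "rsquarefree fp"
    unfolding rsquarefree_roots
  proof (intro allI notI)
    fix z assume z: "poly fp z = 0 \<and> poly (pderiv fp) z = 0"
    have "fp = [:- x1, 1:] * [:- x2, 1:] * [:- x3, 1:]"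
      by (rule poly_eq_poly_eq_iff[THEN iffD1], rule ext) (simp add: poly_fp algebra_simps)
    then have "poly (pderiv fp) z = (z - x2) * (z - x3) + (z - x1) * (z - x3) + (z - x1) * (z - x2)"
      by (simp add: pderiv_mult pderiv_pCons algebra_simps)
    then show False using z dist by (auto simp: roots_fp)
  qed
  then show False using galois_group_iso assms(1) by (simp add: not_S3_def)
qed

section \<open>Eisenstein integers\<close>

definition omega :: complex where "omega = Complex (-1/2) (sqrt 3 / 2)"

text \<open>A subset of the complex numbers instead of a type of its own, so that modulus,
  conjugation, real and imaginary parts apply directly.\<close>

definition Eis :: "complex set" where
  "Eis = {of_int x + of_int y * omega | x y :: int. True}"

lemma Eis_iff: "z \<in> Eis \<longleftrightarrow> (\<exists>x y::int. z = of_int x + of_int y * omega)"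
  by (auto simp: Eis_def)

lemma omega_sq: "omega * omega = - 1 - omega"
  by (simp add: omega_def complex_eq_iff)

lemma cnj_omega: "cnj omega = - 1 - omega"
  by (simp add: omega_def complex_eq_iff)

lemma Eis_of_int [simp, intro]: "of_int k \<in> Eis"
  unfolding Eis_iff by (rule exI[of _ k], rule exI[of _ 0]) simp

lemma Eis_0 [simp, intro]: "0 \<in> Eis" and Eis_1 [simp, intro]: "1 \<in> Eis"
  using Eis_of_int[of 0] Eis_of_int[of 1] by simp_all

lemma Eis_add [intro]: assumes "x \<in> Eis" "y \<in> Eis" shows "x + y \<in> Eis"
proof -
  from assms obtain a b c d :: int where "x = of_int a + of_int b * omega" "y = of_int c + of_int d * omega"
    by (auto simp: Eis_iff)
  then have "x + y = of_int (a + c) + of_int (b + d) * omega" by (simp add: algebra_simps)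
  then show ?thesis unfolding Eis_iff by blast
qed

lemma Eis_minus [intro]: assumes "x \<in> Eis" shows "- x \<in> Eis"
proof -
  from assms obtain a b :: int where "x = of_int a + of_int b * omega"
    by (auto simp: Eis_iff)
  then have "- x = of_int (- a) + of_int (- b) * omega" by (simp add: algebra_simps)
  then show ?thesis unfolding Eis_iff by blast
qed

lemma Eis_diff [intro]: "x \<in> Eis \<Longrightarrow> y \<in> Eis \<Longrightarrow> x - y \<in> Eis"
  using Eis_add[OF _ Eis_minus, of x y] by simp

lemma Eis_mult [intro]: assumes "x \<in> Eis" "y \<in> Eis" shows "x * y \<in> Eis"
proof -
  from assms obtain a b c d :: int where xy: "x = of_int a + of_int b * omega" "y = of_int c + of_int d * omega"
    by (auto simp: Eis_iff)
  have "x * y = of_int a * of_int c + (of_int a * of_int d + of_int b * of_int c) * omega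
                + of_int b * of_int d * (omega * omega)"
    unfolding xy by (simp add: algebra_simps)
  also have "\<dots> = of_int (a * c - b * d) + of_int (a * d + b * c - b * d) * omega"
    unfolding omega_sq by (simp add: algebra_simps)
  finally show ?thesis unfolding Eis_iff by blast
qed

lemma Eis_power [intro]: "x \<in> Eis \<Longrightarrow> x ^ n \<in> Eis"
  by (induction n) auto

lemma Eis_cnj [intro]: assumes "x \<in> Eis" shows "cnj x \<in> Eis"
proof -
  from assms obtain a b :: int where "x = of_int a + of_int b * omega"
    by (auto simp: Eis_iff)
  then have "cnj x = of_int (a - b) + of_int (- b) * omega" by (simp add: cnj_omega algebra_simps)
  then show ?thesis unfolding Eis_iff by blast
qed

lemma Re_omega: "Re omega = - 1 / 2" and Im_omega: "Im omega = sqrt 3 / 2"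
  by (simp_all add: omega_def)

lemma cmod_lin: "(cmod (of_real s + of_real t * omega))\<^sup>2 = s\<^sup>2 - s * t + t\<^sup>2"
proof -
  have re: "Re (of_real s + of_real t * omega) = s - t / 2"
    and im: "Im (of_real s + of_real t * omega) = t * (sqrt 3 / 2)"
    by (simp_all add: Re_omega Im_omega)
  have "(sqrt 3)\<^sup>2 = 3" by simp
  then show ?thesis
    unfolding cmod_power2 re im power_mult_distrib power_divide power2_diff by simp
qed

lemma cmod_int: "(cmod (of_int x + of_int y * omega))\<^sup>2 = real_of_int (x\<^sup>2 - x * y + y\<^sup>2)"
  using cmod_lin[of "of_int x" "of_int y"] by simp

lemma Eis_norm_nat: assumes "z \<in> Eis" shows "\<exists>n::nat. (cmod z)\<^sup>2 = real n"
proof -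
  from assms obtain x y :: int where z: "z = of_int x + of_int y * omega" by (auto simp: Eis_iff)
  define n where "n = x\<^sup>2 - x * y + y\<^sup>2"
  have n: "(cmod z)\<^sup>2 = real_of_int n" unfolding z n_def by (rule cmod_int)
  then have "0 \<le> n" using zero_le_power2[of "cmod z"] by simp
  then have "(cmod z)\<^sup>2 = real (nat n)" using n by simp
  then show ?thesis ..
qed

lemma Eis_norm_ge_1: assumes "z \<in> Eis" "z \<noteq> 0" shows "cmod z \<ge> 1"
proof -
  obtain n :: nat where n: "(cmod z)\<^sup>2 = real n" using Eis_norm_nat assms by blast
  with assms have "n \<noteq> 0" by (cases "n = 0") simp_all
  then have "(cmod z)\<^sup>2 \<ge> 1\<^sup>2" using n by simp
  then show ?thesis by (rule power2_le_imp_le) simp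
qed

lemma Eis_rational: assumes "z \<in> Eis" "z * of_int m = of_int n" "m \<noteq> 0"
  shows "\<exists>k::int. z = of_int k"
proof -
  from assms obtain x y :: int where z: "z = of_int x + of_int y * omega" by (auto simp: Eis_iff)
  have "Im (z * of_int m) = Im (of_int n)" using assms by simp
  then have "y = 0" using assms(3) unfolding z by (simp add: omega_def)
  then show ?thesis using z by auto
qed

lemma complex_omega_coords: "\<exists>s t::real. z = of_real s + of_real t * omega"
proof -
  have "z = of_real (Re z + Im z / sqrt 3) + of_real (2 * Im z / sqrt 3) * omega"
    unfolding complex_eq_iff by (simp add: Re_omega Im_omega)
  then show ?thesis by blast
qed

text \<open>Rounding both coordinates of x / g leaves errors u, v of size at most 1/2, and u^2 - uv
  + v^2 \<le> 3/4 < 1.\<close>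

lemma Eis_division: assumes "g \<noteq> 0"
  shows "\<exists>q\<in>Eis. cmod (x - g * q) < cmod g"
proof -
  obtain s t :: real where st: "x / g = of_real s + of_real t * omega"
    using complex_omega_coords by blast
  define q where "q = of_int (round s) + of_int (round t) * omega"
  define u v where "u = s - of_int (round s)" and "v = t - of_int (round t)"
  have uv: "\<bar>u\<bar> \<le> 1/2" "\<bar>v\<bar> \<le> 1/2"
    using of_int_round_abs_le[of s] of_int_round_abs_le[of t] by (simp_all add: u_def v_def abs_minus_commute)
  have "x / g - q = of_real u + of_real v * omega"
    by (simp add: st q_def u_def v_def algebra_simps)
  then have "(cmod (x / g - q))\<^sup>2 = u\<^sup>2 - u * v + v\<^sup>2" using cmod_lin by simp
  moreover have "u\<^sup>2 \<le> (1/2)\<^sup>2" "v\<^sup>2 \<le> (1/2)\<^sup>2" using power_mono[OF uv(1), of 2] power_mono[OF uv(2), of 2] by simp_all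
  moreover have "\<bar>u * v\<bar> \<le> 1/2 * (1/2)" unfolding abs_mult by (intro mult_mono uv) auto
  ultimately have "(cmod (x / g - q))\<^sup>2 < 1\<^sup>2" by (simp add: power2_eq_square)
  then have "cmod (x / g - q) < 1" by (rule power2_less_imp_less) simp
  then have "cmod (g * (x / g - q)) < cmod g" using assms by (simp add: norm_mult)
  then have "cmod (x - g * q) < cmod g" using assms by (simp add: algebra_simps)
  moreover have "q \<in> Eis" unfolding q_def Eis_iff by blast
  ultimately show ?thesis by blast
qed

section \<open>Divisibility and primes in the Eisenstein integers\<close>

definition edvd :: "complex \<Rightarrow> complex \<Rightarrow> bool" (infix "edvd" 50) where
  "x edvd y \<longleftrightarrow> (\<exists>z\<in>Eis. y = x * z)"

text \<open>Primes in the sense of Euclid's lemma. As nonzero Eisenstein integers have modulus at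
  least 1, the condition \<open>cmod p > 1\<close> excludes 0 and the units at once.\<close>

definition eprime :: "complex \<Rightarrow> bool" where
  "eprime p \<longleftrightarrow> p \<in> Eis \<and> cmod p > 1 \<and>
     (\<forall>x\<in>Eis. \<forall>y\<in>Eis. p edvd x * y \<longrightarrow> p edvd x \<or> p edvd y)"

lemma edvdI [intro]: "z \<in> Eis \<Longrightarrow> x edvd x * z" by (auto simp: edvd_def)
lemma edvd_refl [simp]: "x edvd x" using edvdI[of 1 x] by simp
lemma edvd_trans: "x edvd y \<Longrightarrow> y edvd z \<Longrightarrow> x edvd z"
  by (auto simp: edvd_def mult.assoc)
lemma edvd_mult2: "x edvd y \<Longrightarrow> z \<in> Eis \<Longrightarrow> x edvd y * z"
  by (auto simp: edvd_def mult.assoc)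
lemma edvd_add: "x edvd y \<Longrightarrow> x edvd z \<Longrightarrow> x edvd y + z"
  unfolding edvd_def by (metis Eis_add distrib_left)
lemma edvd_cnj: "x edvd y \<Longrightarrow> cnj x edvd cnj y" by (auto simp: edvd_def)
lemma edvd_mult_cancel: "c \<noteq> 0 \<Longrightarrow> c * x edvd c * y \<longleftrightarrow> x edvd y"
  by (auto simp: edvd_def mult.assoc)

text \<open>Squared moduli are natural numbers. The minimum is used twice in the next lemma: for a
  least nonunit divisor and for a generator of an ideal.\<close>

lemma exists_minimal_cmod:
  assumes "S \<subseteq> Eis" "S \<noteq> {}"
  shows "\<exists>g\<in>S. \<forall>h\<in>S. cmod g \<le> cmod h"
proof -
  define N where "N z = nat \<lfloor>(cmod z)\<^sup>2\<rfloor>" for z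
  obtain k where "k \<in> S" using assms(2) by blast
  note m = arg_min_nat_lemma[of "\<lambda>x. x \<in> S" k N, OF this]
  define g where "g = arg_min N (\<lambda>x. x \<in> S)"
  have g: "g \<in> S" "\<And>h. h \<in> S \<Longrightarrow> N g \<le> N h" using m by (simp_all add: g_def)
  have N: "(cmod z)\<^sup>2 = real (N z)" if "z \<in> S" for z
  proof -
    have "z \<in> Eis" using that assms(1) by (rule subsetD[rotated])
    then obtain n :: nat where "(cmod z)\<^sup>2 = real n" using Eis_norm_nat[of z] by metis
    then show ?thesis by (simp add: N_def)
  qed
  have "cmod g \<le> cmod h" if "h \<in> S" for h
    by (rule power2_le_imp_le) (use N[OF that] N[OF g(1)] g(2)[OF that] in auto)
  with g(1) show ?thesis by blast
qed

text \<open>A nonunit divisor of least modulus is prime: if p does not divide x, the ideal generated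
  by p and x is principal and, by minimality of p, contains a unit, so Bezout gives Euclid's
  lemma.\<close>

lemma eprime_divisor_exists:
  assumes "\<alpha> \<in> Eis" "cmod \<alpha> > 1"
  shows "\<exists>p. eprime p \<and> p edvd \<alpha>"
proof -
  define S where "S = {d \<in> Eis. cmod d > 1 \<and> d edvd \<alpha>}"
  have "\<alpha> \<in> S" using assms by (simp add: S_def)
  then obtain p where p: "p \<in> S" and pmin: "\<And>h. h \<in> S \<Longrightarrow> cmod p \<le> cmod h"
    using exists_minimal_cmod[of S] S_def by blast
  have pE: "p \<in> Eis" "cmod p > 1" "p edvd \<alpha>" using p by (auto simp: S_def)
  then have p0: "p \<noteq> 0" by auto
  have "p edvd y" if xy: "x \<in> Eis" "y \<in> Eis" "p edvd x * y" "\<not> p edvd x" for x y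
  proof -
    \<comment> \<open>The nonzero elements of the ideal (p, x); division with remainder shows that
      the least one divides all others.\<close>
    define I where "I = {z. z \<noteq> 0 \<and> (\<exists>u\<in>Eis. \<exists>v\<in>Eis. z = p * u + x * v)}"
    have "p \<in> I" proof -
      have "p = p * 1 + x * 0" by simp
      then show ?thesis unfolding I_def using p0 by blast
    qed
    moreover have IE: "I \<subseteq> Eis" unfolding I_def using pE xy by auto
    ultimately obtain g where g: "g \<in> I" and gmin: "\<And>h. h \<in> I \<Longrightarrow> cmod g \<le> cmod h"
      using exists_minimal_cmod[of I] by auto
    obtain u v where uv: "u \<in> Eis" "v \<in> Eis" "g = p * u + x * v" "g \<noteq> 0" using g by (auto simp: I_def)
    have gd: "g edvd z" if z: "z = p * u' + x * v'" "u' \<in> Eis" "v' \<in> Eis" for z u' v'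
    proof -
      obtain q where q: "q \<in> Eis" "cmod (z - g * q) < cmod g" using Eis_division uv by blast
      have "z - g * q = p * (u' - u * q) + x * (v' - v * q)" using z uv by (simp add: algebra_simps)
      moreover have "u' - u * q \<in> Eis" "v' - v * q \<in> Eis" using z uv q by auto
      ultimately have "z - g * q \<in> I" if "z - g * q \<noteq> 0" using that unfolding I_def by blast
      then have "z - g * q = 0" using gmin[of "z - g * q"] q by force
      then show ?thesis using q by (auto simp: edvd_def)
    qed
    have gp: "g edvd p" by (rule gd[of _ 1 0]) auto
    have gx: "g edvd x" by (rule gd[of _ 0 1]) auto
    have gE: "g \<in> Eis" using IE g by auto
    have "cmod g = 1"
    proof (rule ccontr)
      assume "cmod g \<noteq> 1"
      then have "cmod g > 1" using Eis_norm_ge_1[OF gE uv(4)] by simp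
      \<comment> \<open>A nonunit g would compete with p in \<open>S\<close>. Minimality then makes
        p and g associates, and p would divide x.\<close>
      then have "g \<in> S" using gE gp pE edvd_trans by (auto simp: S_def)
      then have le: "cmod p \<le> cmod g" by (rule pmin)
      obtain h where h: "h \<in> Eis" "p = g * h" using gp by (auto simp: edvd_def)
      have "cmod h \<le> 1" using le h uv(4) by (simp add: norm_mult)
      moreover have "h \<noteq> 0" using h p0 by auto
      ultimately have "cmod h = 1" using Eis_norm_ge_1[OF h(1)] by simp
      then have "h * cnj h = 1" by (simp add: complex_norm_square[symmetric])
      then have "g = p * cnj h" using h by (simp add: mult.assoc)
      then have "p edvd g" using h(1) by (metis edvdI Eis_cnj)
      then show False using gx edvd_trans xy by blast
    qed
    then have "g * cnj g = 1" by (simp add: complex_norm_square[symmetric])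
    then have "y = (p * u + x * v) * cnj g * y" using uv by simp
    also have "\<dots> = p * (u * cnj g * y) + x * y * (v * cnj g)" by (simp add: algebra_simps)
    also have "p edvd \<dots>" using xy(1-3) uv(1,2) gE by (meson edvd_add edvd_mult2 edvd_refl Eis_mult Eis_cnj) 
    finally show ?thesis .
  qed
  then have "eprime p" using pE unfolding eprime_def by blast
  with pE show ?thesis by blast
qed

text \<open>Induction on k: a further factor p divides one of the two cofactors. This is the form in
  which unique factorisation is used.\<close>

lemma eprime_power_dvd:
  assumes p: "eprime p" and xy: "x \<in> Eis" "y \<in> Eis" "p ^ k edvd x * y"
  shows "\<exists>i j. i + j = k \<and> p ^ i edvd x \<and> p ^ j edvd y"
  using xy(3)
proof (induction k)
  case 0
  then show ?case using xy by (auto simp: edvd_def)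
next
  case (Suc k)
  have pE: "p \<in> Eis" "p \<noteq> 0" using p by (auto simp: eprime_def)
  have "p ^ k edvd x * y" using Suc.prems by (rule edvd_trans[rotated]) (use pE in \<open>auto simp: mult.commute[of p]\<close>)
  then obtain i j where ij: "i + j = k" "p ^ i edvd x" "p ^ j edvd y" using Suc.IH by blast
  then obtain u v where uv: "u \<in> Eis" "v \<in> Eis" "x = p ^ i * u" "y = p ^ j * v" by (auto simp: edvd_def)
  have "x * y = p ^ k * (u * v)" using uv ij(1) by (auto simp: power_add)
  then have "p ^ k * p edvd p ^ k * (u * v)" using Suc.prems by (simp add: mult.commute)
  then have "p edvd u * v" using pE by (subst (asm) edvd_mult_cancel) auto
  then consider "p edvd u" | "p edvd v" using p uv by (auto simp: eprime_def)
  then show ?case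
  proof cases
    case 1
    then have "p ^ Suc i edvd x" using uv pE edvd_mult_cancel[of "p ^ i" p u] by (simp add: mult.commute)
    then show ?thesis using ij by (intro exI[of _ "Suc i"] exI[of _ j]) auto
  next
    case 2
    then have "p ^ Suc j edvd y" using uv pE edvd_mult_cancel[of "p ^ j" p v] by (simp add: mult.commute)
    then show ?thesis using ij by (intro exI[of _ i] exI[of _ "Suc j"]) auto
  qed
qed

lemma eprime_cnj: assumes "eprime p" shows "eprime (cnj p)"
proof -
  have "cnj p edvd x \<or> cnj p edvd y" if "x \<in> Eis" "y \<in> Eis" "cnj p edvd x * y" for x y
  proof -
    have "p edvd cnj x * cnj y" using edvd_cnj[OF that(3)] by simp
    then have "p edvd cnj x \<or> p edvd cnj y" using assms that by (auto simp: eprime_def)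
    then show ?thesis using edvd_cnj[of p "cnj x"] edvd_cnj[of p "cnj y"] by auto
  qed
  then show ?thesis using assms by (auto simp: eprime_def)
qed

text \<open>Write x = q^j u and split p^i between the two factors; nothing can go into q^j.\<close>

lemma eprime_power_coprime:
  assumes p: "eprime p" and q: "eprime q" "\<not> p edvd q" and x: "x \<in> Eis" "p ^ i edvd x" "q ^ j edvd x"
  shows "p ^ i * q ^ j edvd x"
proof -
  obtain u where u: "u \<in> Eis" "x = q ^ j * u" using x by (auto simp: edvd_def)
  have pE: "p \<in> Eis" "q \<in> Eis" "p \<noteq> 0" "q \<noteq> 0" using p q by (auto simp: eprime_def)
  have np: "\<not> p edvd q ^ j" for j
  proof (induction j)
    case 0
    show ?case
    proof
      assume "p edvd q ^ 0"
      then obtain z where z: "z \<in> Eis" "1 = p * z" by (auto simp: edvd_def)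
      then have "cmod p * cmod z = 1" by (metis norm_mult norm_one)
      moreover have "cmod z \<ge> 1" using z by (intro Eis_norm_ge_1) auto
      moreover have "cmod p > 1" using p by (simp add: eprime_def)
      ultimately show False by (smt (verit) mult_le_cancel_left1 mult_less_cancel_right1)
    qed
  next
    case (Suc j)
    then show ?case using p q pE unfolding eprime_def by (auto)
  qed
  obtain i1 i2 where i: "i1 + i2 = i" "p ^ i1 edvd q ^ j" "p ^ i2 edvd u"
    using eprime_power_dvd[OF p, of "q ^ j" u i] x u pE by auto
  have "i1 = 0"
  proof (rule ccontr)
    assume "i1 \<noteq> 0"
    then have "p edvd p ^ i1" using pE by (cases i1) auto
    then show False using i np edvd_trans by blast
  qed
  then have "q ^ j * p ^ i edvd x" using i u pE edvd_mult_cancel[of "q ^ j"] by auto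
  then show ?thesis by (simp add: mult.commute)
qed

lemma mult_cnj_Eis: assumes "x \<in> Eis" shows "\<exists>n::int. x * cnj x = of_int n \<and> real_of_int n = (cmod x)\<^sup>2"
proof -
  obtain n :: nat where n: "(cmod x)\<^sup>2 = real n" using Eis_norm_nat assms by blast
  then have "x * cnj x = of_int (int n)" by (simp only: complex_norm_square[symmetric] of_real_power[symmetric] of_real_of_nat_eq of_int_of_nat_eq)
  then show ?thesis using n by (intro exI[of _ "int n"]) auto
qed

text \<open>Primes dividing \<alpha> are stripped off three at a time, counting conjugates: since the norm of
  \<alpha> is a cube, one of p^3, p^2 p', p p'^2, p'^3 (with p' the conjugate of p) divides \<alpha>.\<close>

lemma Eis_cube_norm_decomposition:
  assumes "\<alpha> \<in> Eis" "\<alpha> \<noteq> 0" "\<alpha> * cnj \<alpha> = of_int n ^ 3"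
  shows "\<exists>\<delta>\<in>Eis. \<exists>\<kappa>\<in>Eis. \<alpha> = \<delta> * cnj \<delta> * \<delta> * \<kappa> ^ 3"
  using assms
proof (induction "nat \<lfloor>(cmod \<alpha>)\<^sup>2\<rfloor>" arbitrary: \<alpha> n rule: less_induct)
  case less
  note \<alpha> = less.prems
  show ?case
  proof (cases "cmod \<alpha> > 1")
    case False
    then have "cmod \<alpha> = 1" using Eis_norm_ge_1 \<alpha> by force
    then have "\<alpha> * cnj \<alpha> = 1" by (simp add: complex_norm_square[symmetric])
    \<comment> \<open>A unit is absorbed by \<delta>, because its norm is 1.\<close>
    then show ?thesis using \<alpha> by (intro bexI[of _ \<alpha>] bexI[of _ 1]) auto
  next
    case True
    obtain p where p: "eprime p" "p edvd \<alpha>" using eprime_divisor_exists \<alpha> True by blast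
    define p' where "p' = cnj p"
    have p': "eprime p'" using eprime_cnj p by (simp add: p'_def)
    have pE: "p \<in> Eis" "p' \<in> Eis" "p \<noteq> 0" "p' \<noteq> 0" "cmod p > 1" using p p' by (auto simp: eprime_def)
    have [simp]: "cnj p = p'" "cnj p' = p" unfolding p'_def by (rule refl, rule complex_cnj_cnj)
    obtain N :: int where N: "p * p' = of_int N" "real_of_int N = (cmod p)\<^sup>2"
      using mult_cnj_Eis[OF pE(1)] by auto
    have N1: "real_of_int N > 1" using N pE by (simp add: one_less_power)
    \<comment> \<open>The induction step for any admissible divisor c of norm N^3: the cofactor
      \<beta> has norm (n/N)^3, and assumption \<open>cc\<close> says that c can be absorbed into a
      decomposition of \<beta>.\<close>
    have red: ?thesis if c: "c \<in> Eis" "\<alpha> = c * \<beta>" "\<beta> \<in> Eis" "c * cnj c = of_int N ^ 3"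
       and cc: "\<And>\<delta> \<kappa>. \<delta> \<in> Eis \<Longrightarrow> \<kappa> \<in> Eis \<Longrightarrow>
              \<exists>\<delta>'\<in>Eis. \<exists>\<kappa>'\<in>Eis. c * (\<delta> * cnj \<delta> * \<delta> * \<kappa> ^ 3) = \<delta>' * cnj \<delta>' * \<delta>' * \<kappa>' ^ 3"
       and Nn: "p * p' edvd of_int n" for c \<beta>
    proof -
      obtain z where z: "z \<in> Eis" "of_int n = of_int N * z" using Nn N by (auto simp: edvd_def)
      then have "\<exists>k::int. z = of_int k" using N1 by (intro Eis_rational[of z N n]) auto
      then obtain k :: int where k: "z = of_int k" by blast
      have "\<alpha> * cnj \<alpha> = (c * cnj c) * (\<beta> * cnj \<beta>)" by (simp add: c(2))
      then have "of_int N ^ 3 * (\<beta> * cnj \<beta>) = (of_int N * of_int k) ^ 3"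
        unfolding \<alpha>(3) c(4) z(2) k by (rule sym)
      then have "of_int N ^ 3 * (\<beta> * cnj \<beta>) = of_int N ^ 3 * of_int k ^ 3"
        by (simp only: power_mult_distrib)
      then have \<beta>n: "\<beta> * cnj \<beta> = of_int k ^ 3" using N1 by simp
      have \<beta>0: "\<beta> \<noteq> 0" using c \<alpha> by auto
      have "(of_real ((cmod c)\<^sup>2) :: complex) = of_real (real_of_int N ^ 3)" using c(4)
        by (metis complex_norm_square of_real_power of_real_of_int_eq)
      then have "(cmod c)\<^sup>2 = real_of_int N ^ 3" using of_real_eq_iff by blast
      then have "(cmod c)\<^sup>2 > 1" using N1 by (simp add: one_less_power)
      then have "(cmod \<beta>)\<^sup>2 < (cmod \<alpha>)\<^sup>2" using c(2) \<beta>0 by (simp add: norm_mult power_mult_distrib)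
      moreover obtain n1 n2 :: nat where "(cmod \<beta>)\<^sup>2 = real n1" "(cmod \<alpha>)\<^sup>2 = real n2"
        using Eis_norm_nat c(3) \<alpha>(1) by meson
      ultimately have "nat \<lfloor>(cmod \<beta>)\<^sup>2\<rfloor> < nat \<lfloor>(cmod \<alpha>)\<^sup>2\<rfloor>" by simp
      from less.hyps[OF this c(3) \<beta>0 \<beta>n]
      show ?thesis using c(2) cc by blast
    qed
    have \<alpha>n: "\<alpha> * cnj \<alpha> = of_int n * (of_int n * of_int n)" using \<alpha>(3) by (simp add: power3_eq_cube mult.assoc)
    have "p edvd of_int n * (of_int n * of_int n)" unfolding \<alpha>n[symmetric] using p(2) \<alpha>(1) by (intro edvd_mult2 Eis_cnj)
    then have pn: "p edvd of_int n" using p(1) unfolding eprime_def by (meson Eis_of_int Eis_mult)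
    then have p'n: "p' edvd of_int n" using edvd_cnj[OF pn] by simp
    have cub: "x ^ 3 edvd y ^ 3" if "x edvd y" for x y
      using that by (auto simp: edvd_def power_mult_distrib)
    show ?thesis
    proof (cases "p edvd p'")
      case False
      have ppn: "p * p' edvd of_int n" using eprime_power_coprime[OF p(1) p' False, of "of_int n" 1 1] pn p'n by simp
      have "p ^ 3 edvd \<alpha> * cnj \<alpha>" using cub[OF pn] \<alpha>(3) by simp
      then obtain i j where ij: "i + j = 3" "p ^ i edvd \<alpha>" "p ^ j edvd cnj \<alpha>"
        using eprime_power_dvd[OF p(1) \<alpha>(1)] \<alpha>(1) by blast
      \<comment> \<open>What the conjugate of \<alpha> receives from p^3 is moved back to \<alpha>
        by conjugation.\<close>
      have "p' ^ j edvd \<alpha>" using edvd_cnj[OF ij(3)] by simp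
      then have "p ^ i * p' ^ j edvd \<alpha>" using eprime_power_coprime[OF p(1) p' False \<alpha>(1) ij(2)] by simp
      then obtain \<beta> where \<beta>: "\<beta> \<in> Eis" "\<alpha> = p ^ i * p' ^ j * \<beta>" by (auto simp: edvd_def)
      show ?thesis
      proof (rule red[OF _ \<beta>(2) \<beta>(1) _ _ ppn])
        show "p ^ i * p' ^ j \<in> Eis" using pE by auto
        have "p ^ i * p' ^ j * cnj (p ^ i * p' ^ j) = (p * p') ^ (i + j)"
          by (simp add: power_mult_distrib power_add)
        then show "p ^ i * p' ^ j * cnj (p ^ i * p' ^ j) = of_int N ^ 3" using ij N by simp
        fix \<delta> \<kappa> assume dk: "\<delta> \<in> Eis" "\<kappa> \<in> Eis"
        \<comment> \<open>The cubes p'^3 and p^3 go into \<kappa>. The mixed products are N(p')p'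
          and N(p)p, so they go into \<delta>.\<close>
        consider "i = 0" "j = 3" | "i = 1" "j = 2" | "i = 2" "j = 1" | "i = 3" "j = 0" using ij(1) by linarith
        then show "\<exists>\<delta>'\<in>Eis. \<exists>\<kappa>'\<in>Eis. p ^ i * p' ^ j * (\<delta> * cnj \<delta> * \<delta> * \<kappa> ^ 3) = \<delta>' * cnj \<delta>' * \<delta>' * \<kappa>' ^ 3"
        proof cases
          case 1 then show ?thesis using dk pE by (intro bexI[of _ \<delta>] bexI[of _ "p' * \<kappa>"] Eis_mult) (simp_all add: power_mult_distrib)
        next
          case 2 then show ?thesis using dk pE by (intro bexI[of _ "p' * \<delta>"] bexI[of _ "\<kappa>"] Eis_mult) (simp_all add: mult_ac power2_eq_square)
        next
          case 3 then show ?thesis using dk pE by (intro bexI[of _ "p * \<delta>"] bexI[of _ "\<kappa>"] Eis_mult) (simp_all add: mult_ac power2_eq_square)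
        next
          case 4 then show ?thesis using dk pE by (intro bexI[of _ \<delta>] bexI[of _ "p * \<kappa>"] Eis_mult) (simp_all add: power_mult_distrib)
        qed
      qed
    next
      case True
      \<comment> \<open>Now p is associate to its conjugate, being inert or ramified, and powers of
        p can be moved freely between \<alpha> and its conjugate.\<close>
      then obtain u where u: "u \<in> Eis" "p' = p * u" by (auto simp: edvd_def)
      have "cmod p' = cmod p" unfolding p'_def by (rule complex_mod_cnj)
      then have cu: "cmod u = 1" using u pE by (simp add: norm_mult)
      then have uu: "u * cnj u = 1" by (simp add: complex_norm_square[symmetric])
      have pw: "p ^ j edvd \<alpha>" if "p ^ j edvd cnj \<alpha>" for j
      proof -
        have "p' ^ j edvd \<alpha>" using edvd_cnj[OF that] by simp
        moreover have "p ^ j edvd p' ^ j" using u by (auto simp: power_mult_distrib)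
        ultimately show ?thesis using edvd_trans by blast
      qed
      have pwm: "p ^ k edvd \<alpha>" if "p ^ l edvd \<alpha>" "k \<le> l" for k l
      proof -
        have "p ^ l = p ^ k * p ^ (l - k)" using that by (simp flip: power_add)
        then have "p ^ k edvd p ^ l" using pE by auto
        then show ?thesis using that edvd_trans by blast
      qed
      obtain m where m: "m \<in> Eis" "of_int n = p * m" using pn by (auto simp: edvd_def)
      have "p ^ 3 edvd \<alpha> * cnj \<alpha>" using cub[OF pn] \<alpha>(3) by simp
      then obtain i j where ij: "i + j = 3" "p ^ i edvd \<alpha>" "p ^ j edvd cnj \<alpha>"
        using eprime_power_dvd[OF p(1) \<alpha>(1)] \<alpha>(1) by blast
      \<comment> \<open>Splitting p^3 over two factors yields only p^2. But then p^4 divides the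
        cube n^3 and p divides n/p, so p^6 divides the norm, and half of it is the p^3
        needed.\<close>
      have "p ^ 2 edvd \<alpha>"
      proof (cases "i \<ge> 2")
        case True then show ?thesis using pwm ij by blast
      next
        case False then have "j \<ge> 2" using ij by simp
        then show ?thesis using pwm pw ij by blast
      qed
      then obtain \<beta> where \<beta>: "\<beta> \<in> Eis" "\<alpha> = p ^ 2 * \<beta>" by (auto simp: edvd_def)
      have "p ^ 3 * (p * (u ^ 2 * \<beta> * cnj \<beta>)) = \<alpha> * cnj \<alpha>"
        using \<beta> u by (simp add: power2_eq_square power3_eq_cube algebra_simps)
      also have "\<dots> = p ^ 3 * m ^ 3" using \<alpha>(3) m by (simp add: power_mult_distrib)
      finally have "p * (u ^ 2 * \<beta> * cnj \<beta>) = m * (m * m)" using pE by (simp add: power3_eq_cube)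
      then have "p edvd m * (m * m)" using u \<beta> by (metis Eis_cnj Eis_mult Eis_power edvdI)
      then have "p edvd m" using p(1) m unfolding eprime_def by (meson Eis_mult)
      then obtain m' where m': "m' \<in> Eis" "m = p * m'" by (auto simp: edvd_def)
      have ppn: "p * p' edvd of_int n"
      proof -
        have "of_int n = p * p' * (cnj u * m')" using m m' u uu by (simp add: algebra_simps)
        then show ?thesis using m' u by (simp add: edvd_def) blast
      qed
      have "\<alpha> * cnj \<alpha> = p ^ 6 * m' ^ 3" using \<alpha>(3) m m' by (simp add: power_mult_distrib algebra_simps eval_nat_numeral)
      then have "p ^ 6 edvd \<alpha> * cnj \<alpha>" using m' by auto
      then obtain i j where ij: "i + j = 6" "p ^ i edvd \<alpha>" "p ^ j edvd cnj \<alpha>"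
        using eprime_power_dvd[OF p(1) \<alpha>(1)] \<alpha>(1) by blast
      have "p ^ 3 edvd \<alpha>"
      proof (cases "i \<ge> 3")
        case True then show ?thesis using pwm ij by blast
      next
        case False then have "j \<ge> 3" using ij by simp
        then show ?thesis using pwm pw ij by blast
      qed
      then obtain \<gamma> where \<gamma>: "\<gamma> \<in> Eis" "\<alpha> = p ^ 3 * \<gamma>" by (auto simp: edvd_def)
      show ?thesis
      proof (rule red[OF _ \<gamma>(2) \<gamma>(1) _ _ ppn])
        show "p ^ 3 \<in> Eis" using pE by auto
        show "p ^ 3 * cnj (p ^ 3) = of_int N ^ 3" using N by (simp flip: power_mult_distrib)
        fix \<delta> \<kappa> assume dk: "\<delta> \<in> Eis" "\<kappa> \<in> Eis"
        then show "\<exists>\<delta>'\<in>Eis. \<exists>\<kappa>'\<in>Eis. p ^ 3 * (\<delta> * cnj \<delta> * \<delta> * \<kappa> ^ 3) = \<delta>' * cnj \<delta>' * \<delta>' * \<kappa>' ^ 3"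
          using pE by (intro bexI[of _ \<delta>] bexI[of _ "p * \<kappa>"] Eis_mult) (simp_all add: power_mult_distrib)
      qed
    qed
  qed
qed

section \<open>Cubics with an integer root\<close>

lemma card_int_interval:
  fixes x y :: real
  assumes "x \<le> y"
  shows "finite {s::int. x \<le> s \<and> s \<le> y}" "\<bar>real (card {s::int. x \<le> s \<and> s \<le> y}) - (y - x)\<bar> \<le> 1"
proof -
  have eq: "{s::int. x \<le> s \<and> s \<le> y} = {\<lceil>x\<rceil>..\<lfloor>y\<rfloor>}"
    by (auto simp: le_floor_iff ceiling_le_iff)
  show "finite {s::int. x \<le> s \<and> s \<le> y}" unfolding eq by simp
  have c: "card {s::int. x \<le> s \<and> s \<le> y} = nat (\<lfloor>y\<rfloor> - \<lceil>x\<rceil> + 1)" unfolding eq by simp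
  have "\<lfloor>y\<rfloor> - \<lceil>x\<rceil> + 1 \<ge> 0" using assms by linarith
  then have "real (nat (\<lfloor>y\<rfloor> - \<lceil>x\<rceil> + 1)) = real_of_int \<lfloor>y\<rfloor> - real_of_int \<lceil>x\<rceil> + 1" by simp
  then show "\<bar>real (card {s::int. x \<le> s \<and> s \<le> y}) - (y - x)\<bar> \<le> 1"
    unfolding c by linarith
qed

text \<open>The convention that 0 counts as 1 lets zero entries take part in sums of reciprocals and
  in bounds for products.\<close>

definition hat :: "int \<Rightarrow> real" where "hat x = max 1 \<bar>real_of_int x\<bar>"

definition hatsum :: "int \<Rightarrow> real" where "hatsum M = (\<Sum>x\<in>{-M..M}. 1 / hat x)"

lemma hat_ge_1: "hat x \<ge> 1" and hat_pos: "hat x > 0"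
  by (auto simp: hat_def)

lemma hatsum_nonneg: "hatsum M \<ge> 0"
  unfolding hatsum_def by (intro sum_nonneg) (simp add: hat_def)

lemma hatsum_mono: "M \<le> M' \<Longrightarrow> hatsum M \<le> hatsum M'"
  unfolding hatsum_def by (intro sum_mono2) (auto simp: hat_def)

lemma sum_int_symmetric:
  fixes f :: "int \<Rightarrow> real"
  assumes "\<And>x. f (- x) = f x"
  shows "(\<Sum>x\<in>{- int n..int n}. f x) = f 0 + 2 * (\<Sum>k=1..n. f (int k))"
proof (induction n)
  case (Suc n)
  have "{- int (Suc n)..int (Suc n)} = insert (int (Suc n)) (insert (- int (Suc n)) {- int n..int n})"
    by auto
  then show ?case using Suc assms[of "int (Suc n)"] by simp
qed simp

lemma hatsum_le:
  assumes "M \<ge> 1"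
  shows "hatsum (int M) \<le> 3 + 2 * ln (real M)"
proof -
  have "hatsum (int M) = 1 + 2 * (\<Sum>k=1..M. 1 / hat (int k))"
    unfolding hatsum_def by (subst sum_int_symmetric) (simp_all add: hat_def)
  also have "(\<Sum>k=1..M. 1 / hat (int k)) = harm M"
    unfolding harm_def by (intro sum.cong) (auto simp: hat_def field_simps)
  also have "harm M \<le> 1 + ln (real M)"
    using assms
  proof (induction M rule: dec_induct)
    case base
    then show ?case by (simp add: harm_def)
  next
    case (step n)
    have "1 / real (Suc n) \<le> ln (real (Suc n)) - ln (real n)"
    proof -
      have "ln (real n / real (Suc n)) \<le> real n / real (Suc n) - 1"
        using step by (intro ln_le_minus_one) auto
      also have "\<dots> = - (1 / real (Suc n))" by (simp add: field_simps)
      finally show ?thesis using step by (simp add: ln_div)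
    qed
    then show ?case using step.IH by (simp add: harm_Suc inverse_eq_divide)
  qed
  finally show ?thesis by simp
qed

text \<open>Each counted triple has weight N / (\<open>hat x * hat y * hat z\<close>) \<ge> 1.
  Summing the weights over the whole box factors into the third power of
  \<open>hatsum N\<close>.\<close>

lemma card_triples_hat:
  assumes "N \<ge> 1"
  shows "finite {(x, y, z). hat x * hat y * hat z \<le> real_of_int N}"
    "real (card {(x, y, z). hat x * hat y * hat z \<le> real_of_int N}) \<le> real_of_int N * hatsum N ^ 3"
proof -
  let ?G = "{(x, y, z). hat x * hat y * hat z \<le> real_of_int N}"
  let ?B = "{-N..N} \<times> {-N..N} \<times> {-N..N}"
  have h: "x \<in> {-N..N} \<and> y \<in> {-N..N} \<and> z \<in> {-N..N}" if "hat x * hat y * hat z \<le> N" for x y z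
  proof -
    have *: "u \<in> {-N..N}" if "hat u \<le> N" for u using that by (auto simp: hat_def)
    have "hat x * 1 * 1 \<le> hat x * hat y * hat z" "1 * hat y * 1 \<le> hat x * hat y * hat z"
      "1 * 1 * hat z \<le> hat x * hat y * hat z"
      by (intro mult_mono; use hat_ge_1[of x] hat_ge_1[of y] hat_ge_1[of z] in simp)+
    then show ?thesis using that * by fastforce
  qed
  then have sub: "?G \<subseteq> ?B" by auto
  then show fin: "finite ?G" by (rule finite_subset) simp
  have "real (card ?G) = (\<Sum>p\<in>?G. 1)" by simp
  also have "\<dots> \<le> (\<Sum>(x, y, z)\<in>?G. real_of_int N * (1 / hat x * (1 / hat y * (1 / hat z))))"
  proof (rule sum_mono)
    fix p assume p: "p \<in> ?G"
    obtain x y z where xyz: "p = (x, y, z)" by (cases p) auto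
    then show "1 \<le> (case p of (x, y, z) \<Rightarrow> real_of_int N * (1 / hat x * (1 / hat y * (1 / hat z))))"
      using p hat_pos[of x] hat_pos[of y] hat_pos[of z] by (simp add: field_simps)
  qed
  also have "\<dots> \<le> (\<Sum>(x, y, z)\<in>?B. real_of_int N * (1 / hat x * (1 / hat y * (1 / hat z))))"
    using assms by (intro sum_mono2 sub) (auto simp: hat_def)
  also have "\<dots> = real_of_int N * hatsum N ^ 3"
    unfolding hatsum_def power3_eq_cube sum.cartesian_product[symmetric]
      sum_distrib_left[symmetric] sum_distrib_right[symmetric] by (simp only: mult.assoc)
  finally show "real (card ?G) \<le> real_of_int N * hatsum N ^ 3" .
qed

section \<open>Factorisations (X - r)(X^2 + sX + t) with coefficients s - r, t - rs, -rt bounded by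
  N\<close>

definition fact_slice :: "int \<Rightarrow> int \<Rightarrow> (int \<times> int) set" where
  "fact_slice N r = {(s, t). \<bar>s - r\<bar> \<le> N \<and> \<bar>t - r * s\<bar> \<le> N \<and> \<bar>r * t\<bar> \<le> N}"

text \<open>Without the bound on s - r the region is a parallelogram of area 4(N/r)^2, which can be
  counted line by line.\<close>

definition wide_slice :: "int \<Rightarrow> int \<Rightarrow> (int \<times> int) set" where
  "wide_slice N r = {(s, t). \<bar>t - r * s\<bar> \<le> N \<and> \<bar>r * t\<bar> \<le> N}"

text \<open>With x = N/r, t runs through an interval of length 2x, and for each t so does s; every
  interval costs an error of at most 1. Since x \<ge> 1, the total error 4x + 1 is at most
  5x.\<close>

lemma card_wide_slice:
  assumes "1 \<le> r" "r \<le> N"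
  shows "finite (wide_slice N r)" "\<bar>real (card (wide_slice N r)) - 4 * (N / r)\<^sup>2\<bar> \<le> 5 * (N / r)"
proof -
  define x where "x = real_of_int N / real_of_int r"
  have x: "x \<ge> 1" using assms by (simp add: x_def)
  define A where "A = {t::int. - x \<le> t \<and> t \<le> x}"
  define B where "B t = {s::int. real_of_int t / r - x \<le> s \<and> s \<le> real_of_int t / r + x}" for t :: int
  have A: "finite A" "\<bar>real (card A) - 2 * x\<bar> \<le> 1"
    using card_int_interval[of "- x" x] x by (simp_all add: A_def)
  have B: "finite (B t)" "\<bar>real (card (B t)) - 2 * x\<bar> \<le> 1" for t
    using card_int_interval[of "real_of_int t / r - x" "real_of_int t / r + x"] x by (simp_all add: B_def)
  have tA: "\<bar>r * t\<bar> \<le> N \<longleftrightarrow> t \<in> A" for t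
  proof -
    have "t \<in> A \<longleftrightarrow> \<bar>real_of_int t\<bar> \<le> x" by (auto simp: A_def)
    also have "\<dots> \<longleftrightarrow> real_of_int r * \<bar>real_of_int t\<bar> \<le> real_of_int N"
      using assms by (simp add: x_def field_simps)
    also have "\<dots> \<longleftrightarrow> real_of_int (\<bar>r * t\<bar>) \<le> real_of_int N" using assms by (simp add: abs_mult)
    finally show ?thesis by linarith
  qed
  have sB: "\<bar>t - r * s\<bar> \<le> N \<longleftrightarrow> s \<in> B t" for s t
  proof -
    have "s \<in> B t \<longleftrightarrow> t - N \<le> real_of_int r * s \<and> real_of_int r * s \<le> t + N"
      using assms by (simp add: B_def x_def field_simps)
    also have "\<dots> \<longleftrightarrow> real_of_int (t - N) \<le> real_of_int (r * s) \<and> real_of_int (r * s) \<le> real_of_int (t + N)"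
      by simp
    finally show ?thesis unfolding of_int_le_iff by linarith
  qed
  have eq: "wide_slice N r = prod.swap ` (SIGMA t:A. B t)"
    by (force simp: wide_slice_def tA sB)
  show "finite (wide_slice N r)" unfolding eq using A B by auto
  have "card (wide_slice N r) = (\<Sum>t\<in>A. card (B t))"
    unfolding eq by (subst card_image) (use A B in auto)
  then have c: "real (card (wide_slice N r)) = (\<Sum>t\<in>A. real (card (B t)))" by simp
  have "\<bar>real (card (wide_slice N r)) - real (card A) * (2 * x)\<bar> = \<bar>\<Sum>t\<in>A. real (card (B t)) - 2 * x\<bar>"
    by (simp add: c sum_subtractf)
  also have "\<dots> \<le> (\<Sum>t\<in>A. 1)" by (rule order_trans[OF sum_abs sum_mono]) (rule B(2))
  also have "\<dots> \<le> 2 * x + 1" using A(2) by simp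
  finally have 1: "\<bar>real (card (wide_slice N r)) - real (card A) * (2 * x)\<bar> \<le> 2 * x + 1" .
  have "real (card A) * (2 * x) - 4 * x\<^sup>2 = (real (card A) - 2 * x) * (2 * x)"
    by (simp add: algebra_simps power2_eq_square)
  then have "\<bar>real (card A) * (2 * x) - 4 * x\<^sup>2\<bar> = \<bar>real (card A) - 2 * x\<bar> * (2 * x)"
    using x by (simp only: abs_mult)
  also have "\<dots> \<le> 1 * (2 * x)" using A(2) x by (intro mult_right_mono) auto
  finally have "\<bar>real (card (wide_slice N r)) - 4 * x\<^sup>2\<bar> \<le> 4 * x + 1" using 1 by linarith
  then show "\<bar>real (card (wide_slice N r)) - 4 * (N / r)\<^sup>2\<bar> \<le> 5 * (N / r)"
    using x unfolding x_def by linarith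
qed

text \<open>The two remaining inequalities give r|s| \<le> N + |t| \<le> 3N/2. For r between 2 and
  N/2 this leaves enough room for |s| + r \<le> N.\<close>

lemma fact_slice_eq_wide_slice:
  assumes "2 \<le> r" "2 * r \<le> N" "8 \<le> N"
  shows "fact_slice N r = wide_slice N r"
proof -
  have "\<bar>s - r\<bar> \<le> N" if st: "\<bar>t - r * s\<bar> \<le> N" "\<bar>r * t\<bar> \<le> N" for s t
  proof -
    have "2 * \<bar>t\<bar> \<le> r * \<bar>t\<bar>" using assms by (intro mult_right_mono) auto
    then have t: "2 * \<bar>t\<bar> \<le> N" using st(2) assms by (simp add: abs_mult)
    have "r * \<bar>s\<bar> \<le> N + \<bar>t\<bar>" using st(1) assms abs_triangle_ineq4[of t "t - r * s"] by (simp add: abs_mult)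
    then have rs: "2 * (r * \<bar>s\<bar>) \<le> 3 * N" using t by linarith
    have "\<bar>s\<bar> + r \<le> N"
    proof (rule ccontr)
      assume "\<not> \<bar>s\<bar> + r \<le> N"
      then have "\<bar>s\<bar> \<ge> N - r + 1" by linarith
      then have "r * (N - r + 1) \<le> r * \<bar>s\<bar>" using assms by (intro mult_left_mono) auto
      \<comment> \<open>Both range conditions on r enter through this product, which replaces r^2 by
        terms linear in r.\<close>
      moreover have "0 \<le> (r - 2) * (N - 2 * r)" using assms by simp
      then have "2 * (r * r) \<le> r * N + 4 * r - 2 * N" by (simp add: algebra_simps)
      moreover have "r * (N - r + 1) = r * N - r * r + r" by (simp add: algebra_simps)
      ultimately have "r * N \<le> N + 2 * r" using rs by linarith
      then have "r * (N - 2) \<le> N" by (simp add: algebra_simps)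
      moreover have "2 * (N - 2) \<le> r * (N - 2)" using assms by (intro mult_right_mono) auto
      ultimately have "2 * (N - 2) \<le> N" by (rule order_trans[rotated])
      then have "N \<le> 4" by simp
      then show False using assms(3) by simp
    qed
    then show ?thesis using assms(1) by linarith
  qed
  then show ?thesis by (auto simp: fact_slice_def wide_slice_def)
qed

lemma card_fact_slice:
  assumes "2 \<le> r" "r \<le> N" "8 \<le> N"
  shows "\<bar>real (card (fact_slice N r)) - 4 * (N / r)\<^sup>2\<bar> \<le> 13 * (N / r)"
proof (cases "2 * r \<le> N")
  case True
  have "real_of_int N / r \<ge> 0" using assms by simp
  then show ?thesis using card_wide_slice[of r N] fact_slice_eq_wide_slice[of r N] True assms by simp
next
  case False
  define x where "x = real_of_int N / real_of_int r"
  have x: "x \<ge> 1" using assms by (simp add: x_def)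
  have "real_of_int N \<le> 2 * real_of_int r" using False by linarith
  \<comment> \<open>For r > N/2 the main term is itself of the size of the error: 4x^2 \<le> 8x, and
    8 + 5 = 13.\<close>
  then have x2: "x \<le> 2" using assms by (simp add: x_def divide_le_eq)
  then have "x\<^sup>2 \<le> 2 * x" using x unfolding power2_eq_square by (intro mult_right_mono) auto
  moreover have "card (fact_slice N r) \<le> card (wide_slice N r)"
    using card_wide_slice[of r N] assms by (intro card_mono) (auto simp: fact_slice_def wide_slice_def)
  moreover have "\<bar>real (card (wide_slice N r)) - 4 * x\<^sup>2\<bar> \<le> 5 * x"
    unfolding x_def using card_wide_slice[of r N] assms by simp
  ultimately have "\<bar>real (card (fact_slice N r)) - 4 * x\<^sup>2\<bar> \<le> 13 * x" by linarith
  then show ?thesis by (simp add: x_def)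
qed

text \<open>The symmetry X to -X, which replaces (r, s, t) by (-r, -s, t).\<close>

lemma card_fact_slice_uminus: "card (fact_slice N (- r)) = card (fact_slice N r)"
proof -
  have "fact_slice N (- r) = (\<lambda>(s, t). (- s, t)) ` fact_slice N r"
  proof
    show "fact_slice N (- r) \<subseteq> (\<lambda>(s, t). (- s, t)) ` fact_slice N r"
    proof
      fix p assume p: "p \<in> fact_slice N (- r)"
      obtain s t where st: "p = (s, t)" by (cases p)
      have "(- s, t) \<in> fact_slice N r" using p unfolding st fact_slice_def by (auto simp: abs_mult)
      then show "p \<in> (\<lambda>(s, t). (- s, t)) ` fact_slice N r" unfolding st by force
    qed
  qed (auto simp: fact_slice_def abs_mult)
  then show ?thesis by (simp add: card_image inj_on_def split_beta prod_eq_iff)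
qed

lemma card_fact_slice_0:
  assumes "N \<ge> 0"
  shows "real (card (fact_slice N 0)) = (2 * real_of_int N + 1)\<^sup>2"
proof -
  have "fact_slice N 0 = {-N..N} \<times> {-N..N}" using assms by (auto simp: fact_slice_def)
  then show ?thesis using assms by (simp add: power2_eq_square)
qed

lemma sum_nat_of_int_0_to: "(\<Sum>s\<in>{0..int n}. s) * 2 = int n * (int n + 1)"
proof (induction n)
  case (Suc n)
  have "{0..int (Suc n)} = insert (int (Suc n)) {0..int n}" by auto
  then show ?case using Suc by (simp add: algebra_simps)
qed simp

text \<open>Here the bound on s - r does cut the parallelogram: it removes two corners of area about
  N^2/2 each. For given s, the number t lies in two overlapping intervals with 2N + 1 - |s| common
  integers.\<close>

lemma card_fact_slice_1:
  assumes "N \<ge> 1"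
  shows "real (card (fact_slice N 1)) = 3 * (real_of_int N)\<^sup>2 + 3 * real_of_int N"
proof -
  define n where "n = nat N"
  have N: "N = int n" and n: "n \<ge> 1" using assms by (simp_all add: n_def)
  have "fact_slice N 1 = (SIGMA s:{1 - N..1 + N}. {max (- N) (s - N)..min N (s + N)})"
    by (auto simp: fact_slice_def)
  then have "card (fact_slice N 1) = (\<Sum>s\<in>{1 - N..1 + N}. card {max (- N) (s - N)..min N (s + N)})"
    by simp
  also have "int \<dots> = (\<Sum>s\<in>{1 - N..1 + N}. 2 * N + 1 - \<bar>s\<bar>)"
    unfolding of_nat_sum using assms by (intro sum.cong) (auto simp: max_def min_def)
  also have "\<dots> = (2 * N + 1) * (2 * N + 1) - (\<Sum>s\<in>{1 - N..1 + N}. \<bar>s\<bar>)"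
    using assms by (simp add: sum_subtractf)
  also have "(\<Sum>s\<in>{1 - N..1 + N}. \<bar>s\<bar>) = (\<Sum>s\<in>{1 - N..-1}. \<bar>s\<bar>) + (\<Sum>s\<in>{0..1 + N}. \<bar>s\<bar>)"
    using assms by (subst sum.union_disjoint[symmetric]) (auto intro!: sum.cong)
  also have "(\<Sum>s\<in>{1 - N..-1}. \<bar>s\<bar>) = (\<Sum>s\<in>{1..N - 1}. s)"
    by (rule sum.reindex_bij_witness[of _ uminus uminus]) auto
  also have "\<dots> = (\<Sum>s\<in>{0..N - 1}. s)" by (rule sum.mono_neutral_left) auto
  also have "(\<Sum>s\<in>{0..1 + N}. \<bar>s\<bar>) = (\<Sum>s\<in>{0..1 + N}. s)" by (rule sum.cong) auto
  finally have e: "int (card (fact_slice N 1)) = (2 * N + 1) * (2 * N + 1) - ((\<Sum>s\<in>{0..N - 1}. s) + (\<Sum>s\<in>{0..1 + N}. s))" .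
  have "(\<Sum>s\<in>{0..N - 1}. s) * 2 = (N - 1) * N"
    using sum_nat_of_int_0_to[of "n - 1"] n by (simp add: N of_nat_diff)
  moreover have "(\<Sum>s\<in>{0..1 + N}. s) * 2 = (N + 1) * (N + 2)"
    using sum_nat_of_int_0_to[of "n + 1"] by (simp add: N add.commute)
  ultimately have "2 * int (card (fact_slice N 1)) = 2 * ((2 * N + 1) * (2 * N + 1)) - ((N - 1) * N + (N + 1) * (N + 2))"
    using e by linarith
  then have "int (card (fact_slice N 1)) = 3 * N\<^sup>2 + 3 * N" by (simp add: algebra_simps power2_eq_square)
  then have "real_of_int (int (card (fact_slice N 1))) = real_of_int (3 * N\<^sup>2 + 3 * N)" by (rule arg_cong)
  then show ?thesis by simp
qed

text \<open>The tail is compared with the telescoping series of 1/m - 1/(m + 1).\<close>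

lemma sum_inverse_squares_tail:
  assumes "n \<ge> 1"
  shows "\<bar>(\<Sum>k=1..n. 1 / (real k)\<^sup>2) - pi\<^sup>2 / 6\<bar> \<le> 1 / real n"
proof -
  have s: "(\<lambda>k. 1 / (real (Suc k))\<^sup>2) sums (pi\<^sup>2 / 6)" using inverse_squares_sums by (simp add: add.commute)
  have t: "(\<lambda>k. 1 / real (k + n) - 1 / real (Suc (k + n))) sums (1 / real n - 0)"
  proof -
    have "(\<lambda>k. 1 / real (k + n)) \<longlonglongrightarrow> 0"
      using LIMSEQ_ignore_initial_segment[OF lim_1_over_n, of n] by simp
    from telescope_sums'[OF this] show ?thesis by simp
  qed
  have sh: "(\<lambda>k. 1 / (real (Suc (k + n)))\<^sup>2) sums (pi\<^sup>2 / 6 - (\<Sum>k<n. 1 / (real (Suc k))\<^sup>2))"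
    using sums_split_initial_segment[OF s, of n] .
  have le: "1 / (real (Suc (k + n)))\<^sup>2 \<le> 1 / real (k + n) - 1 / real (Suc (k + n))" for k
  proof -
    define m where "m = real (k + n)"
    have m: "m \<ge> 1" using assms by (simp add: m_def)
    have "1 / (m + 1)\<^sup>2 \<le> 1 / (m * (m + 1))"
      using m by (intro divide_left_mono) (auto simp: power2_eq_square)
    also have "\<dots> = 1 / m - 1 / (m + 1)" using m by (simp add: field_simps)
    finally show ?thesis by (simp add: m_def add_ac)
  qed
  have "pi\<^sup>2 / 6 - (\<Sum>k<n. 1 / (real (Suc k))\<^sup>2) \<le> 1 / real n - 0"
    by (rule sums_le[OF _ sh t]) (rule le)
  moreover have "0 \<le> pi\<^sup>2 / 6 - (\<Sum>k<n. 1 / (real (Suc k))\<^sup>2)"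
    by (rule sums_le[OF _ sums_zero sh]) simp
  moreover have "(\<Sum>k<n. 1 / (real (Suc k))\<^sup>2) = (\<Sum>k=1..n. 1 / (real k)\<^sup>2)"
    by (rule sum.reindex_bij_witness[of _ "\<lambda>k. k - 1" Suc]) auto
  ultimately show ?thesis by simp
qed

definition fact_triples :: "int \<Rightarrow> (int \<times> int \<times> int) set" where
  "fact_triples N = (SIGMA r:{-N..N}. fact_slice N r)"

text \<open>If |r| > N, then |rt| \<le> N forces t = 0, then |rs| \<le> N forces s = 0, and |s - r|
  \<le> N fails. So restricting r to [-N, N] loses no factorisation.\<close>

lemma fact_slice_bounds:
  assumes "N \<ge> 0" "(s, t) \<in> fact_slice N r"
  shows "\<bar>r\<bar> \<le> N"
proof (rule ccontr)
  assume r: "\<not> \<bar>r\<bar> \<le> N"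
  have h: "u = 0" if "\<bar>r * u\<bar> \<le> N" for u
  proof (rule ccontr)
    assume "u \<noteq> 0"
    then have "\<bar>r\<bar> * 1 \<le> \<bar>r\<bar> * \<bar>u\<bar>" by (intro mult_left_mono) auto
    then show False using that r by (simp add: abs_mult)
  qed
  have "t = 0" using assms by (intro h) (simp add: fact_slice_def)
  moreover from this have "s = 0" using assms by (intro h) (simp add: fact_slice_def)
  ultimately show False using assms r by (simp add: fact_slice_def)
qed

lemma fact_triples_iff: "N \<ge> 0 \<Longrightarrow> (r, s, t) \<in> fact_triples N \<longleftrightarrow> (s, t) \<in> fact_slice N r"
  using fact_slice_bounds[of N s t r] by (auto simp: fact_triples_def)

lemma finite_fact_slice:
  assumes "N \<ge> 0"
  shows "finite (fact_slice N r)"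
proof -
  have "fact_slice N r \<subseteq> (SIGMA s:{r - N..r + N}. {r * s - N..r * s + N})"
    by (auto simp: fact_slice_def)
  then show ?thesis by (rule finite_subset) auto
qed

text \<open>The coefficient of n^2 is 4 from r = 0, 2 * 3 from r = 1 and r = -1, and 2 * 4(pi^2/6 -
  1) from the others, in total 8(pi^2/6 + 1/4).\<close>

lemma card_fact_triples:
  assumes n: "n \<ge> 8"
  shows "\<bar>real (card (fact_triples (int n))) - 8 * (pi\<^sup>2 / 6 + 1 / 4) * (real n)\<^sup>2\<bar> \<le> 45 * real n * hatsum (int n)"
proof -
  define N where "N = int n"
  have N: "N \<ge> 8" "real_of_int N = real n" using n by (simp_all add: N_def)
  define c where "c r = real (card (fact_slice N r))" for r
  have "card (fact_triples N) = (\<Sum>r\<in>{-N..N}. card (fact_slice N r))"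
    unfolding fact_triples_def using finite_fact_slice N by (subst card_SigmaI) auto
  then have "real (card (fact_triples N)) = (\<Sum>r\<in>{-int n..int n}. c r)" by (simp add: c_def N_def)
  also have "\<dots> = c 0 + 2 * (\<Sum>k=1..n. c (int k))"
    by (rule sum_int_symmetric) (simp add: c_def card_fact_slice_uminus)
  also have "{1..n} = insert 1 {2..n}" using n by auto
  also have "c 0 + 2 * (\<Sum>k\<in>insert 1 {2..n}. c (int k)) = c 0 + 2 * c 1 + 2 * (\<Sum>k\<in>{2..n}. c (int k))" by simp
  finally have tot: "real (card (fact_triples N)) = c 0 + 2 * c 1 + 2 * (\<Sum>k\<in>{2..n}. c (int k))" .
  have c0: "c 0 = (2 * real n + 1)\<^sup>2" using card_fact_slice_0[of N] N by (simp add: c_def)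
  have c1: "c 1 = 3 * (real n)\<^sup>2 + 3 * real n" using card_fact_slice_1[of N] N by (simp add: c_def)
  have hs: "hatsum N = 1 + 2 * (\<Sum>k=1..n. 1 / real k)"
  proof -
    have "hatsum N = 1 + 2 * (\<Sum>k=1..n. 1 / hat (int k))"
      unfolding hatsum_def N_def by (subst sum_int_symmetric) (simp_all add: hat_def)
    also have "(\<Sum>k=1..n. 1 / hat (int k)) = (\<Sum>k=1..n. 1 / real k)"
      by (intro sum.cong) (auto simp: hat_def)
    finally show ?thesis .
  qed
  have "\<bar>(\<Sum>k\<in>{2..n}. c (int k)) - (\<Sum>k\<in>{2..n}. 4 * (real n / real k)\<^sup>2)\<bar>
      = \<bar>\<Sum>k\<in>{2..n}. c (int k) - 4 * (real n / real k)\<^sup>2\<bar>" by (simp add: sum_subtractf)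
  also have "\<dots> \<le> (\<Sum>k\<in>{2..n}. 13 * (real n / real k))"
  proof (rule order_trans[OF sum_abs sum_mono])
    fix k assume "k \<in> {2..n}"
    then show "\<bar>c (int k) - 4 * (real n / real k)\<^sup>2\<bar> \<le> 13 * (real n / real k)"
      using card_fact_slice[of "int k" N] N by (simp add: c_def N_def)
  qed
  also have "\<dots> \<le> (\<Sum>k\<in>{1..n}. 13 * (real n / real k))" by (intro sum_mono2) auto
  also have "\<dots> = 13 * real n * (\<Sum>k=1..n. 1 / real k)" by (simp add: sum_distrib_left)
  finally have 1: "\<bar>(\<Sum>k\<in>{2..n}. c (int k)) - (\<Sum>k\<in>{2..n}. 4 * (real n / real k)\<^sup>2)\<bar>
     \<le> 13 * real n * (\<Sum>k=1..n. 1 / real k)" .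
  have "(\<Sum>k\<in>{2..n}. 4 * (real n / real k)\<^sup>2) = 4 * (real n)\<^sup>2 * (\<Sum>k\<in>{2..n}. 1 / (real k)\<^sup>2)"
    by (simp add: sum_distrib_left power_divide)
  also have "(\<Sum>k\<in>{2..n}. 1 / (real k)\<^sup>2) = (\<Sum>k=1..n. 1 / (real k)\<^sup>2) - 1"
  proof -
    have "{1..n} = insert 1 {2..n}" using n by auto
    then show ?thesis by simp
  qed
  finally have 2: "(\<Sum>k\<in>{2..n}. 4 * (real n / real k)\<^sup>2) = 4 * (real n)\<^sup>2 * ((\<Sum>k=1..n. 1 / (real k)\<^sup>2) - 1)" .
  define \<theta> where "\<theta> = (\<Sum>k=1..n. 1 / (real k)\<^sup>2) - pi\<^sup>2 / 6"
  define h where "h = (\<Sum>k=1..n. 1 / real k)"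
  define A where "A = (\<Sum>k\<in>{2..n}. c (int k))"
  have th: "\<bar>(real n)\<^sup>2 * \<theta>\<bar> \<le> real n"
  proof -
    have "(real n)\<^sup>2 * \<bar>\<theta>\<bar> \<le> (real n)\<^sup>2 * (1 / real n)"
      using sum_inverse_squares_tail[of n] n unfolding \<theta>_def by (intro mult_left_mono) auto
    also have "\<dots> = real n" by (simp add: power2_eq_square)
    finally show ?thesis by (simp add: abs_mult)
  qed
  have "A - 4 * (real n)\<^sup>2 * (\<theta> + pi\<^sup>2 / 6 - 1) \<le> 13 * real n * h"
       "4 * (real n)\<^sup>2 * (\<theta> + pi\<^sup>2 / 6 - 1) - A \<le> 13 * real n * h"
    using 1 unfolding 2 A_def \<theta>_def h_def by (simp_all add: abs_le_iff)
  then have "\<bar>A - 4 * (real n)\<^sup>2 * (pi\<^sup>2 / 6 - 1) - 4 * ((real n)\<^sup>2 * \<theta>)\<bar> \<le> 13 * (real n * h)"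
    by (simp add: algebra_simps)
  then have A: "\<bar>A - 4 * (real n)\<^sup>2 * (pi\<^sup>2 / 6 - 1)\<bar> \<le> 13 * (real n * h) + 4 * real n"
    using th by linarith
  \<comment> \<open>The linear term 10n is 4n from r = 0 plus 2 * 3n from r = 1 and r = -1.\<close>
  have "real (card (fact_triples N)) - 8 * (pi\<^sup>2 / 6 + 1 / 4) * (real n)\<^sup>2
     = 2 * (A - 4 * (real n)\<^sup>2 * (pi\<^sup>2 / 6 - 1)) + 10 * real n + 1" (is "?l = 2 * ?d + _ + _")
    unfolding tot c0 c1 A_def[symmetric] by (simp add: field_simps power2_eq_square)
  moreover have "\<bar>2 * d + 10 * real n + 1\<bar> \<le> 26 * (real n * h) + 18 * real n + 1"
    if "\<bar>d\<bar> \<le> 13 * (real n * h) + 4 * real n" for d using that by linarith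
  ultimately have "\<bar>real (card (fact_triples N)) - 8 * (pi\<^sup>2 / 6 + 1 / 4) * (real n)\<^sup>2\<bar>
     \<le> 26 * (real n * h) + 18 * real n + 1" using A by presburger
  also have "\<dots> \<le> 45 * real n * hatsum N"
  proof -
    have "h \<ge> 0" unfolding h_def by (intro sum_nonneg) auto
    then have "0 \<le> real n * h" by simp
    moreover have "45 * real n * hatsum N = 45 * real n + 90 * (real n * h)"
      unfolding hs h_def by (simp add: algebra_simps)
    moreover have "real n \<ge> 1" using n by simp
    ultimately show ?thesis by linarith
  qed
  finally show ?thesis by (simp add: N_def)
qed

section \<open>From factorisations to cubics with an integer root\<close>

definition root_triples :: "int \<Rightarrow> (int \<times> int \<times> int) set" where
  "root_triples N = {(a, b, c). \<bar>a\<bar> \<le> N \<and> \<bar>b\<bar> \<le> N \<and> \<bar>c\<bar> \<le> N \<and> (\<exists>r. r ^ 3 + a * r ^ 2 + b * r + c = 0)}"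

text \<open>Multiplying out, the map \<open>\<phi>\<close>, is onto the cubics with a root and
  injective where the quadratic factor has no integer root. The exceptional set \<open>D\<close> is
  parametrised by triples of roots and bounded by \<open>card_triples_hat\<close>.\<close>

lemma card_root_triples:
  assumes n: "n \<ge> 8"
  shows "\<bar>real (card (root_triples (int n))) - 8 * (pi\<^sup>2 / 6 + 1 / 4) * (real n)\<^sup>2\<bar> \<le> 46 * real n * (1 + hatsum (int n)) ^ 3"
proof -
  define N where "N = int n"
  have N: "N \<ge> 8" "real_of_int N = real n" using n by (simp_all add: N_def)
  define \<phi> where "\<phi> = (\<lambda>(r, s, t). (s - r, t - r * s, - (r * t)) :: int \<times> int \<times> int)"
  define T where "T = fact_triples N"
  have T_iff: "(r, s, t) \<in> T \<longleftrightarrow> \<bar>s - r\<bar> \<le> N \<and> \<bar>t - r * s\<bar> \<le> N \<and> \<bar>r * t\<bar> \<le> N" for r s t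
    unfolding T_def using N by (subst fact_triples_iff) (auto simp: fact_slice_def)
  have finT: "finite T" unfolding T_def fact_triples_def using finite_fact_slice N by auto
  have root: "x ^ 3 + (s - r) * x ^ 2 + (t - r * s) * x + - (r * t) = (x - r) * (x ^ 2 + s * x + t)"
    for x r s t :: int by (simp add: algebra_simps power2_eq_square power3_eq_cube)
  have im: "\<phi> ` T = root_triples N"
  proof
    show "\<phi> ` T \<subseteq> root_triples N"
    proof
      fix q assume "q \<in> \<phi> ` T"
      then obtain r s t where rst: "(r, s, t) \<in> T" "q = \<phi> (r, s, t)" by auto
      have "r ^ 3 + (s - r) * r ^ 2 + (t - r * s) * r + - (r * t) = 0" unfolding root by simp
      then show "q \<in> root_triples N" using rst unfolding T_iff \<phi>_def root_triples_def by auto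
    qed
    show "root_triples N \<subseteq> \<phi> ` T"
    proof
      fix q assume "q \<in> root_triples N"
      then obtain a b c r where q: "q = (a, b, c)" "\<bar>a\<bar> \<le> N" "\<bar>b\<bar> \<le> N" "\<bar>c\<bar> \<le> N" "r ^ 3 + a * r ^ 2 + b * r + c = 0"
        by (auto simp: root_triples_def)
      define s t where "s = a + r" and "t = b + r * s"
      have c: "c = - (r * t)" using q(5) by (simp add: s_def t_def algebra_simps power2_eq_square power3_eq_cube)
      have "q = \<phi> (r, s, t)" unfolding q(1) \<phi>_def by (simp add: c) (simp add: s_def t_def)
      moreover have "(r, s, t) \<in> T" unfolding T_iff using q(2-4) c by (simp add: t_def) (simp add: s_def)
      ultimately show "q \<in> \<phi> ` T" by blast
    qed
  qed
  define D where "D = {(r, s, t). (r, s, t) \<in> T \<and> (\<exists>x. x ^ 2 + s * x + t = 0)}"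
  have inj: "inj_on \<phi> (T - D)"
  proof (rule inj_onI)
    fix p q assume p: "p \<in> T - D" and q: "q \<in> T - D" and e: "\<phi> p = \<phi> q"
    obtain r s t where p': "p = (r, s, t)" by (cases p)
    obtain r' s' t' where q': "q = (r', s', t')" by (cases q)
    have eq: "s - r = s' - r'" "t - r * s = t' - r' * s'" "- (r * t) = - (r' * t')"
      using e by (simp_all add: p' q' \<phi>_def)
    \<comment> \<open>The root r' of the second factorisation is put into the first one.\<close>
    have "(r' - r) * (r' ^ 2 + s * r' + t) = (r' - r') * (r' ^ 2 + s' * r' + t')"
      unfolding root[symmetric] eq ..
    then have "r' = r \<or> r' ^ 2 + s * r' + t = 0" by simp
    then have "r' = r" using p by (auto simp: D_def p')
    then show "p = q" using eq by (simp add: p' q')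
  qed
  have DT: "D \<subseteq> T" by (auto simp: D_def)
  let ?G = "{(x, y, z). hat x * hat y * hat z \<le> real_of_int N}"
  have "D \<subseteq> (\<lambda>(x, y, z). (x, - (y + z), y * z)) ` ?G"
  proof
    fix p assume "p \<in> D"
    then obtain x s t y where p: "p = (x, s, t)" "(x, s, t) \<in> T" "y ^ 2 + s * y + t = 0" by (auto simp: D_def)
    define z where "z = - s - y"
    have s: "s = - (y + z)" by (simp add: z_def)
    have t: "t = y * z" using p(3) by (simp add: z_def algebra_simps power2_eq_square)
    have b: "\<bar>x + y + z\<bar> \<le> N" "\<bar>y * z + x * y + x * z\<bar> \<le> N" "\<bar>x * y * z\<bar> \<le> N"
    proof -
      have "\<bar>s - x\<bar> \<le> N" "\<bar>t - x * s\<bar> \<le> N" "\<bar>x * t\<bar> \<le> N" using p(2) by (simp_all add: T_iff)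
      then show "\<bar>x + y + z\<bar> \<le> N" "\<bar>y * z + x * y + x * z\<bar> \<le> N" "\<bar>x * y * z\<bar> \<le> N"
        unfolding s t by (simp_all add: algebra_simps abs_le_iff)
    qed
    have hat: "hat u = real_of_int (max 1 \<bar>u\<bar>)" for u by (simp add: hat_def)
    \<comment> \<open>The product of the nonzero roots is, up to sign, a coefficient: the constant
      one if no root is 0, the linear one if one is, the quadratic one if two are. If all are 0 the
      product is 1.\<close>
    have "max 1 \<bar>x\<bar> * max 1 \<bar>y\<bar> * max 1 \<bar>z\<bar> \<le> N"
    proof -
      have m: "u = 0 \<and> max 1 \<bar>u\<bar> = 1 \<or> u \<noteq> 0 \<and> max 1 \<bar>u\<bar> = \<bar>u\<bar>" for u :: int by auto
      show ?thesis using m[of x] m[of y] m[of z] b N by (auto simp: abs_mult)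
    qed
    then have "(x, y, z) \<in> ?G" unfolding hat by (simp flip: of_int_mult)
    moreover have "p = (\<lambda>(x, y, z). (x, - (y + z), y * z)) (x, y, z)" using p s t by simp
    ultimately show "p \<in> (\<lambda>(x, y, z). (x, - (y + z), y * z)) ` ?G" by blast
  qed
  then have "card D \<le> card ?G"
    using card_triples_hat(1)[of N] N by (intro surj_card_le) auto
  then have D: "real (card D) \<le> real n * hatsum N ^ 3"
    using card_triples_hat(2)[of N] N by simp
  have "card (\<phi> ` T) \<le> card T" using finT by (rule card_image_le)
  moreover have "card T - card D \<le> card (\<phi> ` T)"
  proof -
    have "card T - card D = card (T - D)" using finT DT by (simp add: card_Diff_subset finite_subset)
    also have "\<dots> = card (\<phi> ` (T - D))" using inj by (simp add: card_image)
    also have "\<dots> \<le> card (\<phi> ` T)" using finT by (intro card_mono) auto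
    finally show ?thesis .
  qed
  ultimately have "\<bar>real (card (root_triples N)) - real (card T)\<bar> \<le> real (card D)"
    unfolding im by linarith
  then have "\<bar>real (card (root_triples N)) - 8 * (pi\<^sup>2 / 6 + 1 / 4) * (real n)\<^sup>2\<bar>
     \<le> 45 * real n * hatsum N + real n * hatsum N ^ 3"
    using card_fact_triples[OF n] D unfolding T_def N_def by linarith
  also have "\<dots> \<le> 46 * real n * (1 + hatsum N) ^ 3"
  proof -
    define h where "h = hatsum N"
    have h: "h \<ge> 0" using hatsum_nonneg by (simp add: h_def)
    have "h \<le> (1 + h) ^ 3" using h by (simp add: power3_eq_cube algebra_simps)
    moreover have "h ^ 3 \<le> (1 + h) ^ 3" using h by (intro power_mono) auto
    ultimately have "45 * h + h ^ 3 \<le> 46 * (1 + h) ^ 3" by linarith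
    then have "real n * (45 * h + h ^ 3) \<le> real n * (46 * (1 + h) ^ 3)" by (intro mult_left_mono) auto
    then show ?thesis unfolding h_def by (simp add: algebra_simps)
  qed
  finally show ?thesis unfolding N_def .
qed

section \<open>Counting Eisenstein integers\<close>

lemma Eis_separated:
  assumes "z \<in> Eis" "w \<in> Eis" "cmod (z - w) < 1"
  shows "z = w"
  using Eis_norm_ge_1[of "z - w"] Eis_diff[OF assms(1,2)] assms(3) by force

lemma card_int_interval_le:
  fixes x y :: real
  assumes "x \<le> y"
  shows "real (card {s::int. x \<le> s \<and> s \<le> y}) \<le> y - x + 1"
  using card_int_interval(2)[OF assms] by linarith

text \<open>Rotated by u, distinct elements of the strip lie in distinct cells of a square grid of mesh 1/2,
  since two points of a cell are at distance less than 1.\<close>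

lemma card_Eis_strip:
  assumes u: "cmod u = 1" and "0 \<le> R" "0 \<le> W"
  shows "finite {z \<in> Eis. \<bar>Re (u * z)\<bar> \<le> R \<and> \<bar>Im (u * z)\<bar> \<le> W}"
    "real (card {z \<in> Eis. \<bar>Re (u * z)\<bar> \<le> R \<and> \<bar>Im (u * z)\<bar> \<le> W}) \<le> (4 * R + 2) * (4 * W + 2)"
proof -
  define S where "S = {z \<in> Eis. \<bar>Re (u * z)\<bar> \<le> R \<and> \<bar>Im (u * z)\<bar> \<le> W}"
  \<comment> \<open>Contains the floor of 2x whenever |x| \<le> B; its length 4B + 1 leaves room for
    at most 4B + 2 integers.\<close>
  define I where "I B = {s::int. - 2 * B - 1 \<le> s \<and> s \<le> 2 * B}" for B :: real
  define f where "f z = (\<lfloor>2 * Re (u * z)\<rfloor>, \<lfloor>2 * Im (u * z)\<rfloor>)" for z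
  have I: "finite (I B)" "real (card (I B)) \<le> 4 * B + 2" if "0 \<le> B" for B
    using card_int_interval(1)[of "- 2 * B - 1" "2 * B"] card_int_interval_le[of "- 2 * B - 1" "2 * B"] that
    by (simp_all add: I_def)
  have inj: "inj_on f S"
  proof (rule inj_onI)
    fix z w assume zw: "z \<in> S" "w \<in> S" "f z = f w"
    then have 1: "\<lfloor>2 * Re (u * z)\<rfloor> = \<lfloor>2 * Re (u * w)\<rfloor>" and 2: "\<lfloor>2 * Im (u * z)\<rfloor> = \<lfloor>2 * Im (u * w)\<rfloor>"
      by (simp_all add: f_def)
    have fl: "\<bar>x - y\<bar> \<le> 1 / 2" if "\<lfloor>2 * x\<rfloor> = \<lfloor>2 * y\<rfloor>" for x y :: real
      using that floor_correct[of "2 * x"] floor_correct[of "2 * y"] by linarith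
    have ab: "\<bar>Re (u * (z - w))\<bar> \<le> 1 / 2" "\<bar>Im (u * (z - w))\<bar> \<le> 1 / 2"
      using fl[OF 1] fl[OF 2] unfolding right_diff_distrib by simp_all
    have "(cmod (u * (z - w)))\<^sup>2 = \<bar>Re (u * (z - w))\<bar>\<^sup>2 + \<bar>Im (u * (z - w))\<bar>\<^sup>2"
      unfolding power2_abs by (rule cmod_power2)
    also have "\<dots> \<le> (1 / 2)\<^sup>2 + (1 / 2)\<^sup>2" by (intro add_mono power_mono ab) auto
    also have "\<dots> < 1\<^sup>2" by (simp add: power2_eq_square)
    finally have "cmod (u * (z - w)) < 1" by (rule power2_less_imp_less) simp
    then have "cmod (z - w) < 1" using u by (simp add: norm_mult)
    then show "z = w" using zw Eis_separated by (simp add: S_def)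
  qed
  have sub: "f ` S \<subseteq> I R \<times> I W"
  proof
    fix p assume "p \<in> f ` S"
    then obtain z where z: "z \<in> S" "p = f z" by blast
    have IB: "\<lfloor>2 * x\<rfloor> \<in> I B" if "\<bar>x\<bar> \<le> B" for x B :: real
      using that unfolding I_def by (simp add: abs_le_iff) linarith
    have "\<bar>Re (u * z)\<bar> \<le> R" "\<bar>Im (u * z)\<bar> \<le> W" using z(1) unfolding S_def by blast+
    then show "p \<in> I R \<times> I W" unfolding z(2) f_def by (intro SigmaI IB)
  qed
  have fin: "finite (I R \<times> I W)" using I assms by simp
  show "finite S" using inj_on_finite[OF inj sub fin] .
  have "card S \<le> card (I R \<times> I W)" using card_inj_on_le[OF inj sub fin] .
  also have "\<dots> = card (I R) * card (I W)" by (rule card_cartesian_product)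
  finally have "real (card S) \<le> real (card (I R)) * real (card (I W))"
    by (metis of_nat_le_iff of_nat_mult)
  also have "\<dots> \<le> (4 * R + 2) * (4 * W + 2)" using I assms by (intro mult_mono) auto
  finally show "real (card S) \<le> (4 * R + 2) * (4 * W + 2)" .
qed

text \<open>For a, a0 \<ge> A the difference of squares is at least 2A|a - a0|, so a window of
  length 6X for a^2 confines a to a distance 3X/A from a0. The width 3X reflects a^2 - P = 3b; the
  sign of a doubles the count, and X \<ge> A turns 2(6X/A + 1) into 14X/A.\<close>

lemma card_square_window:
  fixes A X P :: real
  assumes "A > 0" "X \<ge> A"
  shows "finite {a::int. A \<le> \<bar>real_of_int a\<bar> \<and> \<bar>(real_of_int a)\<^sup>2 - P\<bar> \<le> 3 * X}"
    "real (card {a::int. A \<le> \<bar>real_of_int a\<bar> \<and> \<bar>(real_of_int a)\<^sup>2 - P\<bar> \<le> 3 * X}) \<le> 14 * X / A"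
proof -
  define S where "S = {a::int. A \<le> real_of_int a \<and> \<bar>(real_of_int a)\<^sup>2 - P\<bar> \<le> 3 * X}"
  have S: "finite S \<and> real (card S) \<le> 6 * X / A + 1"
  proof (cases "S = {}")
    case True
    then show ?thesis using assms by simp
  next
    case False
    then obtain a0 where a0: "a0 \<in> S" by blast
    have "S \<subseteq> {s::int. real_of_int a0 - 3 * X / A \<le> s \<and> s \<le> real_of_int a0 + 3 * X / A}" (is "_ \<subseteq> ?I")
    proof
      fix a assume a: "a \<in> S"
      have "\<bar>real_of_int a - a0\<bar> * (2 * A) \<le> \<bar>real_of_int a - a0\<bar> * \<bar>real_of_int a + a0\<bar>"
        using a a0 assms by (intro mult_left_mono) (auto simp: S_def)
      also have "\<dots> = \<bar>(real_of_int a)\<^sup>2 - (real_of_int a0)\<^sup>2\<bar>"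
        by (simp add: abs_mult[symmetric] algebra_simps power2_eq_square)
      also have "\<dots> \<le> 6 * X" using a a0 unfolding S_def mem_Collect_eq by linarith
      finally have "\<bar>real_of_int a - a0\<bar> * A \<le> 3 * X" by (simp add: algebra_simps)
      then have "\<bar>real_of_int a - a0\<bar> \<le> 3 * X / A" unfolding pos_le_divide_eq[OF assms(1)] .
      then show "a \<in> ?I" by (simp add: abs_le_iff)
    qed
    moreover have le: "real_of_int a0 - 3 * X / A \<le> real_of_int a0 + 3 * X / A" using assms by simp
    ultimately have "finite S" "card S \<le> card ?I"
      using card_int_interval(1)[OF le] by (auto intro: finite_subset card_mono)
    then show ?thesis using card_int_interval_le[OF le] by simp
  qed
  have eq: "{a::int. A \<le> \<bar>real_of_int a\<bar> \<and> \<bar>(real_of_int a)\<^sup>2 - P\<bar> \<le> 3 * X} \<subseteq> S \<union> uminus ` S"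
  proof
    fix a :: int assume "a \<in> {a::int. A \<le> \<bar>real_of_int a\<bar> \<and> \<bar>(real_of_int a)\<^sup>2 - P\<bar> \<le> 3 * X}"
    then have "\<bar>a\<bar> \<in> S" by (simp add: S_def)
    moreover have "a = \<bar>a\<bar> \<or> a = - \<bar>a\<bar>" by linarith
    ultimately show "a \<in> S \<union> uminus ` S" by auto
  qed
  then show "finite {a::int. A \<le> \<bar>real_of_int a\<bar> \<and> \<bar>(real_of_int a)\<^sup>2 - P\<bar> \<le> 3 * X}" by (rule finite_subset) (use S in auto)
  have "card {a::int. A \<le> \<bar>real_of_int a\<bar> \<and> \<bar>(real_of_int a)\<^sup>2 - P\<bar> \<le> 3 * X} \<le> card (S \<union> uminus ` S)"
    using eq S by (intro card_mono) auto
  also have "\<dots> \<le> card S + card (uminus ` S)" by (rule card_Un_le)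
  also have "\<dots> \<le> card S + card S" using S by (simp add: card_image_le)
  finally have "real (card {a::int. A \<le> \<bar>real_of_int a\<bar> \<and> \<bar>(real_of_int a)\<^sup>2 - P\<bar> \<le> 3 * X}) \<le> real (card S + card S)"
    unfolding of_nat_le_iff .
  also have "\<dots> \<le> 2 * (6 * X / A + 1)" using S by simp
  also have "\<dots> \<le> 14 * X / A"
  proof -
    define q where "q = X / A"
    have "1 \<le> q" using assms by (simp add: q_def)
    moreover have "6 * X / A = 6 * q" "14 * X / A = 14 * q" by (simp_all add: q_def)
    ultimately show ?thesis by simp
  qed
  finally show "real (card {a::int. A \<le> \<bar>real_of_int a\<bar> \<and> \<bar>(real_of_int a)\<^sup>2 - P\<bar> \<le> 3 * X}) \<le> 14 * X / A" .
qed

text \<open>If p is smallest in modulus, then p^2 \<le> Z/2, while qr = p^2 - 3Z/4 because q + r =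
  -p. Hence 4|qr| \<ge> Z.\<close>

lemma small_of_zero_sum_triple:
  fixes p q r Z :: real
  assumes "p + q + r = 0" "p\<^sup>2 + q\<^sup>2 + r\<^sup>2 = 3 / 2 * Z"
  shows "\<exists>t\<in>{p, q, r}. \<bar>t\<bar> * Z \<le> 4 * \<bar>p * q * r\<bar>"
proof -
  have main: "\<bar>p\<bar> * Z \<le> 4 * \<bar>p * q * r\<bar>"
    if "\<bar>p\<bar> \<le> \<bar>q\<bar>" "\<bar>p\<bar> \<le> \<bar>r\<bar>" "p + q + r = 0" "p\<^sup>2 + q\<^sup>2 + r\<^sup>2 = 3 / 2 * Z" for p q r
  proof -
    have p2: "p\<^sup>2 \<le> q\<^sup>2" "p\<^sup>2 \<le> r\<^sup>2" using that by (auto simp: abs_le_square_iff)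
    have "(q + r)\<^sup>2 = p\<^sup>2" using that(3) by (metis add.assoc add_eq_0_iff power2_minus)
    then have "2 * (q * r) = p\<^sup>2 - (q\<^sup>2 + r\<^sup>2)" by (simp add: power2_sum)
    then have "q * r = p\<^sup>2 - 3 / 4 * Z" using that(4) by linarith
    then have "4 * \<bar>q * r\<bar> \<ge> Z" using p2 that(4) by linarith
    then have "\<bar>p\<bar> * Z \<le> \<bar>p\<bar> * (4 * \<bar>q * r\<bar>)" by (intro mult_left_mono) auto
    then show ?thesis by (simp add: abs_mult)
  qed
  consider "\<bar>p\<bar> \<le> \<bar>q\<bar>" "\<bar>p\<bar> \<le> \<bar>r\<bar>" | "\<bar>q\<bar> \<le> \<bar>p\<bar>" "\<bar>q\<bar> \<le> \<bar>r\<bar>" | "\<bar>r\<bar> \<le> \<bar>p\<bar>" "\<bar>r\<bar> \<le> \<bar>q\<bar>" by linarith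
  then show ?thesis
  proof cases
    case 1 then show ?thesis using main[of p q r] assms by auto
  next
    case 2 then show ?thesis using main[of q p r] assms by (auto simp: algebra_simps)
  next
    case 3 then show ?thesis using main[of r p q] assms by (auto simp: algebra_simps)
  qed
qed

lemma cmod_omega: "cmod omega = 1"
proof -
  have "(cmod omega)\<^sup>2 = 1\<^sup>2" using cmod_lin[of 0 1] by simp
  then show ?thesis by (rule power2_eq_imp_eq) auto
qed

text \<open>The imaginary parts of z, \<open>omega\<close> z and \<open>omega\<close>^2 z add up to
  0, and Im(z^3) is -4 times their product, the triple angle formula. So a small Im(z^3) puts z near
  one of three lines through 0.\<close>

lemma Im_cube_controls_argument:
  "\<exists>u\<in>{1, omega, omega\<^sup>2}. \<bar>Im (u * z)\<bar> * (cmod z)\<^sup>2 \<le> \<bar>Im (z ^ 3)\<bar>"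
proof -
  define x y where "x = Re z" and "y = Im z"
  define s where "s = sqrt 3"
  have s: "s * s = 3" by (simp add: s_def)
  have o2: "omega\<^sup>2 = - 1 - omega" using omega_sq by (simp add: power2_eq_square)
  define q r where "q = (s * x - y) / 2" and "r = (- s * x - y) / 2"
  have Im: "Im (1 * z) = y" "Im (omega * z) = q" "Im (omega\<^sup>2 * z) = r"
    unfolding o2 by (simp_all add: Re_omega Im_omega x_def y_def q_def r_def s_def field_simps)
  have qr: "q * r = (y * y - s * s * (x * x)) / 4" by (simp add: q_def r_def field_simps)
  have qr2: "q\<^sup>2 + r\<^sup>2 = (s * s * (x * x) + y * y) / 2"
    by (simp add: q_def r_def field_simps power2_eq_square)
  have "y + q + r = 0" by (simp add: q_def r_def field_simps)
  moreover have "y\<^sup>2 + q\<^sup>2 + r\<^sup>2 = 3 / 2 * (cmod z)\<^sup>2"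
    using qr2 unfolding s cmod_power2 x_def[symmetric] y_def[symmetric] by (simp add: power2_eq_square)
  ultimately obtain t where t: "t \<in> {y, q, r}" "\<bar>t\<bar> * (cmod z)\<^sup>2 \<le> 4 * \<bar>y * q * r\<bar>"
    using small_of_zero_sum_triple by blast
  have "Im (z ^ 3) = y * (3 * (x * x) - y * y)"
    by (simp add: power3_eq_cube x_def y_def algebra_simps)
  then have "Im (z ^ 3) = - 4 * (y * (q * r))" unfolding qr s by (simp add: algebra_simps)
  then have "4 * \<bar>y * q * r\<bar> = \<bar>Im (z ^ 3)\<bar>" by (simp add: abs_mult)
  then show ?thesis using t Im by auto
qed

section \<open>Reciprocal norms of Eisenstein integers\<close>

definition Eball :: "real \<Rightarrow> complex set" where
  "Eball X = {z \<in> Eis. z \<noteq> 0 \<and> (cmod z)\<^sup>2 \<le> X}"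

definition Esum :: "real \<Rightarrow> real" where
  "Esum X = (\<Sum>z\<in>Eball X. 1 / (cmod z)\<^sup>2)"

text \<open>Completing the square in either variable gives x^2 - xy + y^2 \<ge> 3/4 max(x^2, y^2).
  This bounds the coordinates by 4N and the reciprocal norm by a product of reciprocals of the
  coordinates, so that \<open>Esum\<close> is at most a squared logarithm.\<close>

lemma Eball_hat:
  assumes N: "N \<ge> 1" and X: "X \<le> 12 * real_of_int N"
  defines "e \<equiv> (\<lambda>(x, y). of_int x + of_int y * omega)"
  defines "B \<equiv> {(x, y). (x, y) \<in> {- (4 * N)..4 * N} \<times> {- (4 * N)..4 * N} \<and> e (x, y) \<in> Eball X}"
  shows "Eball X = e ` B" "inj_on e B" "(x, y) \<in> B \<Longrightarrow> 1 / (cmod (e (x, y)))\<^sup>2 \<le> 4 / 3 * (1 / hat x * (1 / hat y))"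
proof -
  have nrm: "3 / 4 * (real_of_int x)\<^sup>2 \<le> (cmod (e (x, y)))\<^sup>2 \<and> 3 / 4 * (real_of_int y)\<^sup>2 \<le> (cmod (e (x, y)))\<^sup>2" for x y
  proof -
    have n: "(cmod (e (x, y)))\<^sup>2 = real_of_int x * real_of_int x - real_of_int x * real_of_int y + real_of_int y * real_of_int y"
      unfolding e_def prod.case cmod_int by (simp add: power2_eq_square)
    have 1: "(cmod (e (x, y)))\<^sup>2 = 3 / 4 * (real_of_int x)\<^sup>2 + (real_of_int y - real_of_int x / 2)\<^sup>2"
      unfolding n by (simp add: power2_eq_square field_simps)
    have 2: "(cmod (e (x, y)))\<^sup>2 = 3 / 4 * (real_of_int y)\<^sup>2 + (real_of_int x - real_of_int y / 2)\<^sup>2"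
      unfolding n by (simp add: power2_eq_square field_simps)
    show ?thesis using 1 2 zero_le_power2[of "real_of_int y - real_of_int x / 2"]
      zero_le_power2[of "real_of_int x - real_of_int y / 2"] by linarith
  qed
  have bd: "\<bar>v\<bar> \<le> 4 * N" if "3 / 4 * (real_of_int v)\<^sup>2 \<le> 12 * real_of_int N" for v
  proof -
    have "(real_of_int \<bar>v\<bar>)\<^sup>2 \<le> 16 * real_of_int N" using that by simp
    also have "\<dots> \<le> (real_of_int (4 * N))\<^sup>2" using N by (simp add: power2_eq_square)
    finally have "real_of_int \<bar>v\<bar> \<le> real_of_int (4 * N)" by (rule power2_le_imp_le) (use N in simp)
    then show ?thesis by linarith
  qed
  show "Eball X = e ` B"
  proof
    show "Eball X \<subseteq> e ` B"
    proof
      fix z assume z: "z \<in> Eball X"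
      then obtain x y where xy: "z = e (x, y)" unfolding Eball_def Eis_iff e_def by auto
      have "\<bar>x\<bar> \<le> 4 * N" "\<bar>y\<bar> \<le> 4 * N"
        using nrm[of x y] z X xy by (auto intro!: bd simp: Eball_def)
      then have "(x, y) \<in> B" using z xy by (auto simp: B_def)
      then show "z \<in> e ` B" using xy by blast
    qed
  qed (auto simp: B_def)
  show "inj_on e B"
  proof (rule inj_onI, clarify)
    fix x y x' y' assume "e (x, y) = e (x', y')"
    then have "Im (e (x, y)) = Im (e (x', y'))" "Re (e (x, y)) = Re (e (x', y'))" by simp_all
    then show "x = x' \<and> y = y'" unfolding e_def by (simp add: Re_omega Im_omega)
  qed
  assume xy: "(x, y) \<in> B"
  have ge1: "(cmod (e (x, y)))\<^sup>2 \<ge> 1"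
  proof -
    have "cmod (e (x, y)) \<ge> 1" using xy Eis_norm_ge_1[of "e (x, y)"] by (simp add: B_def Eball_def)
    then show ?thesis by (simp add: one_le_power)
  qed
  have inv: "1 / c \<le> 4 / 3 * (1 / g)" if "0 < c" "0 < g" "g \<le> 4 / 3 * c" for c g :: real
    using that by (simp add: field_simps)
  define m where "m = max (hat x) (hat y)"
  have "m\<^sup>2 \<le> 4 / 3 * (cmod (e (x, y)))\<^sup>2"
  proof -
    have "m \<in> {1, \<bar>real_of_int x\<bar>, \<bar>real_of_int y\<bar>}" by (auto simp: m_def hat_def max_def)
    then have "m = 1 \<or> m = \<bar>real_of_int x\<bar> \<or> m = \<bar>real_of_int y\<bar>" by simp
    then show ?thesis
    proof (elim disjE)
      assume "m = 1" then show ?thesis using ge1 by simp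
    next
      assume "m = \<bar>real_of_int x\<bar>" then show ?thesis using nrm[of x y] by simp
    next
      assume "m = \<bar>real_of_int y\<bar>" then show ?thesis using nrm[of x y] by simp
    qed
  qed
  moreover have "hat x * hat y \<le> m * m" using hat_pos[of x] hat_pos[of y] unfolding m_def by (intro mult_mono) auto
  ultimately have "hat x * hat y \<le> 4 / 3 * (cmod (e (x, y)))\<^sup>2" by (simp add: power2_eq_square)
  then show "1 / (cmod (e (x, y)))\<^sup>2 \<le> 4 / 3 * (1 / hat x * (1 / hat y))"
    using inv[of "(cmod (e (x, y)))\<^sup>2" "hat x * hat y", OF less_le_trans[OF zero_less_one ge1]]
      hat_pos[of x] hat_pos[of y] by simp
qed

lemma Eball_Esum:
  assumes N: "N \<ge> 1" and X: "X \<le> 12 * real_of_int N"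
  shows "finite (Eball X)" "Esum X \<le> 4 / 3 * (hatsum (4 * N))\<^sup>2"
proof -
  let ?I = "{- (4 * N)..4 * N}"
  define e where "e = (\<lambda>(x, y). of_int x + of_int y * omega)"
  define B where "B = {(x, y). (x, y) \<in> ?I \<times> ?I \<and> e (x, y) \<in> Eball X}"
  note h = Eball_hat[OF N X, folded e_def, folded B_def]
  have BI: "B \<subseteq> ?I \<times> ?I" by (auto simp: B_def)
  have fin: "finite B" by (rule finite_subset[OF BI]) simp
  show "finite (Eball X)" unfolding h(1) using fin by simp
  have "Esum X = (\<Sum>p\<in>B. 1 / (cmod (e p))\<^sup>2)"
    unfolding Esum_def h(1) by (subst sum.reindex[OF h(2)]) simp
  also have "\<dots> \<le> (\<Sum>(x, y)\<in>B. 4 / 3 * (1 / hat x * (1 / hat y)))"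
    by (rule sum_mono) (use h(3) in auto)
  also have "\<dots> \<le> (\<Sum>(x, y)\<in>?I \<times> ?I. 4 / 3 * (1 / hat x * (1 / hat y)))"
    by (rule sum_mono2[OF _ BI]) (auto simp: hat_def)
  also have "\<dots> = 4 / 3 * (hatsum (4 * N))\<^sup>2"
    unfolding hatsum_def power2_eq_square sum.cartesian_product[symmetric]
      sum_distrib_left[symmetric] sum_distrib_right[symmetric] ..
  finally show "Esum X \<le> 4 / 3 * (hatsum (4 * N))\<^sup>2" .
qed

lemma Esum_nonneg: "0 \<le> Esum X"
  unfolding Esum_def by (intro sum_nonneg) auto

text \<open>Serves the range |a| \<le> 3 sqrt X, where P = a^2 - 3b \<le> 9X + 3X. As for triples,
  each pair gets a weight that is at least 1.\<close>

lemma card_Eball_products: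
  assumes N: "N \<ge> 1"
  defines "G \<equiv> {(\<delta>, \<kappa>). \<delta> \<in> Eis \<and> \<kappa> \<in> Eis \<and> \<delta> \<noteq> 0 \<and> \<kappa> \<noteq> 0 \<and> (cmod \<delta>)\<^sup>2 * (cmod \<kappa>)\<^sup>2 \<le> 12 * real_of_int N}"
  shows "finite G" "real (card G) \<le> 12 * real_of_int N * (Esum (12 * real_of_int N))\<^sup>2"
proof -
  let ?Z = "Eball (12 * real_of_int N)"
  have sub: "G \<subseteq> ?Z \<times> ?Z"
  proof (clarify)
    fix \<delta> \<kappa> assume g: "(\<delta>, \<kappa>) \<in> G"
    then have "cmod \<delta> \<ge> 1" "cmod \<kappa> \<ge> 1" using Eis_norm_ge_1 by (auto simp: G_def)
    then have "(cmod \<delta>)\<^sup>2 \<ge> 1" "(cmod \<kappa>)\<^sup>2 \<ge> 1" by (simp_all add: one_le_power)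
    then have "(cmod \<delta>)\<^sup>2 * 1 \<le> (cmod \<delta>)\<^sup>2 * (cmod \<kappa>)\<^sup>2" "1 * (cmod \<kappa>)\<^sup>2 \<le> (cmod \<delta>)\<^sup>2 * (cmod \<kappa>)\<^sup>2"
      by (intro mult_mono; simp)+
    moreover have "(cmod \<delta>)\<^sup>2 * (cmod \<kappa>)\<^sup>2 \<le> 12 * real_of_int N" using g by (simp add: G_def)
    ultimately have "(cmod \<delta>)\<^sup>2 \<le> 12 * real_of_int N" "(cmod \<kappa>)\<^sup>2 \<le> 12 * real_of_int N" by linarith+
    then show "\<delta> \<in> ?Z \<and> \<kappa> \<in> ?Z" using g by (auto simp: G_def Eball_def)
  qed
  have finZ: "finite ?Z" using Eball_Esum[OF N] by simp
  show "finite G" by (rule finite_subset[OF sub]) (use finZ in simp)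
  have "real (card G) = (\<Sum>p\<in>G. 1)" by simp
  also have "\<dots> \<le> (\<Sum>(\<delta>, \<kappa>)\<in>G. 12 * real_of_int N * (1 / (cmod \<delta>)\<^sup>2 * (1 / (cmod \<kappa>)\<^sup>2)))"
  proof (rule sum_mono)
    fix p assume p: "p \<in> G"
    obtain \<delta> \<kappa> where dk: "p = (\<delta>, \<kappa>)" by (cases p)
    then have "cmod \<delta> > 0" "cmod \<kappa> > 0" "(cmod \<delta>)\<^sup>2 * (cmod \<kappa>)\<^sup>2 \<le> 12 * real_of_int N" using p by (auto simp: G_def)
    then show "1 \<le> (case p of (\<delta>, \<kappa>) \<Rightarrow> 12 * real_of_int N * (1 / (cmod \<delta>)\<^sup>2 * (1 / (cmod \<kappa>)\<^sup>2)))"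
      unfolding dk by (simp add: pos_le_divide_eq)
  qed
  also have "\<dots> \<le> (\<Sum>(\<delta>, \<kappa>)\<in>?Z \<times> ?Z. 12 * real_of_int N * (1 / (cmod \<delta>)\<^sup>2 * (1 / (cmod \<kappa>)\<^sup>2)))"
    by (rule sum_mono2[OF _ sub]) (use finZ N in auto)
  also have "\<dots> = 12 * real_of_int N * (Esum (12 * real_of_int N))\<^sup>2"
    unfolding Esum_def power2_eq_square[of "sum _ _"] sum.cartesian_product[symmetric]
      sum_distrib_left[symmetric] sum_distrib_right[symmetric] ..
  finally show "real (card G) \<le> 12 * real_of_int N * (Esum (12 * real_of_int N))\<^sup>2" .
qed

section \<open>Triples (a, \<delta>, \<kappa>) with |a| between A and 2A\<close>

definition block :: "real \<Rightarrow> real \<Rightarrow> (int \<times> complex \<times> complex) set" where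
  "block X A = {(a, \<delta>, \<kappa>). \<delta> \<in> Eis \<and> \<kappa> \<in> Eis \<and> \<delta> \<noteq> 0 \<and> \<kappa> \<noteq> 0 \<and> A \<le> \<bar>real_of_int a\<bar> \<and> \<bar>real_of_int a\<bar> \<le> 2 * A \<and>
     \<bar>(real_of_int a)\<^sup>2 - (cmod \<delta>)\<^sup>2 * (cmod \<kappa>)\<^sup>2\<bar> \<le> 3 * X \<and> (cmod \<delta>)\<^sup>2 * \<bar>Im (\<delta> * \<kappa> ^ 3)\<bar> \<le> 26 * A * X}"

text \<open>Strip count times number of a, where k is the modulus of the fixed factor. The terms +2
  are harmless: 2k \<le> 5A, and 2k \<le> 16/5 sqrt X because k^2 \<le> 5/2 X. Together with X/A
  \<le> sqrt X / 3 the constant is 15 * (52 + 3.2) * 14 = 11592.\<close>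

lemma block_arith:
  fixes X A k :: real
  assumes "X \<ge> 1" "A \<ge> 3 * sqrt X" "A \<le> X" "k \<ge> 1" "k\<^sup>2 \<le> 5 / 2 * A"
  shows "(4 * (5 / 2 * A / k) + 2) * (4 * (39 * X / (A * k)) + 2) * (14 * X / A) \<le> 12000 * X * sqrt X * (1 / k\<^sup>2)"
proof -
  define s where "s = sqrt X"
  have s: "s \<ge> 1" "X = s * s" using assms(1) by (simp_all only: s_def real_sqrt_ge_one real_sqrt_mult_self)
  have A: "A \<ge> 3" "3 * s \<le> A" using assms(2) s(1) unfolding s_def by linarith+
  have k: "k \<le> 5 / 2 * A"
  proof -
    have "k * 1 \<le> k * k" using assms by (intro mult_left_mono) auto
    then show ?thesis using assms(5) by (simp add: power2_eq_square)
  qed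
  have 1: "4 * (5 / 2 * A / k) + 2 = (10 * A + 2 * k) * (1 / k)" using assms(4) by (simp add: add_divide_distrib)
  have "X / (A * k) = X / A * (1 / k)" by simp
  then have 2: "4 * (39 * X / (A * k)) + 2 = (156 * (X / A) + 2 * k) * (1 / k)"
    using assms(4) by (simp add: add_divide_distrib)
  have "(4 * (5 / 2 * A / k) + 2) * (4 * (39 * X / (A * k)) + 2) * (14 * X / A)
     = (10 * A + 2 * k) * (156 * (X / A) + 2 * k) * (14 * X / A) * (1 / k * (1 / k))"
    unfolding 1 2 by (simp only: mult_ac)
  also have "1 / k * (1 / k) = 1 / k\<^sup>2" by (simp add: power2_eq_square)
  also have "(10 * A + 2 * k) * (156 * (X / A) + 2 * k) * (14 * X / A) * (1 / k\<^sup>2)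
     \<le> (15 * A) * (156 * (s / 3) + 16 / 5 * s) * (14 * X / A) * (1 / k\<^sup>2)"
  proof -
    have a: "10 * A + 2 * k \<le> 15 * A" using k by simp
    have "s * (3 * s) \<le> s * A" using A s by (intro mult_left_mono) auto
    then have "3 * X \<le> s * A" using s(2) by simp
    then have XA: "X / A \<le> s / 3" using A by (simp add: divide_le_eq)
    have "k\<^sup>2 \<le> 5 / 2 * X" using assms by linarith
    then have "k\<^sup>2 \<le> 5 / 2 * (s * s)" using s(2) by simp
    moreover have "(8 / 5 * s)\<^sup>2 = 64 / 25 * (s * s)" by (simp add: power2_eq_square)
    ultimately have "k\<^sup>2 \<le> (8 / 5 * s)\<^sup>2" using zero_le_square[of s] by linarith
    then have "k \<le> 8 / 5 * s" by (rule power2_le_imp_le) (use s in simp)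
    with XA have b: "156 * (X / A) + 2 * k \<le> 156 * (s / 3) + 16 / 5 * s" by linarith
    have "(10 * A + 2 * k) * (156 * (X / A) + 2 * k) \<le> (15 * A) * (156 * (s / 3) + 16 / 5 * s)"
      using assms A by (intro mult_mono a b) auto
    then show ?thesis using assms A by (intro mult_right_mono) auto
  qed
  also have "(15 * A) * (156 * (s / 3) + 16 / 5 * s) * (14 * X / A) * (1 / k\<^sup>2) = 11592 * X * s * (1 / k\<^sup>2)"
    using A by (simp add: field_simps)
  also have "\<dots> \<le> 12000 * X * s * (1 / k\<^sup>2)" using assms s by (intro mult_right_mono) auto
  finally show ?thesis by (simp add: s_def)
qed

text \<open>z is the smaller factor, w the other one, and m the number of strips that w may lie in.
  Stated for abstract \<open>Q\<close> and \<open>R\<close> to cover both roles of \<delta> and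
  \<kappa>.\<close>

lemma card_SIGMA_strips:
  assumes N: "N \<ge> 1" and X: "X = real_of_int N" and A: "A \<ge> 3 * sqrt X" "A \<le> X"
    and fQ: "\<And>z. z \<in> Eball (5 / 2 * A) \<Longrightarrow> finite (Q z)"
    and cQ: "\<And>z. z \<in> Eball (5 / 2 * A) \<Longrightarrow>
      real (card (Q z)) \<le> m * ((4 * (5 / 2 * A / cmod z) + 2) * (4 * (39 * X / (A * cmod z)) + 2))"
    and fR: "\<And>z w. finite (R z w :: int set)" and cR: "\<And>z w. real (card (R z w)) \<le> 14 * X / A"
    and m: "m \<ge> 0"
  shows "finite (SIGMA z:Eball (5 / 2 * A). SIGMA w:Q z. R z w)"
    "real (card (SIGMA z:Eball (5 / 2 * A). SIGMA w:Q z. R z w)) \<le> m * (12000 * X * sqrt X * Esum (12 * X))"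
proof -
  let ?Z = "Eball (5 / 2 * A)"
  have X1: "X \<ge> 1" using N X by simp
  have A0: "A > 0" using A(1) X1 by (smt (verit) real_sqrt_ge_one)
  have sub: "?Z \<subseteq> Eball (12 * X)" using A X1 by (auto simp: Eball_def)
  have fin12: "finite (Eball (12 * X))" using Eball_Esum[OF N] X by simp
  have finZ: "finite ?Z" using sub fin12 by (rule finite_subset)
  show "finite (SIGMA z:?Z. SIGMA w:Q z. R z w)" using finZ fQ fR by auto
  have "real (card (SIGMA z:?Z. SIGMA w:Q z. R z w)) = (\<Sum>z\<in>?Z. \<Sum>w\<in>Q z. real (card (R z w)))"
    using finZ fQ fR by (simp add: card_SigmaI)
  also have "\<dots> \<le> (\<Sum>z\<in>?Z. m * (12000 * X * sqrt X * (1 / (cmod z)\<^sup>2)))"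
  proof (rule sum_mono)
    fix z assume z: "z \<in> ?Z"
    have "(\<Sum>w\<in>Q z. real (card (R z w))) \<le> real (card (Q z)) * (14 * X / A)"
      by (rule sum_bounded_above) (rule cR)
    also have "\<dots> \<le> m * ((4 * (5 / 2 * A / cmod z) + 2) * (4 * (39 * X / (A * cmod z)) + 2)) * (14 * X / A)"
      using X1 A0 by (intro mult_right_mono cQ z) auto
    also have "\<dots> = m * ((4 * (5 / 2 * A / cmod z) + 2) * (4 * (39 * X / (A * cmod z)) + 2) * (14 * X / A))"
      by (simp only: mult.assoc)
    also have "\<dots> \<le> m * (12000 * X * sqrt X * (1 / (cmod z)\<^sup>2))"
      using z Eis_norm_ge_1[of z] by (intro mult_left_mono block_arith X1 A m) (auto simp: Eball_def)
    finally show "(\<Sum>w\<in>Q z. real (card (R z w))) \<le> m * (12000 * X * sqrt X * (1 / (cmod z)\<^sup>2))" .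
  qed
  also have "\<dots> = m * (12000 * X * sqrt X * Esum (5 / 2 * A))"
    by (simp only: Esum_def sum_distrib_left)
  also have "\<dots> \<le> m * (12000 * X * sqrt X * Esum (12 * X))"
    unfolding Esum_def using sub fin12 m X1 by (intro mult_left_mono sum_mono2) auto
  finally show "real (card (SIGMA z:?Z. SIGMA w:Q z. R z w)) \<le> m * (12000 * X * sqrt X * Esum (12 * X))" .
qed

lemma Im_of_real_mult: "Im (of_real r * z) = r * Im z"
  by simp

text \<open>A given \<kappa> leaves one strip for \<delta>, whereas a given \<delta> leaves three
  for \<kappa>, which enters as a cube. Hence 48000 = (1 + 3) * 12000.\<close>

lemma card_block:
  assumes N: "N \<ge> 1" and X: "X = real_of_int N" and A: "A \<ge> 3 * sqrt X" "A \<le> X"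
  shows "finite (block X A)" "real (card (block X A)) \<le> 48000 * X * sqrt X * Esum (12 * X)"
proof -
  have X1: "X \<ge> 1" using N X by simp
  have A0: "A \<ge> 3" using A(1) X1 by (smt (verit) real_sqrt_ge_one)
  have A2: "A\<^sup>2 \<ge> 9 * X"
  proof -
    have "(3 * sqrt X)\<^sup>2 \<le> A\<^sup>2" using A X1 by (intro power_mono) auto
    then show ?thesis using X1 by (simp add: power_mult_distrib)
  qed
  let ?Z = "Eball (5 / 2 * A)"
  define R where "R z w = {a::int. A \<le> \<bar>real_of_int a\<bar> \<and> \<bar>(real_of_int a)\<^sup>2 - (cmod z)\<^sup>2 * (cmod w)\<^sup>2\<bar> \<le> 3 * X}" for z w
  have R: "finite (R z w)" "real (card (R z w)) \<le> 14 * X / A" for z w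
    using card_square_window[of A X "(cmod z)\<^sup>2 * (cmod w)\<^sup>2"] A0 A by (simp_all add: R_def)
  define strip where "strip u z = {w \<in> Eis. \<bar>Re (u * w)\<bar> \<le> 5 / 2 * A / cmod z \<and> \<bar>Im (u * w)\<bar> \<le> 39 * X / (A * cmod z)}" for u z
  have strip: "finite (strip u z)"
    "real (card (strip u z)) \<le> (4 * (5 / 2 * A / cmod z) + 2) * (4 * (39 * X / (A * cmod z)) + 2)"
    if "cmod u = 1" for u z
    unfolding strip_def using card_Eis_strip[OF that, of "5 / 2 * A / cmod z" "39 * X / (A * cmod z)"] A0 X1 by auto
  \<comment> \<open>\<delta> is rotated by the argument of \<kappa>^3, so that the product
    \<delta>\<kappa>^3 becomes a positive multiple of the rotated \<delta>.\<close>
  define Q1 where "Q1 \<kappa> = strip (\<kappa> ^ 3 / of_real (cmod \<kappa> ^ 3)) \<kappa>" for \<kappa>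
  \<comment> \<open>A cube root of the direction of \<delta> turns \<delta>\<kappa>^3 into a
    positive multiple of a single cube.\<close>
  define rt where "rt \<delta> = (SOME v. v ^ 3 = \<delta> / of_real (cmod \<delta>))" for \<delta> :: complex
  define Q2 where "Q2 \<delta> = (\<Union>u\<in>{1, omega, omega\<^sup>2}. strip (u * rt \<delta>) \<delta>)" for \<delta>
  have rt3: "rt \<delta> ^ 3 = \<delta> / of_real (cmod \<delta>)" for \<delta>
  proof -
    have "\<exists>v. v ^ 3 = \<delta> / of_real (cmod \<delta>)" by (metis exists_complex_root zero_neq_numeral)
    then show ?thesis unfolding rt_def by (rule someI_ex)
  qed
  have rt1: "cmod (rt \<delta>) = 1" if "\<delta> \<noteq> 0" for \<delta>
  proof -
    have "cmod (rt \<delta>) ^ 3 = 1 ^ 3" using that by (simp add: norm_power[symmetric] rt3 norm_divide)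
    then show ?thesis by (rule power_eq_imp_eq_base) auto
  qed
  have u1: "cmod u = 1" if "u \<in> {1, omega, omega\<^sup>2}" for u
    using that cmod_omega by (auto simp: norm_power)
  have Q1: "finite (Q1 \<kappa>)"
    "real (card (Q1 \<kappa>)) \<le> 1 * ((4 * (5 / 2 * A / cmod \<kappa>) + 2) * (4 * (39 * X / (A * cmod \<kappa>)) + 2))"
    if "\<kappa> \<in> ?Z" for \<kappa>
  proof -
    have "cmod (\<kappa> ^ 3 / of_real (cmod \<kappa> ^ 3)) = 1"
      using that by (simp add: Eball_def norm_divide norm_power)
    from strip[OF this] show "finite (Q1 \<kappa>)" 
      "real (card (Q1 \<kappa>)) \<le> 1 * ((4 * (5 / 2 * A / cmod \<kappa>) + 2) * (4 * (39 * X / (A * cmod \<kappa>)) + 2))"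
      by (simp_all add: Q1_def)
  qed
  have Q2: "finite (Q2 \<delta>)"
    "real (card (Q2 \<delta>)) \<le> 3 * ((4 * (5 / 2 * A / cmod \<delta>) + 2) * (4 * (39 * X / (A * cmod \<delta>)) + 2))"
    if "\<delta> \<in> ?Z" for \<delta>
  proof -
    have n1: "cmod (u * rt \<delta>) = 1" if "u \<in> {1, omega, omega\<^sup>2}" for u
      using u1[OF that] rt1[of \<delta>] \<open>\<delta> \<in> ?Z\<close> by (simp add: norm_mult Eball_def)
    show "finite (Q2 \<delta>)" unfolding Q2_def using strip(1)[OF n1] by blast
    let ?b = "(4 * (5 / 2 * A / cmod \<delta>) + 2) * (4 * (39 * X / (A * cmod \<delta>)) + 2)"
    have b0: "?b \<ge> 0" using A0 X1 by (intro mult_nonneg_nonneg add_nonneg_nonneg divide_nonneg_nonneg) auto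
    have "card (Q2 \<delta>) \<le> (\<Sum>u\<in>{1, omega, omega\<^sup>2}. card (strip (u * rt \<delta>) \<delta>))"
      unfolding Q2_def by (rule card_UN_le) simp
    then have "real (card (Q2 \<delta>)) \<le> (\<Sum>u\<in>{1, omega, omega\<^sup>2}. real (card (strip (u * rt \<delta>) \<delta>)))"
      by (metis of_nat_le_iff of_nat_sum)
    also have "\<dots> \<le> real (card {1, omega, omega\<^sup>2}) * ?b"
      by (rule sum_bounded_above) (use strip(2)[OF n1] in blast)
    also have "\<dots> \<le> 3 * ?b"
    proof (rule mult_right_mono[OF _ b0])
      have "card {1, omega, omega\<^sup>2} \<le> 3" by (simp add: card_insert_if)
      then show "real (card {1, omega, omega\<^sup>2}) \<le> 3" by simp
    qed
    finally show "real (card (Q2 \<delta>)) \<le> 3 * ?b" .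
  qed
  define B1 where "B1 = (SIGMA \<kappa>:?Z. SIGMA \<delta>:Q1 \<kappa>. R \<kappa> \<delta>)"
  define B2 where "B2 = (SIGMA \<delta>:?Z. SIGMA \<kappa>:Q2 \<delta>. R \<delta> \<kappa>)"
  note c1 = card_SIGMA_strips[where Q = Q1 and R = R and m = 1, OF N X A Q1 R zero_le_one, folded B1_def]
  note c2 = card_SIGMA_strips[where Q = Q2 and R = R and m = 3, OF N X A Q2 R zero_le_numeral, folded B2_def]
  have cB: "real (card B1) \<le> 1 * (12000 * X * sqrt X * Esum (12 * X))" "real (card B2) \<le> 3 * (12000 * X * sqrt X * Esum (12 * X))"
    using c1(2) c2(2) by blast+
  have fin: "finite B1" "finite B2" using c1(1) c2(1) by blast+
  have "block X A \<subseteq> (\<lambda>(\<kappa>, \<delta>, a). (a, \<delta>, \<kappa>)) ` B1 \<union> (\<lambda>(\<delta>, \<kappa>, a). (a, \<delta>, \<kappa>)) ` B2" (is "_ \<subseteq> ?U")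
  proof
    fix p assume p: "p \<in> block X A"
    obtain a \<delta> \<kappa> where p': "p = (a, \<delta>, \<kappa>)" by (cases p)
    define d k where "d = cmod \<delta>" and "k = cmod \<kappa>"
    have E: "\<delta> \<in> Eis" "\<kappa> \<in> Eis" "\<delta> \<noteq> 0" "\<kappa> \<noteq> 0" using p by (simp_all add: p' block_def)
    have aA: "A \<le> \<bar>real_of_int a\<bar>" "\<bar>real_of_int a\<bar> \<le> 2 * A" and aP: "\<bar>(real_of_int a)\<^sup>2 - d\<^sup>2 * k\<^sup>2\<bar> \<le> 3 * X"
      and Im: "d\<^sup>2 * \<bar>Im (\<delta> * \<kappa> ^ 3)\<bar> \<le> 26 * A * X"
      using p by (simp_all add: p' block_def d_def k_def)
    have dk: "d \<ge> 1" "k \<ge> 1" using E Eis_norm_ge_1 by (simp_all add: d_def k_def)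
    have a2: "A\<^sup>2 \<le> (real_of_int a)\<^sup>2" "(real_of_int a)\<^sup>2 \<le> 4 * A\<^sup>2"
    proof -
      have "A\<^sup>2 \<le> \<bar>real_of_int a\<bar>\<^sup>2" "\<bar>real_of_int a\<bar>\<^sup>2 \<le> (2 * A)\<^sup>2" using aA A0 by (intro power_mono; simp)+
      then show "A\<^sup>2 \<le> (real_of_int a)\<^sup>2" "(real_of_int a)\<^sup>2 \<le> 4 * A\<^sup>2" by (simp_all add: power_mult_distrib)
    qed
    \<comment> \<open>A \<ge> 3 sqrt X gives 3X \<le> A^2/3, so P lies between 2/3 A^2 and 13/3 A^2,
      the latter being below (5/2 A)^2.\<close>
    have lo: "2 / 3 * A\<^sup>2 \<le> d\<^sup>2 * k\<^sup>2" and hi: "d\<^sup>2 * k\<^sup>2 \<le> (5 / 2 * A)\<^sup>2"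
      using aP a2 A2 by (simp_all add: abs_le_iff power_mult_distrib power_divide)
    have dkA: "d * k \<le> 5 / 2 * A"
      by (rule power2_le_imp_le) (use hi A0 in \<open>simp_all add: power_mult_distrib\<close>)
    \<comment> \<open>Division by d^2 k^2 \<ge> 2/3 A^2 turns 26 into 39.\<close>
    have ImA: "\<bar>Im (\<delta> * \<kappa> ^ 3)\<bar> * A \<le> 39 * X * k\<^sup>2"
    proof -
      have "2 / 3 * A\<^sup>2 * \<bar>Im (\<delta> * \<kappa> ^ 3)\<bar> \<le> d\<^sup>2 * k\<^sup>2 * \<bar>Im (\<delta> * \<kappa> ^ 3)\<bar>"
        using lo by (intro mult_right_mono) auto
      also have "\<dots> = k\<^sup>2 * (d\<^sup>2 * \<bar>Im (\<delta> * \<kappa> ^ 3)\<bar>)" by simp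
      also have "\<dots> \<le> k\<^sup>2 * (26 * A * X)" using Im by (intro mult_left_mono) auto
      finally have "A * (\<bar>Im (\<delta> * \<kappa> ^ 3)\<bar> * A) \<le> A * (39 * X * k\<^sup>2)"
        by (simp add: power2_eq_square field_simps)
      then show ?thesis using A0 by simp
    qed
    have Re_le: "\<bar>Re (u * z)\<bar> \<le> cmod z" if "cmod u = 1" for u z
      using abs_Re_le_cmod[of "u * z"] that by (simp add: norm_mult)
    have Raw: "a \<in> R \<kappa> \<delta>" "a \<in> R \<delta> \<kappa>"
      using aA(1) aP by (simp_all add: R_def d_def k_def mult.commute)
    show "p \<in> ?U"
    proof (cases "k \<le> d")
      case True
      \<comment> \<open>The smaller factor has squared modulus at most dk \<le> 5/2 A, which places
        it in \<open>?Z\<close>.\<close>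
      have "k * k \<le> d * k" using True dk by (intro mult_right_mono) auto
      also note dkA
      finally have kZ: "\<kappa> \<in> ?Z" using E by (simp add: Eball_def k_def power2_eq_square)
      define u where "u = \<kappa> ^ 3 / of_real (k ^ 3)"
      have cu: "cmod u = 1" using E(4) by (simp add: u_def norm_divide norm_power k_def)
      have uk: "u * \<delta> = of_real (1 / k ^ 3) * (\<delta> * \<kappa> ^ 3)" by (simp add: u_def)
      have "\<bar>Im (u * \<delta>)\<bar> = \<bar>Im (\<delta> * \<kappa> ^ 3)\<bar> / k ^ 3"
        unfolding uk Im_of_real_mult abs_mult using dk by simp
      also have "\<dots> \<le> 39 * X / (A * k)"
        using ImA dk A0 by (simp add: field_simps power2_eq_square power3_eq_cube)
      finally have "\<bar>Im (u * \<delta>)\<bar> \<le> 39 * X / (A * k)" .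
      moreover have "\<bar>Re (u * \<delta>)\<bar> \<le> 5 / 2 * A / k"
      proof -
        have "\<bar>Re (u * \<delta>)\<bar> \<le> d" unfolding d_def by (rule Re_le[OF cu])
        also have "d \<le> 5 / 2 * A / k" using dkA dk by (simp add: pos_le_divide_eq)
        finally show ?thesis .
      qed
      ultimately have "\<delta> \<in> Q1 \<kappa>" using E by (simp add: Q1_def strip_def u_def k_def)
      then have "(\<kappa>, \<delta>, a) \<in> B1" using kZ Raw by (simp add: B1_def)
      then have "(\<lambda>(\<kappa>, \<delta>, a). (a, \<delta>, \<kappa>)) (\<kappa>, \<delta>, a) \<in> (\<lambda>(\<kappa>, \<delta>, a). (a, \<delta>, \<kappa>)) ` B1" by (rule imageI)
      then show ?thesis by (simp add: p')
    next
      case False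
      then have "d * d \<le> d * k" using dk by (intro mult_left_mono) auto
      also note dkA
      finally have dZ: "\<delta> \<in> ?Z" using E by (simp add: Eball_def d_def power2_eq_square)
      define v where "v = rt \<delta>"
      have v1: "cmod v = 1" using rt1[OF E(3)] by (simp add: v_def)
      have vk: "(v * \<kappa>) ^ 3 = of_real (1 / d) * (\<delta> * \<kappa> ^ 3)"
        by (simp add: power_mult_distrib v_def rt3 d_def)
      have I3: "\<bar>Im ((v * \<kappa>) ^ 3)\<bar> = \<bar>Im (\<delta> * \<kappa> ^ 3)\<bar> / d"
        unfolding vk Im_of_real_mult abs_mult using dk by simp
      \<comment> \<open>u selects which of the three lines is close to the rotated \<kappa>.\<close>
      obtain u where u: "u \<in> {1, omega, omega\<^sup>2}" "\<bar>Im (u * (v * \<kappa>))\<bar> * (cmod (v * \<kappa>))\<^sup>2 \<le> \<bar>Im ((v * \<kappa>) ^ 3)\<bar>"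
        using Im_cube_controls_argument by blast
      have "\<bar>Im (u * v * \<kappa>)\<bar> * k\<^sup>2 \<le> \<bar>Im (\<delta> * \<kappa> ^ 3)\<bar> / d"
        using u(2) unfolding I3 by (simp add: norm_mult v1 k_def mult.assoc)
      then have "\<bar>Im (u * v * \<kappa>)\<bar> * k\<^sup>2 * d \<le> \<bar>Im (\<delta> * \<kappa> ^ 3)\<bar>" using dk by (simp add: pos_le_divide_eq)
      then have "\<bar>Im (u * v * \<kappa>)\<bar> * k\<^sup>2 * d * A \<le> \<bar>Im (\<delta> * \<kappa> ^ 3)\<bar> * A" using A0 by (intro mult_right_mono) auto
      then have "k\<^sup>2 * (\<bar>Im (u * v * \<kappa>)\<bar> * (A * d)) \<le> k\<^sup>2 * (39 * X)" using ImA by (simp add: mult_ac)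
      then have "\<bar>Im (u * v * \<kappa>)\<bar> * (A * d) \<le> 39 * X" using dk by simp
      then have "\<bar>Im (u * v * \<kappa>)\<bar> \<le> 39 * X / (A * d)" using A0 dk by (simp add: pos_le_divide_eq)
      moreover have "\<bar>Re (u * v * \<kappa>)\<bar> \<le> 5 / 2 * A / d"
      proof -
        have "cmod (u * v) = 1" using u1[OF u(1)] v1 by (simp add: norm_mult)
        then have "\<bar>Re (u * v * \<kappa>)\<bar> \<le> k" unfolding k_def by (rule Re_le)
        also have "k \<le> 5 / 2 * A / d" using dkA dk by (simp add: pos_le_divide_eq algebra_simps)
        finally show ?thesis .
      qed
      ultimately have "\<kappa> \<in> strip (u * v) \<delta>" using E by (simp add: strip_def d_def)
      then have "\<kappa> \<in> Q2 \<delta>" using u(1) unfolding Q2_def v_def by blast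
      then have "(\<delta>, \<kappa>, a) \<in> B2" using dZ Raw by (simp add: B2_def)
      then have "(\<lambda>(\<delta>, \<kappa>, a). (a, \<delta>, \<kappa>)) (\<delta>, \<kappa>, a) \<in> (\<lambda>(\<delta>, \<kappa>, a). (a, \<delta>, \<kappa>)) ` B2" by (rule imageI)
      then show ?thesis by (simp add: p')
    qed
  qed
  moreover have finU: "finite ?U" using fin by simp
  ultimately show "finite (block X A)" by (rule finite_subset)
  have "card (block X A) \<le> card ?U" using \<open>block X A \<subseteq> ?U\<close> finU by (intro card_mono)
  also have "\<dots> \<le> card ((\<lambda>(\<kappa>, \<delta>, a). (a, \<delta>, \<kappa>)) ` B1) + card ((\<lambda>(\<delta>, \<kappa>, a). (a, \<delta>, \<kappa>)) ` B2)" by (rule card_Un_le)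
  also have "\<dots> \<le> card B1 + card B2" using fin by (intro add_mono card_image_le)
  finally have "real (card (block X A)) \<le> real (card B1) + real (card B2)" by (metis of_nat_add of_nat_le_iff)
  then show "real (card (block X A)) \<le> 48000 * X * sqrt X * Esum (12 * X)" using cB by simp
qed

section \<open>Cubics with a square discriminant\<close>

text \<open>The classical syzygy between the covariants of a binary cubic, read off at leading
  coefficients: a^2 - 3b belongs to the Hessian and the other square to the cubic covariant.\<close>

lemma disc3_identity:
  "(9 * a * b - 2 * a ^ 3 - 27 * c) ^ 2 + 27 * disc3 a b c = 4 * (a ^ 2 - 3 * b) ^ 3"
  unfolding disc3_def by algebra

text \<open>The Eisenstein integer \<alpha> of the proof is, up to conjugation, the third power of the Lagrange resolvent.\<close>

lemma square_disc_resolvent: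
  fixes a b c y :: int
  assumes y: "disc3 a b c = y ^ 2" and P: "a ^ 2 - 3 * b \<noteq> 0"
  shows "\<exists>\<delta>\<in>Eis. \<exists>\<kappa>\<in>Eis. \<delta> \<noteq> 0 \<and> \<kappa> \<noteq> 0 \<and>
    (cmod \<delta>)\<^sup>2 * (cmod \<kappa>)\<^sup>2 = real_of_int (a ^ 2 - 3 * b) \<and>
    (cmod \<delta>)\<^sup>2 * Re (\<delta> * \<kappa> ^ 3) = real_of_int (9 * a * b - 2 * a ^ 3 - 27 * c) / 2 \<and>
    (cmod \<delta>)\<^sup>2 * Im (\<delta> * \<kappa> ^ 3) = 3 * sqrt 3 / 2 * real_of_int y"
proof -
  define J where "J = 9 * a * b - 2 * a ^ 3 - 27 * c"
  define p where "p = a ^ 2 - 3 * b"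
  have key: "J ^ 2 + 27 * y ^ 2 = 4 * p ^ 3" using disc3_identity[of a b c] y by (simp add: J_def p_def)
  \<comment> \<open>J and y have the same parity, which makes (J + 3y sqrt(-3))/2 an Eisenstein
    integer.\<close>
  have "even (J ^ 2 + 27 * y ^ 2)" unfolding key by simp
  then have "even (J + 3 * y)" by simp
  then obtain m where m: "J + 3 * y = 2 * m" by (elim evenE)
  have J: "J = 2 * m - 3 * y" using m by simp
  \<comment> \<open>As \<open>omega\<close> has real part -1/2, this is (J + 3y sqrt(-3))/2 with J =
    2m - 3y.\<close>
  define \<alpha> where "\<alpha> = of_int m + of_int (3 * y) * omega"
  have "4 * (m\<^sup>2 - m * (3 * y) + (3 * y)\<^sup>2) = J ^ 2 + 27 * y ^ 2"
    unfolding J by (simp add: algebra_simps power2_eq_square)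
  then have mp: "m\<^sup>2 - m * (3 * y) + (3 * y)\<^sup>2 = p ^ 3" using key by simp
  have n\<alpha>: "(cmod \<alpha>)\<^sup>2 = real_of_int p ^ 3" unfolding \<alpha>_def cmod_int mp by simp
  have \<alpha>E: "\<alpha> \<in> Eis" unfolding \<alpha>_def Eis_iff by blast
  have \<alpha>0: "\<alpha> \<noteq> 0" using n\<alpha> P unfolding p_def[symmetric] by auto
  have "\<alpha> * cnj \<alpha> = of_real ((cmod \<alpha>)\<^sup>2)" by (simp only: complex_norm_square)
  also have "\<dots> = of_int p ^ 3" unfolding n\<alpha> by simp
  finally obtain \<delta> \<kappa> where dk: "\<delta> \<in> Eis" "\<kappa> \<in> Eis" "\<alpha> = \<delta> * cnj \<delta> * \<delta> * \<kappa> ^ 3"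
    using Eis_cube_norm_decomposition[OF \<alpha>E \<alpha>0] by blast
  have nz: "\<delta> \<noteq> 0" "\<kappa> \<noteq> 0" using dk(3) \<alpha>0 by auto
  have \<alpha>: "\<alpha> = of_real ((cmod \<delta>)\<^sup>2) * (\<delta> * \<kappa> ^ 3)"
    unfolding complex_norm_square using dk(3) by (simp add: mult.assoc)
  define u where "u = (cmod \<delta>)\<^sup>2 * (cmod \<kappa>)\<^sup>2"
  have u0: "u \<ge> 0" by (simp add: u_def)
  have "cmod \<alpha> = (cmod \<delta>)\<^sup>2 * (cmod \<delta> * cmod \<kappa> ^ 3)" by (simp add: \<alpha> norm_mult norm_power)
  then have "(cmod \<alpha>)\<^sup>2 = u ^ 3" by (simp add: u_def power2_eq_square power3_eq_cube)
  then have u3: "u ^ 3 = real_of_int p ^ 3" using n\<alpha> by simp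
  \<comment> \<open>p^3 is the nonnegative number u^3, so p is nonnegative and cube roots may be
    compared.\<close>
  have p0: "real_of_int p \<ge> 0"
  proof (rule ccontr)
    assume "\<not> real_of_int p \<ge> 0"
    then have "real_of_int p ^ 3 < 0" by (simp add: power_less_zero_eq)
    then show False using u3 u0 zero_le_power[OF u0, of 3] by linarith
  qed
  have up: "u = real_of_int p" by (rule power_eq_imp_eq_base[OF u3 u0 p0]) simp
  have "Re \<alpha> = real_of_int J / 2" unfolding J by (simp add: \<alpha>_def Re_omega field_simps)
  moreover have "Im \<alpha> = 3 * sqrt 3 / 2 * real_of_int y" by (simp add: \<alpha>_def Im_omega)
  moreover have "Re \<alpha> = (cmod \<delta>)\<^sup>2 * Re (\<delta> * \<kappa> ^ 3)" unfolding \<alpha> by simp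
  moreover have "Im \<alpha> = (cmod \<delta>)\<^sup>2 * Im (\<delta> * \<kappa> ^ 3)" unfolding \<alpha> by (rule Im_of_real_mult)
  ultimately show ?thesis using dk nz up unfolding u_def J_def[symmetric] p_def[symmetric] by metis
qed

text \<open>In units of A^2 X^2 the first four terms are at most 4, 4, 32 and 36, in total 76 < 100,
  and the last one is nonpositive. The hypotheses on A and X turn X^3, A^3 X and A X^2 into such
  units.\<close>

lemma disc_bound:
  fixes a b c A X :: real
  assumes a: "\<bar>a\<bar> \<le> 2 * A" and b: "\<bar>b\<bar> \<le> X" and c: "\<bar>c\<bar> \<le> X" and X: "9 * X \<le> A\<^sup>2" "A \<le> X" "1 \<le> A"
  shows "a^2 * b^2 - 4 * b^3 - 4 * a^3 * c + 18 * a * b * c - 27 * c^2 \<le> (10 * (A * X))\<^sup>2"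
proof -
  have X1: "1 \<le> X" using X by simp
  have "\<bar>a * b\<bar> \<le> 2 * A * X" unfolding abs_mult by (intro mult_mono a b) (use X in auto)
  then have "\<bar>a * b\<bar>\<^sup>2 \<le> (2 * A * X)\<^sup>2" by (intro power_mono) auto
  then have 1: "a^2 * b^2 \<le> 4 * (A\<^sup>2 * X\<^sup>2)" by (simp add: power_mult_distrib)
  have "\<bar>b ^ 3\<bar> \<le> X ^ 3" unfolding power_abs by (intro power_mono b) auto
  also have "X ^ 3 = X * X\<^sup>2" by (simp add: power3_eq_cube power2_eq_square)
  also have "\<dots> \<le> A\<^sup>2 * X\<^sup>2" using X X1 by (intro mult_right_mono) auto
  finally have 2: "\<bar>b ^ 3\<bar> \<le> A\<^sup>2 * X\<^sup>2" .
  have "\<bar>a ^ 3 * c\<bar> \<le> (2 * A) ^ 3 * X" unfolding abs_mult power_abs by (intro mult_mono power_mono a c) (use X in auto)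
  also have "\<dots> = 8 * (A\<^sup>2 * X * A)" by (simp add: power3_eq_cube power2_eq_square)
  also have "\<dots> \<le> 8 * (A\<^sup>2 * X * X)" using X X1 by (intro mult_left_mono) auto
  finally have 3: "\<bar>a ^ 3 * c\<bar> \<le> 8 * (A\<^sup>2 * X\<^sup>2)" by (simp add: power2_eq_square mult.assoc)
  have "\<bar>a * b * c\<bar> \<le> (2 * A) * X * X" unfolding abs_mult by (intro mult_mono a b c) (use X in auto)
  also have "\<dots> \<le> (2 * A\<^sup>2) * X * X"
    using X X1 by (intro mult_right_mono) (auto simp: power2_eq_square)
  finally have 4: "\<bar>a * b * c\<bar> \<le> 2 * (A\<^sup>2 * X\<^sup>2)" by (simp add: power2_eq_square mult.assoc)
  have "(10 * (A * X))\<^sup>2 = 100 * (A\<^sup>2 * X\<^sup>2)" by (simp add: power_mult_distrib)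
  moreover have "0 \<le> A\<^sup>2 * X\<^sup>2" "0 \<le> c\<^sup>2" by auto
  moreover have "4 * a ^ 3 * c = 4 * (a ^ 3 * c)" "18 * a * b * c = 18 * (a * b * c)" by simp_all
  ultimately show ?thesis using 1 2 3 4 unfolding abs_le_iff by linarith
qed

definition square_disc_triples :: "int \<Rightarrow> (int \<times> int \<times> int) set" where
  "square_disc_triples N = {(a, b, c). \<bar>a\<bar> \<le> N \<and> \<bar>b\<bar> \<le> N \<and> \<bar>c\<bar> \<le> N \<and> (\<exists>y. disc3 a b c = y ^ 2)}"

text \<open>If P = 0, the syzygy has a sum of squares equal to 0, so J = 0 and a determines b and c.
  These are the cubes (X + a/3)^3, for which the resolvent vanishes.\<close>

lemma card_zero_hessian:
  assumes "N \<ge> 0"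
  defines "Z \<equiv> {(a, b, c). (a, b, c) \<in> square_disc_triples N \<and> a\<^sup>2 = 3 * b}"
  shows "finite Z" "card Z \<le> nat (2 * N + 1)"
proof -
  define f where "f a = (a, a\<^sup>2 div 3, (9 * a * (a\<^sup>2 div 3) - 2 * a ^ 3) div 27)" for a :: int
  have "Z \<subseteq> f ` {-N..N}"
  proof
    fix p assume "p \<in> Z"
    then obtain a b c y where p: "p = (a, b, c)" "\<bar>a\<bar> \<le> N" "disc3 a b c = y ^ 2" "a\<^sup>2 = 3 * b"
      by (auto simp: Z_def square_disc_triples_def)
    define J where "J = 9 * a * b - 2 * a ^ 3 - 27 * c"
    have "J ^ 2 + 27 * y ^ 2 = 0" using disc3_identity[of a b c] p(3,4) by (simp add: J_def)
    then have "J ^ 2 = 0" using zero_le_power2[of J] zero_le_power2[of y] by linarith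
    then have "9 * a * b - 2 * a ^ 3 = c * 27" by (simp add: J_def)
    then have "p = f a" using p(1,4) by (simp add: f_def)
    moreover have "a \<in> {-N..N}" using p(2) by auto
    ultimately show "p \<in> f ` {-N..N}" by blast
  qed
  moreover have "card (f ` {-N..N}) \<le> nat (2 * N + 1)"
    using card_image_le[of "{-N..N}" f] by simp
  ultimately show "finite Z" "card Z \<le> nat (2 * N + 1)"
    using card_mono[of "f ` {-N..N}" Z] by (auto intro: finite_subset)
qed

lemma dyadic_scale:
  fixes x B :: real
  assumes "B > 0" "B \<le> x"
  shows "\<exists>k::nat. B * 2 ^ k \<le> x \<and> x \<le> 2 * (B * 2 ^ k)"
proof -
  define l where "l = log 2 (x / B)"
  have l: "l \<ge> 0" using assms by (simp add: l_def)
  define k where "k = nat \<lfloor>l\<rfloor>"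
  have k: "real k \<le> l" "l \<le> real k + 1" using l by (simp_all add: k_def)
  have xl: "x / B = 2 powr l" using assms by (simp add: l_def)
  have "2 powr real k \<le> x / B" unfolding xl using k by simp
  moreover have "x / B \<le> 2 powr (real k + 1)" unfolding xl using k by simp
  ultimately have "2 ^ k \<le> x / B" "x / B \<le> 2 * 2 ^ k" by (simp_all add: powr_realpow powr_add)
  then show ?thesis using assms by (intro exI[of _ k]) (simp add: field_simps)
qed

lemma card_square_disc_triples:
  assumes N: "N \<ge> 1" and X: "X = real_of_int N"
  shows "finite (square_disc_triples N)"
    "real (card (square_disc_triples N)) \<le> 3 * X + 84 * (X * sqrt X) * (Esum (12 * X))\<^sup>2
      + (log 2 X + 1) * (48000 * X * sqrt X * Esum (12 * X))"
proof -
  let ?S = "Esum (12 * X)"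
  define s where "s = sqrt X"
  have X1: "X \<ge> 1" using N X by simp
  have s: "s \<ge> 1" "s * s = X" using X1 by (simp_all only: s_def real_sqrt_ge_one real_sqrt_mult_self) 
  define G where "G = {(\<delta>, \<kappa>). \<delta> \<in> Eis \<and> \<kappa> \<in> Eis \<and> \<delta> \<noteq> 0 \<and> \<kappa> \<noteq> 0 \<and> (cmod \<delta>)\<^sup>2 * (cmod \<kappa>)\<^sup>2 \<le> 12 * X}"
  define Z where "Z = {(a, b, c). (a, b, c) \<in> square_disc_triples N \<and> a\<^sup>2 = 3 * b}"
  define I where "I = {a::int. - 3 * s \<le> a \<and> a \<le> 3 * s}"
  \<comment> \<open>The dyadic scales start at 3 sqrt X and end at X, the largest possible
    |a|.\<close>
  define K where "K = {k::nat. k \<le> nat \<lfloor>log 2 X\<rfloor> \<and> 3 * s * 2 ^ k \<le> X}"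
  define U where "U = (\<Union>k\<in>K. block X (3 * s * 2 ^ k))"
  \<comment> \<open>Recovers the cubic from (a, \<delta>, \<kappa>) by solving P = a^2 - 3b and then
    J for c. On the triples that occur, floors and divisions are exact.\<close>
  define g where "g = (\<lambda>(a, \<delta>, \<kappa>).
     let b = (a\<^sup>2 - \<lfloor>(cmod \<delta>)\<^sup>2 * (cmod \<kappa>)\<^sup>2\<rfloor>) div 3
     in (a, b, (9 * a * b - 2 * a ^ 3 - \<lfloor>2 * ((cmod \<delta>)\<^sup>2 * Re (\<delta> * \<kappa> ^ 3))\<rfloor>) div 27))"
  have G: "finite G" "real (card G) \<le> 12 * X * ?S\<^sup>2"
    using card_Eball_products[OF N] by (simp_all add: G_def X)
  have Z: "finite Z" "real (card Z) \<le> 3 * X"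
  proof -
    show "finite Z" unfolding Z_def using card_zero_hessian(1)[of N] N by simp
    have "card Z \<le> nat (2 * N + 1)" unfolding Z_def using card_zero_hessian(2)[of N] N by simp
    then have "real (card Z) \<le> real (nat (2 * N + 1))" by simp
    also have "\<dots> \<le> 3 * X" using N X by simp
    finally show "real (card Z) \<le> 3 * X" .
  qed
  have I: "finite I" "real (card I) \<le> 7 * s"
    using card_int_interval(1)[of "- 3 * s" "3 * s"] card_int_interval_le[of "- 3 * s" "3 * s"] s
    by (simp_all add: I_def)
  have IG: "finite (I \<times> G)" "real (card (I \<times> G)) \<le> 84 * (X * s) * ?S\<^sup>2"
  proof -
    show "finite (I \<times> G)" using I G by simp
    have "real (card (I \<times> G)) = real (card I) * real (card G)" by (simp add: card_cartesian_product)
    also have "\<dots> \<le> (7 * s) * (12 * X * ?S\<^sup>2)" using I G s by (intro mult_mono) auto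
    finally show "real (card (I \<times> G)) \<le> 84 * (X * s) * ?S\<^sup>2" by (simp add: mult_ac)
  qed
  have bl: "finite (block X (3 * s * 2 ^ k))" "real (card (block X (3 * s * 2 ^ k))) \<le> 48000 * X * s * ?S" if "k \<in> K" for k
  proof -
    have "3 * s * 1 \<le> 3 * s * 2 ^ k" using s by (intro mult_left_mono) auto
    then show "finite (block X (3 * s * 2 ^ k))" "real (card (block X (3 * s * 2 ^ k))) \<le> 48000 * X * s * ?S"
      using card_block[OF N X, of "3 * s * 2 ^ k"] that by (simp_all add: K_def s_def)
  qed
  have K: "finite K" "real (card K) \<le> log 2 X + 1"
  proof -
    have sub: "K \<subseteq> {..nat \<lfloor>log 2 X\<rfloor>}" by (auto simp: K_def)
    then show "finite K" by (rule finite_subset) simp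
    have "card K \<le> nat \<lfloor>log 2 X\<rfloor> + 1" using card_mono[OF _ sub] by simp
    then have "real (card K) \<le> real (nat \<lfloor>log 2 X\<rfloor>) + 1" by linarith
    also have "\<dots> \<le> log 2 X + 1" using X1 by simp
    finally show "real (card K) \<le> log 2 X + 1" .
  qed
  have U: "finite U" "real (card U) \<le> (log 2 X + 1) * (48000 * X * s * ?S)"
  proof -
    show "finite U" unfolding U_def using K bl by blast
    have "card U \<le> (\<Sum>k\<in>K. card (block X (3 * s * 2 ^ k)))" unfolding U_def by (rule card_UN_le[OF K(1)])
    then have "real (card U) \<le> real (\<Sum>k\<in>K. card (block X (3 * s * 2 ^ k)))" unfolding of_nat_le_iff .
    also have "\<dots> = (\<Sum>k\<in>K. real (card (block X (3 * s * 2 ^ k))))" by simp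
    also have "\<dots> \<le> real (card K) * (48000 * X * s * ?S)" by (rule sum_bounded_above) (rule bl(2))
    also have "\<dots> \<le> (log 2 X + 1) * (48000 * X * s * ?S)"
      using K X1 s Esum_nonneg by (intro mult_right_mono) auto
    finally show "real (card U) \<le> (log 2 X + 1) * (48000 * X * s * ?S)" .
  qed
  have sub: "square_disc_triples N \<subseteq> Z \<union> g ` (I \<times> G) \<union> g ` U"
  proof
    fix q assume q: "q \<in> square_disc_triples N"
    then obtain a b c y where abc: "q = (a, b, c)" "\<bar>a\<bar> \<le> N" "\<bar>b\<bar> \<le> N" "\<bar>c\<bar> \<le> N" and y: "disc3 a b c = y ^ 2"
      by (auto simp: square_disc_triples_def)
    show "q \<in> Z \<union> g ` (I \<times> G) \<union> g ` U"
    proof (cases "a\<^sup>2 = 3 * b")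
      case True
      then show ?thesis using q by (simp add: abc(1) Z_def)
    next
      case False
      then have "a\<^sup>2 - 3 * b \<noteq> 0" by simp
      then obtain \<delta> \<kappa> where dk: "\<delta> \<in> Eis" "\<kappa> \<in> Eis" "\<delta> \<noteq> 0" "\<kappa> \<noteq> 0"
        and P: "(cmod \<delta>)\<^sup>2 * (cmod \<kappa>)\<^sup>2 = real_of_int (a ^ 2 - 3 * b)"
        and J: "(cmod \<delta>)\<^sup>2 * Re (\<delta> * \<kappa> ^ 3) = real_of_int (9 * a * b - 2 * a ^ 3 - 27 * c) / 2"
        and Y: "(cmod \<delta>)\<^sup>2 * Im (\<delta> * \<kappa> ^ 3) = 3 * sqrt 3 / 2 * real_of_int y"
        using square_disc_resolvent[OF y] by blast
      have "2 * ((cmod \<delta>)\<^sup>2 * Re (\<delta> * \<kappa> ^ 3)) = real_of_int (9 * a * b - 2 * a ^ 3 - 27 * c)"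
        unfolding J by simp
      then have fJ: "\<lfloor>2 * ((cmod \<delta>)\<^sup>2 * Re (\<delta> * \<kappa> ^ 3))\<rfloor> = 9 * a * b - 2 * a ^ 3 - 27 * c"
        by (simp only: floor_of_int)
      have fP: "\<lfloor>(cmod \<delta>)\<^sup>2 * (cmod \<kappa>)\<^sup>2\<rfloor> = a ^ 2 - 3 * b" unfolding P by (rule floor_of_int)
      have gq: "q = g (a, \<delta>, \<kappa>)" unfolding g_def prod.case Let_def fJ fP by (simp add: abc(1))
      have rb: "\<bar>real_of_int b\<bar> \<le> X" "\<bar>real_of_int c\<bar> \<le> X" "\<bar>real_of_int a\<bar> \<le> X"
        using abc by (simp_all add: X flip: of_int_abs)
      show ?thesis
      proof (cases "\<bar>real_of_int a\<bar> \<le> 3 * s")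
        case True
        then have aI: "a \<in> I" by (simp add: I_def abs_le_iff)
        have "\<bar>real_of_int a\<bar>\<^sup>2 \<le> (3 * s)\<^sup>2" using True by (intro power_mono) auto
        then have "(real_of_int a)\<^sup>2 \<le> 9 * X" using s by (simp add: power2_eq_square)
        then have "(cmod \<delta>)\<^sup>2 * (cmod \<kappa>)\<^sup>2 \<le> 12 * X" unfolding P using rb(1) by (simp add: abs_le_iff)
        then have "(a, \<delta>, \<kappa>) \<in> I \<times> G" using aI dk by (simp add: G_def)
        then show ?thesis using gq by blast
      next
        case False
        then obtain k :: nat where k: "3 * s * 2 ^ k \<le> \<bar>real_of_int a\<bar>" "\<bar>real_of_int a\<bar> \<le> 2 * (3 * s * 2 ^ k)"
          using dyadic_scale[of "3 * s" "\<bar>real_of_int a\<bar>"] s by auto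
        define A where "A = 3 * s * 2 ^ k"
        have AX: "A \<le> X" using k(1) rb(3) by (simp add: A_def)
        have "1 * 2 ^ k \<le> A" unfolding A_def using s by (intro mult_right_mono) auto
        then have "2 ^ k \<le> X" using AX by simp
        then have "real k \<le> log 2 X" using X1 by (simp add: le_log_of_power)
        then have "k \<le> nat \<lfloor>log 2 X\<rfloor>" by (simp add: le_nat_iff le_floor_iff)
        then have kK: "k \<in> K" using AX by (simp add: K_def A_def)
        have A3: "3 * s \<le> A" 
        proof -
          have "3 * s * 1 \<le> 3 * s * 2 ^ k" using s by (intro mult_left_mono) auto
          then show ?thesis by (simp add: A_def)
        qed
        have A9: "9 * X \<le> A\<^sup>2"
        proof -
          have "(3 * s)\<^sup>2 \<le> A\<^sup>2" using A3 s by (intro power_mono) auto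
          then show ?thesis using s by (simp add: power2_eq_square)
        qed
        have "real_of_int (y ^ 2) \<le> (10 * (A * X))\<^sup>2"
          using disc_bound[of "real_of_int a" A "real_of_int b" X "real_of_int c"] k(2) rb A9 AX A3 s
          unfolding y[symmetric] disc3_def A_def[symmetric] by simp
        then have "\<bar>real_of_int y\<bar>\<^sup>2 \<le> (10 * (A * X))\<^sup>2" by simp
        then have yb: "\<bar>real_of_int y\<bar> \<le> 10 * (A * X)"
          by (rule power2_le_imp_le) (use A3 s X1 in auto)
        \<comment> \<open>Chosen so that 3/2 * 26/15 * 10 = 26, the constant in
          \<open>block\<close>.\<close>
        have "sqrt 3 \<le> 26 / 15" by (rule real_le_lsqrt) (auto simp: power2_eq_square)
        then have "3 * sqrt 3 / 2 * \<bar>real_of_int y\<bar> \<le> 3 * (26 / 15) / 2 * (10 * (A * X))"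
          using yb by (intro mult_mono) auto
        then have "3 * sqrt 3 / 2 * \<bar>real_of_int y\<bar> \<le> 26 * A * X" by simp
        moreover have "(cmod \<delta>)\<^sup>2 * \<bar>Im (\<delta> * \<kappa> ^ 3)\<bar> = \<bar>(cmod \<delta>)\<^sup>2 * Im (\<delta> * \<kappa> ^ 3)\<bar>"
          by (simp only: abs_mult abs_power2)
        then have "(cmod \<delta>)\<^sup>2 * \<bar>Im (\<delta> * \<kappa> ^ 3)\<bar> = 3 * sqrt 3 / 2 * \<bar>real_of_int y\<bar>"
          unfolding Y by (simp add: abs_mult)
        ultimately have ImA: "(cmod \<delta>)\<^sup>2 * \<bar>Im (\<delta> * \<kappa> ^ 3)\<bar> \<le> 26 * A * X" by simp
        have "\<bar>(real_of_int a)\<^sup>2 - (cmod \<delta>)\<^sup>2 * (cmod \<kappa>)\<^sup>2\<bar> \<le> 3 * X" unfolding P using rb(1) by simp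
        then have "(a, \<delta>, \<kappa>) \<in> block X A"
          unfolding block_def using dk k ImA by (simp add: A_def)
        then have "(a, \<delta>, \<kappa>) \<in> U" unfolding U_def A_def using kK by blast
        then show ?thesis using gq by blast
      qed
    qed
  qed
  have fin: "finite (Z \<union> g ` (I \<times> G) \<union> g ` U)" using Z IG U by simp
  show "finite (square_disc_triples N)" by (rule finite_subset[OF sub fin])
  have "card (square_disc_triples N) \<le> card (Z \<union> g ` (I \<times> G) \<union> g ` U)" by (rule card_mono[OF fin sub])
  also have "\<dots> \<le> card (Z \<union> g ` (I \<times> G)) + card (g ` U)" by (rule card_Un_le)
  also have "\<dots> \<le> card Z + card (g ` (I \<times> G)) + card (g ` U)" by (intro add_right_mono card_Un_le)
  also have "\<dots> \<le> card Z + card (I \<times> G) + card U"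
    using IG U by (intro add_mono order_refl card_image_le)
  finally have "real (card (square_disc_triples N)) \<le> real (card Z + card (I \<times> G) + card U)"
    unfolding of_nat_le_iff .
  then have "real (card (square_disc_triples N)) \<le> real (card Z) + real (card (I \<times> G)) + real (card U)" by simp
  then have "real (card (square_disc_triples N)) \<le> 3 * X + 84 * (X * s) * ?S\<^sup>2 + (log 2 X + 1) * (48000 * X * s * ?S)"
    using Z(2) IG(2) U(2) by linarith
  then show "real (card (square_disc_triples N)) \<le> 3 * X + 84 * (X * sqrt X) * ?S\<^sup>2
      + (log 2 X + 1) * (48000 * X * sqrt X * ?S)" by (simp add: s_def)
qed

section \<open>Assembling the error term\<close>

lemma E3_error_bound:
  fixes H :: real
  assumes H: "H \<ge> 8"
  defines "L \<equiv> 3 + 2 * ln (4 * H)"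
  shows "\<bar>real (E3 H) - 8 * (pi\<^sup>2 / 6 + 1 / 4) * H\<^sup>2\<bar>
    \<le> 46 * H * (1 + L) ^ 3 + 3 * H + 84 * (H * sqrt H) * (4 / 3 * L\<^sup>2)\<^sup>2
      + (log 2 H + 1) * (48000 * (H * sqrt H) * (4 / 3 * L\<^sup>2)) + 48 * H"
proof -
  define n where "n = nat \<lfloor>H\<rfloor>"
  define N where "N = int n"
  have n8: "n \<ge> 8" using H by (simp add: n_def le_nat_iff le_floor_iff)
  have NH: "N = \<lfloor>H\<rfloor>" using H by (simp add: N_def n_def)
  have nH: "real n \<le> H" "H < real n + 1" using H unfolding n_def by linarith+
  have N1: "N \<ge> 1" using n8 by (simp add: N_def)
  define E where "E = {(a1 :: int, a2 :: int, a3 :: int).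
      \<bar>real_of_int a1\<bar> \<le> H \<and> \<bar>real_of_int a2\<bar> \<le> H \<and> \<bar>real_of_int a3\<bar> \<le> H \<and> not_S3 a1 a2 a3}"
  have leH: "\<bar>real_of_int a\<bar> \<le> H \<longleftrightarrow> \<bar>a\<bar> \<le> N" for a
    unfolding NH le_floor_iff by simp
  have sub1: "root_triples N \<subseteq> E"
    using int_root_imp_not_S3 by (auto simp: root_triples_def E_def leH)
  have sub2: "E \<subseteq> root_triples N \<union> square_disc_triples N"
  proof
    fix p assume "p \<in> E"
    then obtain a b c where p: "p = (a, b, c)" "\<bar>a\<bar> \<le> N" "\<bar>b\<bar> \<le> N" "\<bar>c\<bar> \<le> N" "not_S3 a b c"
      by (auto simp: E_def leH)
    show "p \<in> root_triples N \<union> square_disc_triples N"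
    proof (cases "\<exists>r. r ^ 3 + a * r ^ 2 + b * r + c = 0")
      case True
      then show ?thesis using p by (simp add: root_triples_def)
    next
      case False
      then have "\<exists>y. disc3 a b c = y ^ 2" using not_S3_imp[OF p(5)] by blast
      then show ?thesis using p by (simp add: square_disc_triples_def)
    qed
  qed
  have sd: "finite (square_disc_triples N)" using card_square_disc_triples(1)[OF N1] by simp
  have "root_triples N \<subseteq> {-N..N} \<times> {-N..N} \<times> {-N..N}" by (auto simp: root_triples_def)
  then have fr: "finite (root_triples N)" by (rule finite_subset) simp
  have fE: "finite E" using sub2 fr sd by (auto intro: finite_subset)
  have c1: "card (root_triples N) \<le> card E" by (rule card_mono[OF fE sub1])
  have "card E \<le> card (root_triples N \<union> square_disc_triples N)" using fr sd by (intro card_mono sub2) auto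
  also have "\<dots> \<le> card (root_triples N) + card (square_disc_triples N)" by (rule card_Un_le)
  finally have c2: "card E \<le> card (root_triples N) + card (square_disc_triples N)" .
  have E3: "E3 H = card E" by (simp add: E3_def E_def)
  define \<kappa> where "\<kappa> = 8 * (pi\<^sup>2 / 6 + 1 / 4)"
  \<comment> \<open>Needed for passing from n = \<lfloor>H\<rfloor> to H: H^2 - n^2 \<le> 2H, so the
    main term changes by at most 48H.\<close>
  have \<kappa>: "0 \<le> \<kappa>" "\<kappa> \<le> 24"
  proof -
    have "pi\<^sup>2 \<le> 4\<^sup>2" using pi_less_4 by (intro power_mono) auto
    then show "\<kappa> \<le> 24" "0 \<le> \<kappa>" by (simp_all add: \<kappa>_def)
  qed
  have main: "\<bar>real (card (root_triples N)) - \<kappa> * (real n)\<^sup>2\<bar> \<le> 46 * real n * (1 + hatsum N) ^ 3"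
    using card_root_triples[OF n8] by (simp add: N_def \<kappa>_def)
  have L0: "L \<ge> 0" using H by (simp add: L_def)
  \<comment> \<open>The range 4N is that of the coordinates in \<open>Eball_Esum\<close>, whence the
    4H inside the logarithm of L.\<close>
  have h4: "hatsum (4 * N) \<le> L"
  proof -
    have "hatsum (int (4 * n)) \<le> 3 + 2 * ln (real (4 * n))" using n8 by (intro hatsum_le) simp
    also have "\<dots> \<le> L" unfolding L_def using nH n8 by simp
    finally show ?thesis by (simp add: N_def)
  qed
  have h: "hatsum N \<le> L" using hatsum_mono[of N "4 * N"] h4 N1 by simp
  let ?S = "Esum (12 * real_of_int N)"
  have S: "?S \<le> 4 / 3 * L\<^sup>2"
  proof -
    have "?S \<le> 4 / 3 * (hatsum (4 * N))\<^sup>2" using Eball_Esum(2)[OF N1] by simp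
    also have "\<dots> \<le> 4 / 3 * L\<^sup>2" using h4 hatsum_nonneg by (intro mult_left_mono power_mono) auto
    finally show ?thesis .
  qed
  have Nn: "real_of_int N = real n" by (simp add: N_def)
  have nn: "real n * sqrt (real n) \<le> H * sqrt H" using nH H by (intro mult_mono) auto
  have "46 * real n * (1 + hatsum N) ^ 3 \<le> 46 * H * (1 + L) ^ 3"
    using nH h hatsum_nonneg[of N] H by (intro mult_mono power_mono) auto
  moreover have "real (card (square_disc_triples N)) \<le> 3 * H + 84 * (H * sqrt H) * (4 / 3 * L\<^sup>2)\<^sup>2
      + (log 2 H + 1) * (48000 * (H * sqrt H) * (4 / 3 * L\<^sup>2))"
  proof -
    have "real (card (square_disc_triples N)) \<le> 3 * real n + 84 * (real n * sqrt (real n)) * ?S\<^sup>2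
      + (log 2 (real n) + 1) * (48000 * (real n * sqrt (real n)) * ?S)"
      using card_square_disc_triples(2)[OF N1 refl] by (simp add: Nn mult.assoc)
    also have "\<dots> \<le> 3 * H + 84 * (H * sqrt H) * (4 / 3 * L\<^sup>2)\<^sup>2
      + (log 2 H + 1) * (48000 * (H * sqrt H) * (4 / 3 * L\<^sup>2))"
    proof (intro add_mono)
      show "84 * (real n * sqrt (real n)) * ?S\<^sup>2 \<le> 84 * (H * sqrt H) * (4 / 3 * L\<^sup>2)\<^sup>2"
        using nn S Esum_nonneg H nH by (intro mult_mono power_mono) auto
      show "(log 2 (real n) + 1) * (48000 * (real n * sqrt (real n)) * ?S)
         \<le> (log 2 H + 1) * (48000 * (H * sqrt H) * (4 / 3 * L\<^sup>2))"
        using nn S Esum_nonneg H nH n8 by (intro mult_mono) auto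
    qed (use nH in simp)
    finally show ?thesis .
  qed
  moreover have "\<bar>real (card E) - real (card (root_triples N))\<bar> \<le> real (card (square_disc_triples N))"
    using c1 c2 by linarith
  moreover have "0 \<le> \<kappa> * H\<^sup>2 - \<kappa> * (real n)\<^sup>2" "\<kappa> * H\<^sup>2 - \<kappa> * (real n)\<^sup>2 \<le> 48 * H"
  proof -
    have e: "\<kappa> * H\<^sup>2 - \<kappa> * (real n)\<^sup>2 = \<kappa> * ((H - real n) * (H + real n))"
      by (simp add: algebra_simps power2_eq_square)
    show "0 \<le> \<kappa> * H\<^sup>2 - \<kappa> * (real n)\<^sup>2" unfolding e using \<kappa> nH H by (intro mult_nonneg_nonneg) auto
    have "\<kappa> * ((H - real n) * (H + real n)) \<le> 24 * (1 * (2 * H))" using \<kappa> nH H by (intro mult_mono) auto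
    then show "\<kappa> * H\<^sup>2 - \<kappa> * (real n)\<^sup>2 \<le> 48 * H" unfolding e by simp
  qed
  ultimately have "\<bar>real (card E) - \<kappa> * H\<^sup>2\<bar> \<le> 46 * H * (1 + L) ^ 3 + (3 * H + 84 * (H * sqrt H) * (4 / 3 * L\<^sup>2)\<^sup>2
      + (log 2 H + 1) * (48000 * (H * sqrt H) * (4 / 3 * L\<^sup>2))) + 48 * H"
    using main unfolding abs_le_iff by linarith
  then show ?thesis unfolding E3 \<kappa>_def by simp
qed

theorem theorem1p1:
  fixes \<epsilon> :: real
  assumes "\<epsilon> > 0"
  shows "(\<lambda>H::real. real (E3 H) - 8 * (pi\<^sup>2 / 6 + 1 / 4) * H\<^sup>2)
           \<in> O[at_top](\<lambda>H. H powr (3 / 2 + \<epsilon>))"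
proof -
  define F where "F H = 46 * H * (1 + (3 + 2 * ln (4 * H))) ^ 3 + 3 * H
      + 84 * (H * sqrt H) * (4 / 3 * (3 + 2 * ln (4 * H))\<^sup>2)\<^sup>2
      + (log 2 H + 1) * (48000 * (H * sqrt H) * (4 / 3 * (3 + 2 * ln (4 * H))\<^sup>2)) + 48 * H" for H :: real
  have "(\<lambda>H::real. real (E3 H) - 8 * (pi\<^sup>2 / 6 + 1 / 4) * H\<^sup>2) \<in> O[at_top](F)"
  proof (rule bigoI[of _ 1])
    show "\<forall>\<^sub>F H in at_top. norm (real (E3 H) - 8 * (pi\<^sup>2 / 6 + 1 / 4) * H\<^sup>2) \<le> 1 * norm (F H)"
      using eventually_ge_at_top[of 8]
    proof eventually_elim
      case (elim H)
      then have "\<bar>real (E3 H) - 8 * (pi\<^sup>2 / 6 + 1 / 4) * H\<^sup>2\<bar> \<le> F H"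
        unfolding F_def by (rule E3_error_bound)
      then show ?case by simp
    qed
  qed
  \<comment> \<open>The largest term of F is H^(3/2) times a fourth power of a logarithm, and
    H^\<epsilon> absorbs the logarithms.\<close>
  also have "F \<in> O[at_top](\<lambda>H. H powr (3 / 2 + \<epsilon>))"
    unfolding F_def using assms by real_asymp
  finally show ?thesis .
qed

end
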